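(* Let $F$ be a field of characteristic $p>0$. Let $D$ be a division $p$-algebra of degree $m\ge 2$ over $F$ which is split by a purely inseparable extension $K/F$ of exponent one and finite degree $[K:F]=p^e$ such that $m<[K:F]$. Then there are a derivation $\delta$ on $K$ with $F=\mathrm{Const}(\delta)$ and an irreducible polynomial $f\in K[t;\delta]$ of degree $m$ such that $S_f=K[t;\delta]/K[t;\delta]f$ is a division algebra over $F$ of dimension $mp^e$ with right nucleus (isomorphic to) $D$, left and middle nucleus $K$, and nucleus $D\cap K$ an intermediate field of $K/F$, unequal to $K$.
   Context: A central simple algebra over a field $F$ of characteristic $p$ is a $p$-algebra if its index is a power of $p$; a division $p$-algebra is a $p$-algebra that is a division algebra. The degree of $D$ is $\sqrt{\dim_F D}$. A purely inseparable extension $K/F$ has exponent one if $K^p\subset F\subset K$. For a field $K$ with a derivation $\delta$ (additive, $\delta(ab)=a\delta(b)+\delta(a)b$), $\mathrm{Const}(\delta)=\{a\in K\mid \delta(a)=0\}$. The differential polynomial ring $R=K[t;\delta]$ is the set of polynomials $\sum a_it^i$ ($a_i\in K$) with termwise addition and multiplication determined by $ta=at+\delta(a)$. An element of $R$ is irreducible if it is not a unit and is not a product of two polynomials of strictly smaller degree. For $f\in R$ of degree $m$ and $g\in R$ there are unique $q,r\in R$ with $\deg(r)<m$, $g=qf+r$; write $r=g\bmod_r f$. The Petit algebra $S_f=K[t;\delta]/K[t;\delta]f$ is the set $R_m=\{g\in R\mid \deg(g)<m\}$ with usual addition and multiplication $g\circ h=gh\bmod_r f$; it is a unital, in general nonassociative,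 algebra over $\mathrm{Const}(\delta)$, and $K$ is regarded as a subset of $S_f$. A nonzero (possibly nonassociative) algebra $A$ is a division algebra if for each $a\ne0$ left multiplication $L_a$ and right multiplication $R_a$ by $a$ are bijective. With $[x,y,z]=(xy)z-x(yz)$: $\mathrm{Nuc}_l(A)=\{x\mid [x,A,A]=0\}$, $\mathrm{Nuc}_m(A)=\{x\mid [A,x,A]=0\}$, $\mathrm{Nuc}_r(A)=\{x\mid [A,A,x]=0\}$ are the left, middle, right nucleus and $\mathrm{Nuc}(A)$ is their intersection. $D\cap K$ is formed inside $S_f$, with $D$ identified with $\mathrm{Nuc}_r(S_f)$. Standing assumptions: $m\ge2$, $\delta\neq0$. *)

theory Defs
  imports
    "Jordan_Normal_Form.VS_Connect"
    "HOL-Algebra.QuotRing"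
    "HOL-Algebra.Subrings"
    "HOL-Library.Poly_Mapping"
begin

section \<open>Algebras over a field\<close>

text \<open>
  An algebra over the field type \<open>'f\<close> is presented by a record of type \<open>('f, 'a) module\<close>, which
  has both a ring multiplication and a scalar multiplication. The locale \<open>algebra\<close> of HOL-Algebra
  is restricted to commutative rings, so it cannot be used here.
\<close>

definition nonassoc_algebra :: "('f::field, 'a) module \<Rightarrow> bool" where
  "nonassoc_algebra A \<longleftrightarrow>
     Module.module class_ring A \<and>
     (\<forall>x\<in>carrier A. \<forall>y\<in>carrier A. x \<otimes>\<^bsub>A\<^esub> y \<in> carrier A) \<and>
     (\<forall>x\<in>carrier A. \<forall>y\<in>carrier A. \<forall>z\<in>carrier A.
        (x \<oplus>\<^bsub>A\<^esub> y) \<otimes>\<^bsub>A\<^esub> z = x \<otimes>\<^bsub>A\<^esub> z \<oplus>\<^bsub>A\<^esub> y \<otimes>\<^bsub>A\<^esub> z \<and>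
        z \<otimes>\<^bsub>A\<^esub> (x \<oplus>\<^bsub>A\<^esub> y) = z \<otimes>\<^bsub>A\<^esub> x \<oplus>\<^bsub>A\<^esub> z \<otimes>\<^bsub>A\<^esub> y) \<and>
     (\<forall>c. \<forall>x\<in>carrier A. \<forall>y\<in>carrier A.
        (c \<odot>\<^bsub>A\<^esub> x) \<otimes>\<^bsub>A\<^esub> y = c \<odot>\<^bsub>A\<^esub> (x \<otimes>\<^bsub>A\<^esub> y) \<and>
        x \<otimes>\<^bsub>A\<^esub> (c \<odot>\<^bsub>A\<^esub> y) = c \<odot>\<^bsub>A\<^esub> (x \<otimes>\<^bsub>A\<^esub> y)) \<and>
     \<one>\<^bsub>A\<^esub> \<in> carrier A \<and>
     (\<forall>x\<in>carrier A. \<one>\<^bsub>A\<^esub> \<otimes>\<^bsub>A\<^esub> x = x \<and> x \<otimes>\<^bsub>A\<^esub> \<one>\<^bsub>A\<^esub> = x)"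

text \<open>
  Dimension and finite-dimensionality go through the type-based linear algebra of HOL: in every
  record considered below the scalar multiplication turns the whole type into a vector space, of
  which the carrier is a subspace. The value is \<open>0\<close> for an infinite-dimensional carrier.
\<close>

definition algebra_dim :: "('f::field, 'a::ab_group_add) module \<Rightarrow> nat" where
  "algebra_dim A = vector_space.dim (module.smult A) (carrier A)"

definition finite_dim_algebra :: "('f::field, 'a::ab_group_add) module \<Rightarrow> bool" where
  "finite_dim_algebra A \<longleftrightarrow>
     (\<exists>B. finite B \<and> B \<subseteq> carrier A \<and> carrier A = Modules.module.span (module.smult A) B)"

definition algebra_degree :: "('f::field, 'a::ab_group_add) module \<Rightarrow> real" where
  "algebra_degree A = sqrt (real (algebra_dim A))"

definition division_algebra :: "('f::field, 'a) module \<Rightarrow> bool" where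
  "division_algebra A \<longleftrightarrow>
     nonassoc_algebra A \<and> carrier A \<noteq> {\<zero>\<^bsub>A\<^esub>} \<and>
     (\<forall>a\<in>carrier A - {\<zero>\<^bsub>A\<^esub>}.
        bij_betw (\<lambda>x. a \<otimes>\<^bsub>A\<^esub> x) (carrier A) (carrier A) \<and>
        bij_betw (\<lambda>x. x \<otimes>\<^bsub>A\<^esub> a) (carrier A) (carrier A))"

definition central_simple :: "('f::field, 'a::ab_group_add) module \<Rightarrow> bool" where
  "central_simple A \<longleftrightarrow>
     nonassoc_algebra A \<and> ring A \<and> finite_dim_algebra A \<and> \<one>\<^bsub>A\<^esub> \<noteq> \<zero>\<^bsub>A\<^esub> \<and>
     (\<forall>I. ideal I A \<longrightarrow> I = {\<zero>\<^bsub>A\<^esub>} \<or> I = carrier A) \<and>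
     {z \<in> carrier A. \<forall>x\<in>carrier A. z \<otimes>\<^bsub>A\<^esub> x = x \<otimes>\<^bsub>A\<^esub> z} = range (\<lambda>c. c \<odot>\<^bsub>A\<^esub> \<one>\<^bsub>A\<^esub>)"

definition algebra_iso :: "('f, 'a) module \<Rightarrow> ('f, 'b) module \<Rightarrow> ('a \<Rightarrow> 'b) set" where
  "algebra_iso A B =
     {\<phi> \<in> ring_iso A B. \<forall>c. \<forall>x\<in>carrier A. \<phi> (c \<odot>\<^bsub>A\<^esub> x) = c \<odot>\<^bsub>B\<^esub> \<phi> x}"

subsection \<open>Algebras on whole types and matrix algebras\<close>

definition type_algebra :: "('f \<Rightarrow> 'a::ring_1 \<Rightarrow> 'a) \<Rightarrow> ('f, 'a) module" where
  "type_algebra scale =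
     \<lparr>carrier = UNIV, mult = (*), one = 1, zero = 0, add = (+), smult = scale\<rparr>"

text \<open>
  A field extension is given by an embedding \<open>emb\<close> of the ground field \<open>'f\<close> into \<open>'k\<close>; the
  ground field is identified with \<open>range emb\<close>.
\<close>

definition extension_algebra :: "('f::field \<Rightarrow> 'k::field) \<Rightarrow> ('f, 'k) module" where
  "extension_algebra emb = type_algebra (\<lambda>c x. emb c * x)"

definition mat_algebra :: "('f \<Rightarrow> 'a::ring_1 \<Rightarrow> 'a) \<Rightarrow> nat \<Rightarrow> 'a set \<Rightarrow> ('f, 'a mat) module" where
  "mat_algebra scale n S =
     \<lparr>carrier = {M \<in> carrier_mat n n. elements_mat M \<subseteq> S}, mult = (*), one = 1\<^sub>m n,
      zero = 0\<^sub>m n n, add = (+), smult = \<lambda>c. map_mat (scale c)\<rparr>"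

subsection \<open>Index and p-algebras\<close>

text \<open>
  The index is the degree of the division algebra \<open>E\<close> in a Wedderburn decomposition into
  \<open>n \<times> n\<close> matrices over \<open>E\<close>. HOL cannot quantify over the type of \<open>E\<close>, but \<open>E\<close>, embedded as the
  scalar matrices, may be taken to be a unital subalgebra of the given algebra.
\<close>

definition has_index :: "('f::field \<Rightarrow> 'a::ring_1 \<Rightarrow> 'a) \<Rightarrow> nat \<Rightarrow> bool" where
  "has_index scale d \<longleftrightarrow>
     (\<exists>S n. let E = (type_algebra scale)\<lparr>carrier := S\<rparr> in
        central_simple E \<and> division_algebra E \<and>
        algebra_iso (type_algebra scale) (mat_algebra scale n S) \<noteq> {} \<and>
        algebra_degree E = real d)"

definition p_algebra :: "nat \<Rightarrow> ('f::field \<Rightarrow> 'a::ring_1 \<Rightarrow> 'a) \<Rightarrow> bool" where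
  "p_algebra p scale \<longleftrightarrow> central_simple (type_algebra scale) \<and> (\<exists>k. has_index scale (p ^ k))"

subsection \<open>Scalar extension and splitting\<close>

text \<open>
  \<open>D \<otimes>\<^sub>F K\<close> is the quotient of the monoid ring \<open>\<int>[D \<times> K]\<close>, where the product set is a monoid under
  componentwise multiplication, by the bilinearity relations. The multiples of a relation by an
  element of \<open>D \<times> K\<close> are again relations, so the ideal they generate is just their additive span,
  as in the usual construction of the tensor product of modules.
\<close>

definition product_monoid_ring :: "(('d::ring_1 \<times> 'k::comm_ring_1) \<Rightarrow>\<^sub>0 int) ring" where
  "product_monoid_ring =
     \<lparr>carrier = UNIV,
      mult = (\<lambda>u v. \<Sum>x\<in>Poly_Mapping.keys u. \<Sum>y\<in>Poly_Mapping.keys v.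
                Poly_Mapping.single (fst x * fst y, snd x * snd y)
                  (Poly_Mapping.lookup u x * Poly_Mapping.lookup v y)),
      one = Poly_Mapping.single (1, 1) 1, zero = 0, add = (+)\<rparr>"

definition tensor_relations ::
    "('f \<Rightarrow> 'd::ring_1 \<Rightarrow> 'd) \<Rightarrow> ('f \<Rightarrow> 'k::comm_ring_1) \<Rightarrow> (('d \<times> 'k) \<Rightarrow>\<^sub>0 int) set" where
  "tensor_relations scale emb =
     (let s = (\<lambda>x a. Poly_Mapping.single (x, a) (1::int)) in
        {s (x + y) a - s x a - s y a | x y a. True} \<union>
        {s x (a + b) - s x a - s x b | x a b. True} \<union>
        {s (scale c x) a - s x (emb c * a) | c x a. True})"

definition tensor_ideal ::
    "('f \<Rightarrow> 'd::ring_1 \<Rightarrow> 'd) \<Rightarrow> ('f \<Rightarrow> 'k::comm_ring_1) \<Rightarrow> (('d \<times> 'k) \<Rightarrow>\<^sub>0 int) set" where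
  "tensor_ideal scale emb = genideal product_monoid_ring (tensor_relations scale emb)"

definition pure_tensor ::
    "('f \<Rightarrow> 'd::ring_1 \<Rightarrow> 'd) \<Rightarrow> ('f \<Rightarrow> 'k::comm_ring_1) \<Rightarrow> 'd \<Rightarrow> 'k \<Rightarrow> (('d \<times> 'k) \<Rightarrow>\<^sub>0 int) set" where
  "pure_tensor scale emb x a =
     tensor_ideal scale emb +>\<^bsub>product_monoid_ring\<^esub> Poly_Mapping.single (x, a) 1"

definition scalar_extension ::
    "('f \<Rightarrow> 'd::ring_1 \<Rightarrow> 'd) \<Rightarrow> ('f \<Rightarrow> 'k::comm_ring_1) \<Rightarrow> ('k, (('d \<times> 'k) \<Rightarrow>\<^sub>0 int) set) module" where
  "scalar_extension scale emb =
     (let T = FactRing product_monoid_ring (tensor_ideal scale emb) in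
        ring.extend T (module.fields (\<lambda>a X. pure_tensor scale emb 1 a \<otimes>\<^bsub>T\<^esub> X)))"

definition splits :: "('f \<Rightarrow> 'd::ring_1 \<Rightarrow> 'd) \<Rightarrow> ('f \<Rightarrow> 'k::field) \<Rightarrow> bool" where
  "splits scale emb \<longleftrightarrow>
     (\<exists>n>0. algebra_iso (scalar_extension scale emb)
              (mat_algebra ((*) :: 'k \<Rightarrow> 'k \<Rightarrow> 'k) n UNIV) \<noteq> {})"

section \<open>Purely inseparable extensions\<close>

definition purely_inseparable :: "('f::field \<Rightarrow> 'k::field) \<Rightarrow> bool" where
  "purely_inseparable emb \<longleftrightarrow> (\<forall>x. \<exists>n. x ^ (CHAR('k) ^ n) \<in> range emb)"

definition exponent_one :: "('f::field \<Rightarrow> 'k::field) \<Rightarrow> bool" where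
  "exponent_one emb \<longleftrightarrow> (\<forall>x. x ^ CHAR('k) \<in> range emb)"

section \<open>Nuclei\<close>

definition associator :: "('a, 'm) ring_scheme \<Rightarrow> 'a \<Rightarrow> 'a \<Rightarrow> 'a \<Rightarrow> 'a" where
  "associator A x y z = ((x \<otimes>\<^bsub>A\<^esub> y) \<otimes>\<^bsub>A\<^esub> z) \<ominus>\<^bsub>A\<^esub> (x \<otimes>\<^bsub>A\<^esub> (y \<otimes>\<^bsub>A\<^esub> z))"

definition Nuc_l :: "('a, 'm) ring_scheme \<Rightarrow> 'a set" where
  "Nuc_l A = {x \<in> carrier A. \<forall>y\<in>carrier A. \<forall>z\<in>carrier A. associator A x y z = \<zero>\<^bsub>A\<^esub>}"

definition Nuc_m :: "('a, 'm) ring_scheme \<Rightarrow> 'a set" where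
  "Nuc_m A = {x \<in> carrier A. \<forall>y\<in>carrier A. \<forall>z\<in>carrier A. associator A y x z = \<zero>\<^bsub>A\<^esub>}"

definition Nuc_r :: "('a, 'm) ring_scheme \<Rightarrow> 'a set" where
  "Nuc_r A = {x \<in> carrier A. \<forall>y\<in>carrier A. \<forall>z\<in>carrier A. associator A y z x = \<zero>\<^bsub>A\<^esub>}"

definition Nuc :: "('a, 'm) ring_scheme \<Rightarrow> 'a set" where
  "Nuc A = Nuc_l A \<inter> Nuc_m A \<inter> Nuc_r A"

section \<open>Differential polynomials and Petit algebras\<close>

definition derivation :: "('k::field \<Rightarrow> 'k) \<Rightarrow> bool" where
  "derivation \<delta> \<longleftrightarrow>
     (\<forall>a b. \<delta> (a + b) = \<delta> a + \<delta> b) \<and> (\<forall>a b. \<delta> (a * b) = a * \<delta> b + \<delta> a * b)"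

definition Const :: "('k::field \<Rightarrow> 'k) \<Rightarrow> 'k set" where
  "Const \<delta> = {a. \<delta> a = 0}"

text \<open>
  The elements of \<open>K[t;\<delta>]\<close> are represented by the type \<open>'k poly\<close>, with coefficients written to the
  left of the powers of \<open>t\<close>. Only the additive structure and the degree of that type are used;
  its multiplication is replaced. From \<open>t a = a t + \<delta> a\<close> one gets
  \<open>t (\<Sum> b\<^sub>j t\<^sup>j) = \<Sum> b\<^sub>j t\<^sup>j\<^sup>+\<^sup>1 + \<Sum> \<delta> b\<^sub>j t\<^sup>j\<close>.
\<close>

definition t_mult :: "('k::field \<Rightarrow> 'k) \<Rightarrow> 'k poly \<Rightarrow> 'k poly" where
  "t_mult \<delta> g = pCons 0 g + map_poly \<delta> g"

definition diff_mult :: "('k::field \<Rightarrow> 'k) \<Rightarrow> 'k poly \<Rightarrow> 'k poly \<Rightarrow> 'k poly" where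
  "diff_mult \<delta> f g = (\<Sum>i\<le>degree f. Polynomial.smult (Polynomial.coeff f i) ((t_mult \<delta> ^^ i) g))"

definition diff_poly_ring :: "('k::field \<Rightarrow> 'k) \<Rightarrow> 'k poly ring" where
  "diff_poly_ring \<delta> =
     \<lparr>carrier = UNIV, mult = diff_mult \<delta>, one = 1, zero = 0, add = (+)\<rparr>"

lemma derivation_0: "derivation \<delta> \<Longrightarrow> \<delta> 0 = 0"
  unfolding derivation_def by (metis add_cancel_right_left)

lemma coeff_t_mult:
  "derivation \<delta> \<Longrightarrow> Polynomial.coeff (t_mult \<delta> g) n =
     (if n = 0 then 0 else Polynomial.coeff g (n - 1)) + \<delta> (Polynomial.coeff g n)"
  by (auto simp: t_mult_def coeff_map_poly derivation_0 coeff_pCons split: nat.splits)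

lemma t_mult_add: "derivation \<delta> \<Longrightarrow> t_mult \<delta> (g + h) = t_mult \<delta> g + t_mult \<delta> h"
  by (rule poly_eqI) (auto simp: coeff_t_mult derivation_def)

lemma t_mult_0: "derivation \<delta> \<Longrightarrow> t_mult \<delta> 0 = 0"
  by (rule poly_eqI) (auto simp: coeff_t_mult derivation_0)

lemma t_mult_smult:
  "derivation \<delta> \<Longrightarrow> t_mult \<delta> (Polynomial.smult a g) =
     Polynomial.smult a (t_mult \<delta> g) + Polynomial.smult (\<delta> a) g"
  by (rule poly_eqI) (auto simp: coeff_t_mult derivation_def algebra_simps)

lemma t_mult_pow_add:
  "derivation \<delta> \<Longrightarrow> (t_mult \<delta> ^^ i) (g + h) = (t_mult \<delta> ^^ i) g + (t_mult \<delta> ^^ i) h"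
  by (induction i) (auto simp: t_mult_add)

lemma t_mult_sum: "derivation \<delta> \<Longrightarrow> t_mult \<delta> (sum g A) = (\<Sum>i\<in>A. t_mult \<delta> (g i))"
  by (induction A rule: infinite_finite_induct) (auto simp: t_mult_0 t_mult_add)

lemma diff_mult_alt:
  assumes "degree f \<le> n"
  shows "diff_mult \<delta> f g = (\<Sum>i\<le>n. Polynomial.smult (Polynomial.coeff f i) ((t_mult \<delta> ^^ i) g))"
  unfolding diff_mult_def
  by (rule sum.mono_neutral_left) (use assms in \<open>auto simp: coeff_eq_0 not_le\<close>)

lemma diff_mult_add_left: "diff_mult \<delta> (f + f') g = diff_mult \<delta> f g + diff_mult \<delta> f' g"
proof -
  define n where "n = max (degree f) (degree f')"
  have "degree (f + f') \<le> n" "degree f \<le> n" "degree f' \<le> n"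
    unfolding n_def by (auto intro: degree_add_le)
  then show ?thesis
    by (simp add: diff_mult_alt[of _ n] smult_add_left sum.distrib)
qed

lemma diff_mult_add_right:
  "derivation \<delta> \<Longrightarrow> diff_mult \<delta> f (g + h) = diff_mult \<delta> f g + diff_mult \<delta> f h"
  by (simp add: diff_mult_def t_mult_pow_add smult_add_right sum.distrib)

lemma diff_mult_0_left [simp]: "diff_mult \<delta> 0 g = 0"
  by (simp add: diff_mult_def)

lemma diff_mult_sum_left: "diff_mult \<delta> (sum f A) g = (\<Sum>i\<in>A. diff_mult \<delta> (f i) g)"
  by (induction A rule: infinite_finite_induct) (auto simp: diff_mult_add_left)

lemma diff_mult_smult_left:
  "diff_mult \<delta> (Polynomial.smult a f) g = Polynomial.smult a (diff_mult \<delta> f g)"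
proof -
  have "Polynomial.smult a (\<Sum>i\<in>A. h i) = (\<Sum>i\<in>A. Polynomial.smult a (h i))"
    for h :: "nat \<Rightarrow> 'a poly" and A
    by (induction A rule: infinite_finite_induct) (auto simp: smult_add_right)
  then show ?thesis
    by (cases "a = 0") (auto simp: diff_mult_def)
qed

lemma diff_mult_const: "diff_mult \<delta> [:a:] g = Polynomial.smult a g"
  by (simp add: diff_mult_def)

lemma t_mult_eq: "diff_mult \<delta> [:0, 1:] g = t_mult \<delta> g"
  by (simp add: diff_mult_def)

lemma t_mult_commutation:
  "derivation \<delta> \<Longrightarrow> diff_mult \<delta> [:0, 1:] [:a:] = diff_mult \<delta> [:a:] [:0, 1:] + [:\<delta> a:]"
  by (auto simp: diff_mult_const t_mult_eq t_mult_def derivation_0 map_poly_pCons)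

lemma t_mult_diff_mult:
  assumes "derivation \<delta>"
  shows "diff_mult \<delta> (t_mult \<delta> f) g = t_mult \<delta> (diff_mult \<delta> f g)"
proof -
  have "degree (map_poly \<delta> f) \<le> degree f"
    by (rule degree_le) (auto simp: coeff_map_poly derivation_0[OF assms] coeff_eq_0)
  then have "diff_mult \<delta> (map_poly \<delta> f) g =
      (\<Sum>i\<le>degree f. Polynomial.smult (\<delta> (Polynomial.coeff f i)) ((t_mult \<delta> ^^ i) g))"
    by (simp add: diff_mult_alt[of _ "degree f"] coeff_map_poly derivation_0[OF assms])
  moreover have "diff_mult \<delta> (pCons 0 f) g =
      (\<Sum>i\<le>degree f. Polynomial.smult (Polynomial.coeff f i) ((t_mult \<delta> ^^ Suc i) g))"
    by (simp add: diff_mult_alt[of "pCons 0 f" "Suc (degree f)"] degree_pCons_le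
          sum.atMost_Suc_shift del: sum.atMost_Suc)
  ultimately show ?thesis
    unfolding t_mult_def[of _ f] diff_mult_add_left
    by (simp add: diff_mult_def t_mult_sum t_mult_smult assms sum.distrib)
qed

lemma diff_mult_assoc:
  assumes "derivation \<delta>"
  shows "diff_mult \<delta> (diff_mult \<delta> f g) h = diff_mult \<delta> f (diff_mult \<delta> g h)"
proof -
  have "diff_mult \<delta> ((t_mult \<delta> ^^ i) g) h = (t_mult \<delta> ^^ i) (diff_mult \<delta> g h)" for i
    by (induction i) (auto simp: t_mult_diff_mult assms)
  then show ?thesis
    unfolding diff_mult_def[of \<delta> f] by (simp add: diff_mult_sum_left diff_mult_smult_left)
qed

lemma diff_mult_1_right:
  assumes "derivation \<delta>"
  shows "diff_mult \<delta> f 1 = f"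
proof -
  have "\<delta> 1 = 0"
    using assms unfolding derivation_def by (metis add_cancel_right_left mult.right_neutral mult_1)
  then have "(t_mult \<delta> ^^ i) 1 = Polynomial.monom 1 i" for i
    by (induction i)
       (auto simp: t_mult_def monom_Suc map_poly_monom derivation_0[OF assms])
  then show ?thesis
    by (simp add: diff_mult_def smult_monom poly_as_sum_of_monoms)
qed

lemma ring_diff_poly_ring:
  assumes "derivation \<delta>"
  shows "ring (diff_poly_ring \<delta>)"
proof (rule ringI)
  show "abelian_group (diff_poly_ring \<delta>)"
  proof (rule abelian_groupI)
    show "\<exists>y\<in>carrier (diff_poly_ring \<delta>). y \<oplus>\<^bsub>diff_poly_ring \<delta>\<^esub> x = \<zero>\<^bsub>diff_poly_ring \<delta>\<^esub>" for x
      by (rule bexI[of _ "- x"]) (auto simp: diff_poly_ring_def)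
  qed (auto simp: diff_poly_ring_def algebra_simps)
  show "Group.monoid (diff_poly_ring \<delta>)"
    by (rule monoidI)
       (auto simp: diff_poly_ring_def diff_mult_assoc assms diff_mult_1_right
          diff_mult_const[of _ 1, folded one_pCons])
qed (auto simp: diff_poly_ring_def diff_mult_add_left diff_mult_add_right assms)

definition diff_irreducible :: "('k::field \<Rightarrow> 'k) \<Rightarrow> 'k poly \<Rightarrow> bool" where
  "diff_irreducible \<delta> f \<longleftrightarrow>
     f \<notin> Units (diff_poly_ring \<delta>) \<and>
     \<not> (\<exists>g h. degree g < degree f \<and> degree h < degree f \<and> f = diff_mult \<delta> g h)"

text \<open>
  Since \<open>degree 0 = 0\<close> for the type \<open>'k poly\<close>, the following is meaningful when \<open>degree f > 0\<close>.
\<close>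

definition mod_r :: "('k::field \<Rightarrow> 'k) \<Rightarrow> 'k poly \<Rightarrow> 'k poly \<Rightarrow> 'k poly" where
  "mod_r \<delta> g f = (THE r. degree r < degree f \<and> (\<exists>q. g = diff_mult \<delta> q f + r))"

text \<open>The Petit algebra as an algebra over the subfield \<open>range emb\<close> of \<open>Const \<delta>\<close>.\<close>

definition petit_algebra ::
    "('f::field \<Rightarrow> 'k::field) \<Rightarrow> ('k \<Rightarrow> 'k) \<Rightarrow> 'k poly \<Rightarrow> ('f, 'k poly) module" where
  "petit_algebra emb \<delta> f =
     \<lparr>carrier = {g. degree g < degree f}, mult = (\<lambda>g h. mod_r \<delta> (diff_mult \<delta> g h) f),
      one = 1, zero = 0, add = (+), smult = (\<lambda>c. Polynomial.smult (emb c))\<rparr>"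

definition const_polys :: "'k::field set \<Rightarrow> 'k poly set" where
  "const_polys L = (\<lambda>a. [:a:]) ` L"

end

theory Submission
  imports Defs
begin

text \<open>
  Write \<open>F\<close> for the ground field (embedded in \<open>K\<close> by \<open>emb\<close>), \<open>q = [K:F]\<close> and \<open>R = K[t;\<delta>]\<close>.

  The derivation. A subring between \<open>F\<close> and \<open>K\<close> is a field, and adjoining an element \<open>x\<close> to it gives
  a simple extension of degree \<open>p\<close>, because \<open>x\<^sup>p \<in> F\<close>. A derivation \<open>\<delta>\<close> of \<open>L\<close> with constants \<open>F\<close> has
  a nonzero kernel, so by finite dimension it misses some \<open>c \<in> L\<close>; putting \<open>\<delta> x = c\<close> extends it to
  \<open>L(x)\<close> without new constants. An \<open>L\<close> of maximal dimension is \<open>K\<close> (\<open>exists_derivation_with_constants\<close>).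

  The module. A splitting of \<open>D\<close> is a homomorphism \<open>\<psi>\<close> from \<open>D\<close> to \<open>m \<times> m\<close> matrices over \<open>K\<close> whose
  image spans all matrices (\<open>splits_imp_matrix_representation\<close>, \<open>card_BD\<close>). Hence the space \<open>V = K\<^sup>m\<close> of
  row vectors is a left \<open>K\<close>-space and a right \<open>D\<close>-space. Applying \<open>\<delta>\<close> to the entries of \<open>\<psi>\<close> is a
  derivation of \<open>D\<close> into matrices, and such a derivation is inner, given by a matrix \<open>c\<close>
  (\<open>derivation_of_representation_inner\<close>). So \<open>T v = \<delta> v + v c\<close> commutes with \<open>D\<close> and satisfies
  \<open>T (a v) = a (T v) + \<delta>(a) v\<close>: it makes \<open>V\<close> a left \<open>R\<close>-module on which \<open>D\<close> acts from the right.

  Density. An \<open>F\<close>-dimension count shows that \<open>V\<close> has a \<open>D\<close>-basis of \<open>r = q / m\<close> vectors. The differential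
  polynomials of degree less than \<open>q\<close> act faithfully on \<open>V\<close> (\<open>differential_module_faithful\<close>), because
  the powers \<open>\<delta>\<^sup>i\<close> with \<open>i < q\<close> are linearly independent over \<open>K\<close>. They form a \<open>K\<close>-space of dimension
  \<open>q = r m = dim V\<^sup>r\<close>, so they take arbitrary values on a \<open>D\<close>-basis (\<open>density\<close>). In other words, \<open>R\<close> acts
  on \<open>V\<close> as the full ring of \<open>D\<close>-linear maps; \<open>V\<close> is simple, and only \<open>D\<close> commutes with \<open>R\<close>.

  The Petit algebra. Let \<open>f\<close> be the monic generator of the annihilator of a nonzero vector \<open>u\<close>. Since every
  nonzero vector generates \<open>V\<close>, whose \<open>K\<close>-dimension is \<open>m\<close>, all these annihilators have generators of
  degree \<open>m\<close>; in particular \<open>g v = 0\<close> with \<open>deg g < m\<close> forces \<open>g = 0\<close> or \<open>v = 0\<close>. The map \<open>g \<mapsto> g u\<close>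
  identifies \<open>S\<^sub>f\<close> with \<open>V\<close>, and \<open>(g \<circ> h) u = g (h u)\<close>. Hence \<open>f\<close> is irreducible, \<open>S\<^sub>f\<close> has no zero
  divisors, and finite dimension makes it a division algebra. If \<open>x y = q f + r\<close> with \<open>deg r < m\<close>, the
  associator of \<open>x, y, z\<close> vanishes exactly when \<open>q f z u = 0\<close> (\<open>associator_eq_0_iff\<close>), and this determines
  the nuclei. The right nucleus consists of the \<open>z\<close> with \<open>f z u = 0\<close>; by density these are the \<open>z\<close> for
  which \<open>z u\<close> is of the form \<open>u d\<close>, and \<open>d \<mapsto> z\<close> is the isomorphism from \<open>D\<close>. Finally, \<open>K\<close> is not inside the
  right nucleus: otherwise \<open>f\<close> would commute with \<open>K\<close>, which is impossible for \<open>0 < deg f < q\<close>.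
\<close>

section \<open>Systems of linear equations\<close>

text \<open>
  Gaussian elimination: an equation with a nonzero coefficient expresses one unknown through the
  others, which removes one equation and one unknown.
\<close>

lemma homogeneous_system:
  fixes a :: "'i \<Rightarrow> 'j \<Rightarrow> 'k::field"
  assumes "finite I" "finite J" "card I < card J"
  shows "\<exists>x. (\<exists>j\<in>J. x j \<noteq> 0) \<and> (\<forall>i\<in>I. (\<Sum>j\<in>J. a i j * x j) = 0)"
  using assms
proof (induction I arbitrary: J a rule: finite_induct)
  case empty
  then obtain j where "j \<in> J" by fastforce
  then show ?case by (intro exI[of _ "\<lambda>_. 1"]) auto
next
  case (insert i I)
  show ?case
  proof (cases "\<forall>j\<in>J. a i j = 0")
    case True
    with insert.IH[of J a] insert.prems insert.hyps show ?thesis by auto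
  next
    case False
    then obtain j0 where j0: "j0 \<in> J" "a i j0 \<noteq> 0" by blast
    define J' where "J' = J - {j0}"
    \<comment> \<open>The system in which the unknown j0 is eliminated by means of equation i.\<close>
    define a' where "a' = (\<lambda>i' j. a i' j - a i' j0 * a i j / a i j0)"
    have J': "finite J'" "card I < card J'" "j0 \<notin> J'" "J = insert j0 J'"
      using insert j0 by (auto simp: J'_def)
    from insert.IH[OF J'(1,2), of a'] obtain x where
      x: "\<exists>j\<in>J'. x j \<noteq> 0" "\<And>i'. i' \<in> I \<Longrightarrow> (\<Sum>j\<in>J'. a' i' j * x j) = 0" by blast
    define y where "y = x(j0 := - (\<Sum>j\<in>J'. a i j * x j) / a i j0)"
    have y: "(\<Sum>j\<in>J'. a i' j * y j) = (\<Sum>j\<in>J'. a i' j * x j)" for i'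
      by (rule sum.cong) (use J' in \<open>auto simp: y_def\<close>)
    have s: "(\<Sum>j\<in>J. a i' j * y j) = a i' j0 * y j0 + (\<Sum>j\<in>J'. a i' j * x j)" for i'
      using J' by (simp add: y)
    have "(\<Sum>j\<in>J. a i' j * y j) = 0" if "i' \<in> I" for i'
    proof -
      have "(\<Sum>j\<in>J'. a' i' j * x j) =
          (\<Sum>j\<in>J'. a i' j * x j) - a i' j0 / a i j0 * (\<Sum>j\<in>J'. a i j * x j)"
        by (simp add: a'_def sum_distrib_left sum_subtractf[symmetric] algebra_simps)
      with x(2)[OF that] show ?thesis
        unfolding s by (simp add: y_def)
    qed
    moreover have "(\<Sum>j\<in>J. a i j * y j) = 0"
      unfolding s using j0 by (simp add: y_def)
    moreover have "\<exists>j\<in>J. y j \<noteq> 0"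
      using x(1) J' by (auto simp: y_def)
    ultimately show ?thesis by blast
  qed
qed

text \<open>
  Stated for families, so that repeated vectors count as dependent.
\<close>

lemma (in vector_space) family_dependent:
  assumes "finite B" "finite J" "card B < card J" "\<And>j. j \<in> J \<Longrightarrow> v j \<in> span B"
  shows "\<exists>x. (\<exists>j\<in>J. x j \<noteq> 0) \<and> (\<Sum>j\<in>J. scale (x j) (v j)) = 0"
proof -
  have "\<exists>u. v j = (\<Sum>b\<in>B. scale (u b) b)" if "j \<in> J" for j
    using assms(4)[OF that] unfolding span_finite[OF assms(1)] by blast
  then obtain u where u: "\<And>j. j \<in> J \<Longrightarrow> v j = (\<Sum>b\<in>B. scale (u j b) b)"
    by metis
  from homogeneous_system[OF assms(1-3), of "\<lambda>b j. u j b"] obtain x where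
    x: "\<exists>j\<in>J. x j \<noteq> 0" "\<And>b. b \<in> B \<Longrightarrow> (\<Sum>j\<in>J. u j b * x j) = 0" by blast
  have "(\<Sum>j\<in>J. scale (x j) (v j)) = (\<Sum>j\<in>J. \<Sum>b\<in>B. scale (u j b * x j) b)"
    by (rule sum.cong) (simp_all add: u scale_sum_right mult.commute)
  also have "\<dots> = (\<Sum>b\<in>B. scale (\<Sum>j\<in>J. u j b * x j) b)"
    by (subst sum.swap) (simp add: scale_sum_left)
  also have "\<dots> = 0"
    by (simp add: x)
  finally show ?thesis using x(1) by blast
qed

text \<open>
  The images of the basis vectors together with a target vector are one too many to be
  independent, and by injectivity the target occurs in the relation with a nonzero coefficient.
\<close>

lemma (in vector_space) injective_endomorphism_surjective:
  assumes "finite B" "independent B"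
    and add: "\<And>x y. L (x + y) = L x + L y" and hom: "\<And>c x. L (scale c x) = scale c (L x)"
    and into: "\<And>x. x \<in> span B \<Longrightarrow> L x \<in> span B"
    and inj: "\<And>x. x \<in> span B \<Longrightarrow> L x = 0 \<Longrightarrow> x = 0"
    and w: "w \<in> span B"
  shows "\<exists>x\<in>span B. L x = w"
proof -
  \<comment> \<open>The index None stands for the target vector.\<close>
  define v where "v = (\<lambda>j. case j of None \<Rightarrow> w | Some b \<Rightarrow> L b)"
  let ?J = "insert None (Some ` B)"
  have "card B < card ?J" using assms(1) by (simp add: card_image)
  moreover have "v j \<in> span B" if "j \<in> ?J" for j
    using that w into span_base by (auto simp: v_def)
  ultimately obtain x where x: "\<exists>j\<in>?J. x j \<noteq> 0" "(\<Sum>j\<in>?J. scale (x j) (v j)) = 0"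
    using family_dependent[OF assms(1), of ?J v] assms(1) by blast
  define y where "y = (\<Sum>b\<in>B. scale (x (Some b)) b)"
  have y: "y \<in> span B" unfolding y_def by (intro span_sum span_scale span_base)
  have L0: "L 0 = 0" using add[of 0 0] by (metis add.right_neutral add_left_cancel)
  have "L (\<Sum>b\<in>A. scale (x (Some b)) b) = (\<Sum>b\<in>A. scale (x (Some b)) (L b))" for A
    by (induction A rule: infinite_finite_induct) (auto simp: L0 add hom)
  then have eq: "scale (x None) w + L y = 0"
    using x(2) assms(1) by (simp add: sum.reindex v_def y_def)
  have "x None \<noteq> 0"
  proof
    assume zero: "x None = 0"
    then have "y = 0" using eq inj[OF y] by simp
    then have "x (Some b) = 0" if "b \<in> B" for b
      using independentD[OF assms(2,1) order_refl _ that] by (simp add: y_def)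
    then show False using x(1) zero by auto
  qed
  have "L y = - scale (x None) w" using eq by (simp add: eq_neg_iff_add_eq_0 add.commute)
  then have "L (scale (- inverse (x None)) y) = w"
    using \<open>x None \<noteq> 0\<close> by (simp only: hom) simp
  moreover have "scale (- inverse (x None)) y \<in> span B" using y by (rule span_scale)
  ultimately show ?thesis by blast
qed

lemma sum_mult_sum_assoc:
  fixes f :: "'a \<Rightarrow> 'k::comm_ring_1"
  shows "(\<Sum>x\<in>A. f x * (\<Sum>y\<in>B. g x y * h y)) = (\<Sum>y\<in>B. (\<Sum>x\<in>A. f x * g x y) * h y)"
  unfolding sum_distrib_left sum_distrib_right by (subst sum.swap) (simp add: mult.assoc)

lemma sum_mult_sum_left_commute:
  fixes f :: "'a \<Rightarrow> 'k::comm_ring_1"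
  shows "(\<Sum>x\<in>A. f x * (\<Sum>y\<in>B. g y * h x y)) = (\<Sum>y\<in>B. g y * (\<Sum>x\<in>A. f x * h x y))"
  unfolding sum_distrib_left by (subst sum.swap) (simp add: mult.left_commute)

section \<open>Derivations with a prescribed field of constants\<close>

text \<open>
  In \<open>u w = (X - x)\<^sup>j\<close> all factors \<open>X - x\<close> must be absorbed by \<open>w\<close>.
\<close>

lemma cofactor_of_linear_power_constant:
  fixes u w :: "'k::field poly"
  assumes "u * w = [:- x, 1:] ^ j" "poly u x \<noteq> 0"
  shows "degree u = 0"
  using assms(1)
proof (induction j arbitrary: w)
  case 0
  then have "u dvd 1" by (metis dvd_triv_left power_0)
  then show ?case by (auto simp: is_unit_poly_iff)
next
  case (Suc j)
  have "poly (u * w) x = 0" by (simp add: Suc.prems)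
  then have "poly w x = 0" using assms(2) by simp
  then obtain w' where "w = [:- x, 1:] * w'"
    by (auto simp: poly_eq_0_iff_dvd elim: dvdE)
  with Suc.prems have "[:- x, 1:] * (u * w') = [:- x, 1:] * [:- x, 1:] ^ j"
    by (simp add: algebra_simps)
  then have "u * w' = [:- x, 1:] ^ j"
    by (subst (asm) mult_cancel_left) auto
  then show ?case by (rule Suc.IH)
qed

lemma divisor_of_linear_power:
  fixes g :: "'k::field poly"
  assumes "g dvd [:- x, 1:] ^ j" "lead_coeff g = 1"
  shows "g = [:- x, 1:] ^ degree g"
proof -
  have "g \<noteq> 0" using assms(2) by auto
  obtain u where u: "g = [:- x, 1:] ^ order x g * u" "\<not> [:- x, 1:] dvd u"
    using order_decomp[OF \<open>g \<noteq> 0\<close>] by blast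
  obtain h where h: "[:- x, 1:] ^ j = g * h" using assms(1) by blast
  have "u * ([:- x, 1:] ^ order x g * h) = [:- x, 1:] ^ j"
    by (subst h, subst (2) u(1)) (simp only: ac_simps)
  then have "degree u = 0"
    by (rule cofactor_of_linear_power_constant) (use u(2) in \<open>simp add: poly_eq_0_iff_dvd\<close>)
  then obtain c where c: "u = [:c:]" by (metis degree_eq_zeroE)
  have "lead_coeff g = c"
    using arg_cong[OF u(1), of lead_coeff]
    by (simp only: lead_coeff_mult lead_coeff_power) (simp add: c)
  then have "c = 1" using assms(2) by simp
  then have "g = [:- x, 1:] ^ order x g" using u(1) c by (simp add: one_pCons[symmetric])
  then show ?thesis by (metis degree_linear_power)
qed

lemma linear_power_CHAR:
  fixes x :: "'k::field"
  assumes "prime CHAR('k)"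
  shows "[:- x, 1:] ^ CHAR('k) = Polynomial.monom 1 CHAR('k) - [:x ^ CHAR('k):]"
proof -
  have "[:- x, 1:] ^ CHAR('k) = (Polynomial.monom 1 1 + [:- x:]) ^ CHAR('k)"
    by (simp add: monom_altdef)
  also have "\<dots> = Polynomial.monom 1 1 ^ CHAR('k) + [:- x:] ^ CHAR('k)"
    by (rule freshmans_dream) (use assms in auto)
  also have "\<dots> = Polynomial.monom 1 CHAR('k) + [:(- x) ^ CHAR('k):]"
    by (simp add: monom_power poly_const_pow)
  finally show ?thesis
    using assms by (simp add: minus_power_prime_CHAR)
qed

definition polys_over :: "'k::field set \<Rightarrow> 'k poly set" where
  "polys_over L = {g. \<forall>i. Polynomial.coeff g i \<in> L}"

definition derivation_on :: "'k::field set \<Rightarrow> ('k \<Rightarrow> 'k) \<Rightarrow> bool" where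
  "derivation_on L \<delta> \<longleftrightarrow>
     (\<forall>a\<in>L. \<delta> a \<in> L) \<and> (\<forall>a\<in>L. \<forall>b\<in>L. \<delta> (a + b) = \<delta> a + \<delta> b \<and> \<delta> (a * b) = a * \<delta> b + \<delta> a * b)"

locale exponent_one_extension = field_hom emb for emb :: "'f::field \<Rightarrow> 'k::field" +
  assumes prime_CHAR: "prime CHAR('k)"
    and power_CHAR: "x ^ CHAR('k) \<in> range emb"
begin

text \<open>
  A subring of \<open>K\<close> containing \<open>F\<close> is an intermediate field: it is closed under subtraction because
  \<open>- 1 \<in> F\<close>, and under inverses because \<open>x\<inverse> = x\<^sup>p\<^sup>-\<^sup>1 / x\<^sup>p\<close> with \<open>x\<^sup>p \<in> F\<close>.
\<close>

definition intermediate_ring :: "'k set \<Rightarrow> bool" where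
  "intermediate_ring L \<longleftrightarrow>
     range emb \<subseteq> L \<and> (\<forall>x\<in>L. \<forall>y\<in>L. x + y \<in> L \<and> x * y \<in> L)"

end

locale intermediate_extension = exponent_one_extension +
  fixes L assumes L: "intermediate_ring L"
begin

lemma L_emb [simp]: "emb c \<in> L"
  using L by (auto simp: intermediate_ring_def)

lemma L_add: "x \<in> L \<Longrightarrow> y \<in> L \<Longrightarrow> x + y \<in> L"
  and L_mult: "x \<in> L \<Longrightarrow> y \<in> L \<Longrightarrow> x * y \<in> L"
  using L by (auto simp: intermediate_ring_def)

lemma L_0 [simp]: "0 \<in> L" and L_1 [simp]: "1 \<in> L"
  using L_emb[of 0] L_emb[of 1] by (simp_all del: L_emb)

lemma L_minus: "x \<in> L \<Longrightarrow> - x \<in> L"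
  using L_mult[OF L_emb[of "- 1"], of x] by (simp add: hom_uminus del: L_emb)

lemma L_diff: "x \<in> L \<Longrightarrow> y \<in> L \<Longrightarrow> x - y \<in> L"
  using L_add[of x "- y"] L_minus by simp

lemma L_power: "x \<in> L \<Longrightarrow> x ^ n \<in> L"
  by (induction n) (auto intro: L_mult)

lemma L_of_nat [simp]: "of_nat n \<in> L"
  by (induction n) (auto intro: L_add)

lemma L_sum: "(\<And>i. i \<in> A \<Longrightarrow> f i \<in> L) \<Longrightarrow> sum f A \<in> L"
  by (induction A rule: infinite_finite_induct) (auto intro: L_add)

lemma L_inverse:
  assumes "x \<in> L" shows "inverse x \<in> L"
proof (cases "x = 0")
  case False
  let ?p = "CHAR('b)"
  obtain c where c: "x ^ ?p = emb c" using power_CHAR by blast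
  have "?p = Suc (?p - 1)" using prime_gt_0_nat[OF prime_CHAR] by simp
  then have "x * x ^ (?p - 1) = emb c" by (metis c power_Suc)
  moreover have "c \<noteq> 0" using c False by auto
  then have "emb c * emb (inverse c) = 1" by (simp flip: hom_mult)
  ultimately have "x * (x ^ (?p - 1) * emb (inverse c)) = 1" by (simp flip: mult.assoc)
  then have "inverse x = x ^ (?p - 1) * emb (inverse c)" by (rule inverse_unique)
  then show ?thesis using L_mult L_power assms by simp
qed simp

lemma PO_0 [simp]: "0 \<in> polys_over L"
  and PO_add: "g \<in> polys_over L \<Longrightarrow> h \<in> polys_over L \<Longrightarrow> g + h \<in> polys_over L"
  and PO_diff: "g \<in> polys_over L \<Longrightarrow> h \<in> polys_over L \<Longrightarrow> g - h \<in> polys_over L"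
  and PO_mult: "g \<in> polys_over L \<Longrightarrow> h \<in> polys_over L \<Longrightarrow> g * h \<in> polys_over L"
  and PO_smult: "a \<in> L \<Longrightarrow> g \<in> polys_over L \<Longrightarrow> Polynomial.smult a g \<in> polys_over L"
  and PO_monom: "a \<in> L \<Longrightarrow> Polynomial.monom a n \<in> polys_over L"
  and PO_const: "a \<in> L \<Longrightarrow> [:a:] \<in> polys_over L"
  by (auto simp: polys_over_def coeff_mult coeff_pCons
      intro!: L_add L_diff L_mult L_sum split: nat.splits)

lemma monic_division_over:
  assumes "N \<in> polys_over L" "lead_coeff N = 1" "g \<in> polys_over L" "degree N > 0"
  shows "\<exists>q\<in>polys_over L. \<exists>r\<in>polys_over L. degree r < degree N \<and> g = q * N + r"
  using assms(3)
proof (induction "degree g" arbitrary: g rule: less_induct)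
  case less
  show ?case
  proof (cases "degree g < degree N")
    case True
    then show ?thesis using less.prems by (intro bexI[of _ 0] bexI[of _ g]) auto
  next
    case False
    define l where "l = Polynomial.monom (lead_coeff g) (degree g - degree N)"
    have l: "l \<in> polys_over L" using less.prems by (auto simp: l_def polys_over_def)
    define h where "h = g - l * N"
    have h: "h \<in> polys_over L" using l less.prems assms(1) by (auto simp: h_def intro!: PO_diff PO_mult)
    have "degree (l * N) \<le> degree g"
      using degree_mult_le[of l N] degree_monom_le[of "lead_coeff g" "degree g - degree N"] False
      by (auto simp: l_def)
    then have "degree h \<le> degree g" by (auto simp: h_def intro: degree_diff_le)
    moreover have "Polynomial.coeff h (degree g) = 0"
      using assms(2) False by (simp add: h_def l_def coeff_monom_mult)
    ultimately have "h = 0 \<or> degree h < degree g" by (rule eq_zero_or_degree_less)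
    then have "\<exists>q\<in>polys_over L. \<exists>r\<in>polys_over L. degree r < degree N \<and> h = q * N + r"
    proof
      assume "h = 0"
      then show ?thesis using assms(4) by (intro bexI[of _ 0]) auto
    qed (use less.hyps h in blast)
    then obtain q r where "q \<in> polys_over L" "r \<in> polys_over L" "degree r < degree N" "h = q * N + r"
      by blast
    then show ?thesis using l
      by (intro bexI[of _ "q + l"] bexI[of _ r]) (auto simp: h_def algebra_simps intro!: PO_add)
  qed
qed

text \<open>
  The minimal polynomial of \<open>x\<close> over \<open>L\<close> divides \<open>X\<^sup>p - x\<^sup>p = (X - x)\<^sup>p\<close>, so it is \<open>(X - x)\<^sup>s\<close> for some \<open>s\<close>.
  If \<open>s < p\<close>, its second coefficient \<open>- s x\<close> puts \<open>x\<close> into \<open>L\<close>.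
\<close>

lemma no_root_of_small_degree:
  assumes x: "x \<notin> L" and g: "g \<in> polys_over L" "poly g x = 0" "degree g < CHAR('b)"
  shows "g = 0"
proof (rule ccontr)
  assume "g \<noteq> 0"
  define P where "P = (\<lambda>h. h \<in> polys_over L \<and> h \<noteq> 0 \<and> poly h x = 0)"
  have "P g" using g \<open>g \<noteq> 0\<close> by (simp add: P_def)
  then obtain h0 where h0: "P h0" "\<And>h. P h \<Longrightarrow> degree h0 \<le> degree h"
    using ex_has_least_nat[of P g degree] by blast
  \<comment> \<open>The minimal polynomial of x over L.\<close>
  define h where "h = Polynomial.smult (inverse (lead_coeff h0)) h0"
  have deg: "degree h = degree h0" using h0(1) by (simp add: h_def P_def)
  have h: "h \<in> polys_over L" "poly h x = 0" "lead_coeff h = 1"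
    using h0(1) L_inverse PO_smult by (auto simp: h_def P_def polys_over_def)
  have "degree h > 0"
  proof (rule ccontr)
    assume "\<not> degree h > 0"
    then obtain c where "h = [:c:]" using degree_eq_zeroE by blast
    then show False using h by auto
  qed
  have small: "degree h < CHAR('b)"
    using h0(2)[OF \<open>P g\<close>] g deg by simp
  obtain c where c: "x ^ CHAR('b) = emb c" using power_CHAR by blast
  have "[:- x, 1:] ^ CHAR('b) \<in> polys_over L"
    unfolding linear_power_CHAR[OF prime_CHAR] c by (intro PO_diff PO_monom PO_const) auto
  from monic_division_over[OF h(1) h(3) this \<open>degree h > 0\<close>] obtain q r where
    qr: "r \<in> polys_over L" "degree r < degree h" "[:- x, 1:] ^ CHAR('b) = q * h + r" by blast
  have "poly ([:- x, 1:] ^ CHAR('b)) x = 0"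
    using prime_gt_0_nat[OF prime_CHAR] by (simp add: poly_power)
  then have "poly r x = 0" using qr(3) h(2) by simp
  then have "r = 0" using h0(2)[of r] qr deg by (auto simp: P_def)
  then have "h dvd [:- x, 1:] ^ CHAR('b)" using qr(3) by simp
  then have eq: "h = [:- x, 1:] ^ degree h" using divisor_of_linear_power h(3) by blast
  have "Polynomial.coeff h (degree h - 1) = of_nat (degree h) * (- x)"
    using \<open>degree h > 0\<close> coeff_linear_poly_power[of "degree h - 1" "degree h" "- x" 1]
    by (subst eq) (cases "degree h", auto)
  moreover have "of_nat (degree h) \<noteq> (0::'b)"
    using small \<open>degree h > 0\<close> by (auto simp: of_nat_eq_0_iff_char_dvd dest: dvd_imp_le)
  ultimately have "x = - (inverse (of_nat (degree h)) * Polynomial.coeff h (degree h - 1))"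
    by (simp add: field_simps)
  moreover have "\<dots> \<in> L" using h(1) by (auto simp: polys_over_def intro!: L_minus L_mult L_inverse)
  ultimately show False using x by simp
qed

end

context exponent_one_extension
begin

text \<open>
  Elements of \<open>L(x)\<close> are values at \<open>x\<close> of polynomials over \<open>L\<close>, and \<open>D g\<close> is the polynomial whose value at
  \<open>x\<close> must be \<open>\<delta> (g x)\<close> once \<open>\<delta> x = c\<close>. This is well defined because the minimal polynomial
  \<open>N = X\<^sup>p - x\<^sup>p\<close> satisfies \<open>D N = 0\<close>. If \<open>g\<close> of degree \<open>s\<close> with \<open>0 < s < p\<close> gave a constant, comparing the two
  highest coefficients of \<open>D g = 0\<close> would exhibit \<open>c\<close> as a value of \<open>\<delta>\<close> on \<open>L\<close>.
\<close>

lemma extend_derivation: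
  assumes L: "intermediate_ring L"
    and \<delta>: "derivation_on L \<delta>" "{a \<in> L. \<delta> a = 0} = range emb"
    and x: "x \<notin> L" and c: "c \<in> L" "c \<notin> \<delta> ` L"
  obtains L' \<delta>' where "intermediate_ring L'" "derivation_on L' \<delta>'" "{a \<in> L'. \<delta>' a = 0} = range emb"
    "L \<subset> L'"
proof -
  interpret intermediate_extension emb L
    by unfold_locales (rule L)
  let ?p = "CHAR('k)"
  let ?R = "polys_over L"
  have p0: "?p > 0" using prime_gt_0_nat[OF prime_CHAR] .
  have \<delta>_add: "\<delta> (a + b) = \<delta> a + \<delta> b" and \<delta>_mult: "\<delta> (a * b) = a * \<delta> b + \<delta> a * b"
    and \<delta>_in: "\<delta> a \<in> L" if "a \<in> L" "b \<in> L" for a b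
    using \<delta>(1) that by (auto simp: derivation_on_def)
  have \<delta>_emb: "\<delta> (emb a) = 0" for a using \<delta>(2) by blast
  have emb_of_nat: "emb (of_nat n) = of_nat n" for n by (induction n) (simp_all add: hom_add)
  have \<delta>_0: "\<delta> 0 = 0" and \<delta>_1: "\<delta> 1 = 0"
    using \<delta>_emb[of 0] \<delta>_emb[of 1] by simp_all
  have \<delta>_sum: "\<delta> (sum f A) = (\<Sum>i\<in>A. \<delta> (f i))" if "\<And>i. f i \<in> L" for f :: "nat \<Rightarrow> 'k" and A
    by (induction A rule: infinite_finite_induct) (auto simp: \<delta>_0 \<delta>_add L_sum that)
  have R: "Polynomial.coeff g i \<in> L" if "g \<in> ?R" for g i using that by (simp add: polys_over_def)
  define D where "D = (\<lambda>g. map_poly \<delta> g + Polynomial.smult c (pderiv g))"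
  have coeff_D: "Polynomial.coeff (D g) i =
      \<delta> (Polynomial.coeff g i) + c * (of_nat (Suc i) * Polynomial.coeff g (Suc i))" for g i
    by (simp add: D_def coeff_map_poly \<delta>_0 coeff_pderiv del: of_nat_Suc)
  have D_R: "D g \<in> ?R" if "g \<in> ?R" for g
    using that by (auto simp: polys_over_def coeff_D intro!: L_add L_mult \<delta>_in c simp del: of_nat_Suc)
  have D_add: "D (g + h) = D g + D h" if "g \<in> ?R" "h \<in> ?R" for g h
    by (rule poly_eqI) (simp add: coeff_D \<delta>_add R that algebra_simps del: of_nat_Suc)
  have map_mult: "map_poly \<delta> (g * h) = map_poly \<delta> g * h + g * map_poly \<delta> h"
    if "g \<in> ?R" "h \<in> ?R" for g h
    by (rule poly_eqI)
       (simp add: coeff_map_poly \<delta>_0 coeff_mult \<delta>_sum \<delta>_mult R L_mult that sum.distrib add.commute)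
  have D_mult: "D (g * h) = D g * h + g * D h" if "g \<in> ?R" "h \<in> ?R" for g h
    by (simp add: D_def map_mult that pderiv_mult algebra_simps smult_add_right)
  define N where "N = Polynomial.monom 1 ?p - [:x ^ ?p:]"
  obtain \<alpha> where \<alpha>: "x ^ ?p = emb \<alpha>" using power_CHAR by blast
  have N_R: "N \<in> ?R" unfolding N_def \<alpha> by (intro PO_diff PO_monom PO_const) auto
  have degN: "degree N = ?p"
    unfolding N_def linear_power_CHAR[OF prime_CHAR, symmetric] by (rule degree_linear_power)
  have monicN: "lead_coeff N = 1"
    unfolding N_def linear_power_CHAR[OF prime_CHAR, symmetric] lead_coeff_power by simp
  have Nx: "poly N x = 0" by (simp add: N_def poly_monom)
  have "D N = 0"
  proof (rule poly_eqI)
    fix i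
    have "\<delta> (- emb \<alpha>) = 0" using \<delta>_emb[of "- \<alpha>"] by (simp add: hom_uminus)
    moreover have "of_nat (Suc i) * Polynomial.coeff N (Suc i) = 0"
    proof (cases "Suc i = ?p")
      case True
      then have "of_nat (Suc i) = (0::'k)" by (metis of_nat_CHAR)
      then show ?thesis by (simp only: mult_zero_left)
    qed (simp add: N_def)
    ultimately show "Polynomial.coeff (D N) i = Polynomial.coeff 0 i"
      unfolding coeff_D using p0
      by (auto simp: N_def \<alpha> coeff_pCons \<delta>_0 \<delta>_1 split: nat.splits simp del: of_nat_Suc)
  qed
  have reduce: "\<exists>h\<in>?R. degree h < ?p \<and> poly h x = poly g x \<and> poly (D h) x = poly (D g) x" if g: "g \<in> ?R" for g
  proof -
    obtain q r where "q \<in> ?R" "r \<in> ?R" "degree r < ?p" "g = q * N + r"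
      using monic_division_over[OF N_R monicN g] degN p0 by auto
    then show ?thesis
      by (intro bexI[of _ r]) (auto simp: D_add D_mult PO_mult N_R Nx \<open>D N = 0\<close>)
  qed
  have small: "g = 0" if "g \<in> ?R" "poly g x = 0" "degree g < ?p" for g
    using no_root_of_small_degree[OF x that] .
  have cong: "poly (D g) x = poly (D h) x" if gh: "g \<in> ?R" "h \<in> ?R" "poly g x = poly h x" for g h
  proof -
    have "g - h \<in> ?R" using gh by (intro PO_diff)
    from reduce[OF this] obtain r where "r \<in> ?R" "degree r < ?p" "poly r x = 0"
      "poly (D r) x = poly (D (g - h)) x" using gh by auto
    with small[of r] have "poly (D (g - h)) x = 0" by (auto simp: D_def)
    moreover have "D g = D (g - h) + D h" using D_add[of "g - h" h] gh PO_diff by simp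
    ultimately show ?thesis by simp
  qed
  define L' where "L' = (\<lambda>g. poly g x) ` ?R"
  define \<delta>' where "\<delta>' = (\<lambda>y. poly (D (SOME g. g \<in> ?R \<and> poly g x = y)) x)"
  have \<delta>': "\<delta>' (poly g x) = poly (D g) x" if "g \<in> ?R" for g
  proof -
    have "(SOME h. h \<in> ?R \<and> poly h x = poly g x) \<in> ?R \<and>
        poly (SOME h. h \<in> ?R \<and> poly h x = poly g x) x = poly g x"
      by (rule someI[of _ g]) (use that in blast)
    then show ?thesis unfolding \<delta>'_def using cong that by blast
  qed
  have in_L': "poly g x \<in> L'" if "g \<in> ?R" for g using that by (auto simp: L'_def)
  have sub: "a \<in> L'" if "a \<in> L" for a
    using in_L'[OF PO_const[OF that]] by simp
  have "intermediate_ring L'"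
    unfolding intermediate_ring_def
  proof (intro conjI ballI)
    fix y z assume "y \<in> L'" "z \<in> L'"
    then obtain g h where "g \<in> ?R" "h \<in> ?R" "y = poly g x" "z = poly h x" by (auto simp: L'_def)
    then show "y + z \<in> L'" "y * z \<in> L'"
      using in_L'[OF PO_add[of g h]] in_L'[OF PO_mult[of g h]] by auto
  qed (use sub in auto)
  moreover have "derivation_on L' \<delta>'"
    unfolding derivation_on_def
  proof (intro conjI ballI)
    fix y assume "y \<in> L'"
    then show "\<delta>' y \<in> L'" using \<delta>' D_R by (auto simp: L'_def)
  next
    fix y z assume "y \<in> L'" "z \<in> L'"
    then obtain g h where gh: "g \<in> ?R" "h \<in> ?R" "y = poly g x" "z = poly h x" by (auto simp: L'_def)
    then show "\<delta>' (y + z) = \<delta>' y + \<delta>' z" "\<delta>' (y * z) = y * \<delta>' z + \<delta>' y * z"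
      using \<delta>'[OF PO_add[of g h]] \<delta>'[OF PO_mult[of g h]] \<delta>'[of g] \<delta>'[of h]
      by (simp_all add: D_add D_mult)
  qed
  moreover have "{a \<in> L'. \<delta>' a = 0} = range emb"
  proof
    show "range emb \<subseteq> {a \<in> L'. \<delta>' a = 0}"
    proof safe
      fix a
      show "emb a \<in> L'" using sub by simp
      show "\<delta>' (emb a) = 0"
        using \<delta>'[OF PO_const[of "emb a"]] by (simp add: D_def map_poly_pCons \<delta>_emb \<delta>_0)
    qed
  next
    show "{a \<in> L'. \<delta>' a = 0} \<subseteq> range emb"
    proof safe
      fix y assume y: "y \<in> L'" "\<delta>' y = 0"
      then obtain g0 where g0: "g0 \<in> ?R" "y = poly g0 x" by (auto simp: L'_def)
      then obtain g where g: "g \<in> ?R" "degree g < ?p" "y = poly g x" "poly (D g) x = 0"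
        using reduce[OF g0(1)] \<delta>' y(2) by metis
      have "degree (D g) \<le> degree g"
        by (rule degree_le) (auto simp: coeff_D coeff_eq_0 \<delta>_0)
      then have "D g = 0" using small[of "D g"] D_R g by simp
      then have eq: "\<delta> (Polynomial.coeff g i) + c * (of_nat (Suc i) * Polynomial.coeff g (Suc i)) = 0" for i
        using coeff_D[of g i] by simp
      let ?s = "degree g"
      have "\<delta> (lead_coeff g) = 0" using eq[of ?s] by (simp add: coeff_eq_0)
      then obtain b where b: "lead_coeff g = emb b" using \<delta>(2) R[OF g(1)] by blast
      have "?s = 0"
      proof (rule ccontr)
        assume s: "?s \<noteq> 0"
        define d where "d = of_nat ?s * b"
        have "of_nat ?s \<noteq> (0::'k)"
          using s g(2) by (auto simp: of_nat_eq_0_iff_char_dvd dest: dvd_imp_le)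
        moreover have ed: "emb d = of_nat ?s * lead_coeff g" by (simp add: d_def b hom_mult emb_of_nat)
        moreover have "lead_coeff g \<noteq> 0" using s by auto
        ultimately have d: "emb d \<noteq> 0" by simp
        have e: "\<delta> (Polynomial.coeff g (?s - 1)) + c * emb d = 0"
          using eq[of "?s - 1"] s by (simp add: ed)
        \<comment> \<open>Dividing by the constant \<open>- d\<close> turns the coefficient below the leading one into a preimage of c.\<close>
        define i where "i = emb (- inverse d)"
        have "d \<noteq> 0" using d by auto
        then have "emb d * emb (inverse d) = 1" by (simp flip: hom_mult)
        then have "c * (emb d * i) = - c" by (simp add: i_def hom_uminus)
        moreover have "\<delta> (i * Polynomial.coeff g (?s - 1)) = i * \<delta> (Polynomial.coeff g (?s - 1))"
          by (subst \<delta>_mult) (auto simp: i_def \<delta>_emb R g)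
        moreover have "\<delta> (Polynomial.coeff g (?s - 1)) = - (c * emb d)"
          using e by (simp add: eq_neg_iff_add_eq_0)
        ultimately have "\<delta> (i * Polynomial.coeff g (?s - 1)) = c"
          by (simp add: algebra_simps)
        moreover have "i * Polynomial.coeff g (?s - 1) \<in> L"
          by (auto simp: i_def R g intro!: L_mult)
        ultimately show False using c(2) by blast
      qed
      then obtain a where "g = [:a:]" using degree_eq_zeroE by blast
      then show "y \<in> range emb" using g(3) b by simp
    qed
  qed
  moreover have "x \<in> L'" using in_L'[OF PO_monom[of 1 1]] by (simp add: poly_monom)
  then have "L \<subset> L'" using sub x by blast
  ultimately show ?thesis by (rule that)
qed

lemma vector_space_emb: "vector_space (\<lambda>c x. emb c * x)"
  by unfold_locales (simp_all add: algebra_simps hom_add hom_mult)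

text \<open>
  A derivation kills \<open>1\<close>, so preimages of a basis, together with \<open>1\<close>, would be independent and too
  many. The hypothesis on the dimension says that \<open>K\<close> is of finite degree, since the dimension of an
  infinite-dimensional space is \<open>0\<close> by convention.
\<close>

lemma exists_nonimage_of_derivation:
  assumes fin: "vector_space.dim (\<lambda>c x. emb c * x) (UNIV :: 'k set) > 0"
    and L: "intermediate_ring L"
    and \<delta>: "derivation_on L \<delta>" "{a \<in> L. \<delta> a = 0} = range emb"
  shows "\<exists>c\<in>L. c \<notin> \<delta> ` L"
proof (rule ccontr)
  assume "\<not> ?thesis"
  then have surj: "\<And>c. c \<in> L \<Longrightarrow> \<exists>y\<in>L. \<delta> y = c" by (metis imageE)
  interpret intermediate_extension emb L
    by unfold_locales (rule L)
  interpret V: vector_space "\<lambda>c x. emb c * x" by (rule vector_space_emb)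
  have \<delta>_add: "\<delta> (a + b) = \<delta> a + \<delta> b" and \<delta>_mult: "\<delta> (a * b) = a * \<delta> b + \<delta> a * b"
    if "a \<in> L" "b \<in> L" for a b
    using \<delta>(1) that by (auto simp: derivation_on_def)
  have \<delta>_emb: "\<delta> (emb a) = 0" for a using \<delta>(2) by blast
  obtain B0 where B0: "V.independent B0" "UNIV \<subseteq> V.span B0" "card B0 = V.dim (UNIV :: 'k set)"
    by (rule V.basis_exists[of UNIV])
  then have "finite B0" using fin by (metis card_gt_0_iff)
  obtain B where B: "B \<subseteq> L" "V.independent B" "L \<subseteq> V.span B"
    by (rule V.basis_exists[of L])
  have "finite B"
    using V.independent_span_bound[OF \<open>finite B0\<close> B(2)] B0(2) by blast
  obtain y where y: "\<And>b. b \<in> B \<Longrightarrow> y b \<in> L \<and> \<delta> (y b) = b"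
    using surj B(1) by (metis subsetD)
  \<comment> \<open>The index None stands for the additional vector 1.\<close>
  define v where "v = (\<lambda>j. case j of None \<Rightarrow> 1 | Some b \<Rightarrow> y b)"
  let ?J = "insert None (Some ` B)"
  have "card B < card ?J" using \<open>finite B\<close> by (simp add: card_image)
  moreover have vL: "v j \<in> L" if "j \<in> ?J" for j using that y by (auto simp: v_def)
  ultimately obtain f where f: "\<exists>j\<in>?J. f j \<noteq> 0" "(\<Sum>j\<in>?J. emb (f j) * v j) = 0"
    using V.family_dependent[OF \<open>finite B\<close>, of ?J v] \<open>finite B\<close> B(3) by blast
  have sum: "emb (f None) + (\<Sum>b\<in>B. emb (f (Some b)) * y b) = 0"
    using f(2) \<open>finite B\<close> by (simp add: sum.reindex v_def)
  have "\<delta> (\<Sum>b\<in>A. emb (f (Some b)) * y b) = (\<Sum>b\<in>A. emb (f (Some b)) * b)" if "A \<subseteq> B" for A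
  proof -
    have "finite A" using that \<open>finite B\<close> by (rule finite_subset)
    then show ?thesis using that
    proof (induction A rule: finite_induct)
      case empty
      then show ?case using \<delta>_emb[of 0] by simp
    next
      case (insert b A)
      have "(\<Sum>b\<in>A. emb (f (Some b)) * y b) \<in> L"
        using insert.prems y by (intro L_sum L_mult) auto
      with insert y[of b] show ?case
        by (simp add: \<delta>_add \<delta>_mult L_mult \<delta>_emb)
    qed
  qed
  from this[of B] have "(\<Sum>b\<in>B. emb (f (Some b)) * b) = \<delta> (\<Sum>b\<in>B. emb (f (Some b)) * y b)"
    by simp
  also have "(\<Sum>b\<in>B. emb (f (Some b)) * y b) = emb (- f None)"
    using sum by (simp add: hom_uminus eq_neg_iff_add_eq_0 add.commute)
  finally have "(\<Sum>b\<in>B. emb (f (Some b)) * b) = 0" by (simp add: \<delta>_emb)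
  then have zero: "f (Some b) = 0" if "b \<in> B" for b
    by (rule V.independentD[OF B(2) \<open>finite B\<close> order_refl _ that])
  have "(\<Sum>b\<in>B. emb (f (Some b)) * y b) = 0"
    by (rule sum.neutral) (auto dest: zero)
  then have "f None = 0" using sum by simp
  moreover obtain j where "j \<in> ?J" "f j \<noteq> 0" using f(1) by blast
  ultimately show False using zero by (cases j) auto
qed

text \<open>
  An intermediate field of maximal dimension that carries a derivation with constants \<open>F\<close> must be
  \<open>K\<close>, as otherwise the derivation extends further.
\<close>

theorem exists_derivation_with_constants:
  assumes fin: "vector_space.dim (\<lambda>c x. emb c * x) (UNIV :: 'k set) > 0"
  shows "\<exists>\<delta>. derivation \<delta> \<and> Const \<delta> = range emb"
proof -
  interpret V: vector_space "\<lambda>c x. emb c * x" by (rule vector_space_emb)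
  obtain B0 where B0: "V.independent B0" "UNIV \<subseteq> V.span B0" "card B0 = V.dim (UNIV :: 'k set)"
    by (rule V.basis_exists[of UNIV])
  then have "finite B0" using fin by (metis card_gt_0_iff)
  interpret V: finite_dimensional_vector_space "\<lambda>c x. emb c * x" B0
    by unfold_locales (use B0 \<open>finite B0\<close> in auto)
  define P where "P = (\<lambda>(L, \<delta>). intermediate_ring L \<and> derivation_on L \<delta> \<and> {a \<in> L. \<delta> a = 0} = range emb)"
  have "P (range emb, \<lambda>_. 0)"
  proof -
    have "emb a + emb b \<in> range emb" "emb a * emb b \<in> range emb" "0 \<in> range emb" for a b
      by (metis hom_add rangeI, metis hom_mult rangeI, metis hom_zero rangeI)
    then show ?thesis by (auto simp: P_def intermediate_ring_def derivation_on_def)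
  qed
  moreover have "V.dim (fst z) \<le> card B0" for z :: "'k set \<times> ('k \<Rightarrow> 'k)"
    using V.dim_subset_UNIV[of "fst z"] by (simp add: V.dimension_def)
  then have "\<forall>z. P z \<longrightarrow> V.dim (fst z) < Suc (card B0)" by (simp add: less_Suc_eq_le)
  ultimately obtain z where z: "P z" "\<And>z'. P z' \<Longrightarrow> V.dim (fst z') \<le> V.dim (fst z)"
    using ex_has_greatest_nat[of P "(range emb, \<lambda>_. 0)" "\<lambda>z. V.dim (fst z)" "Suc (card B0)"]
    by blast
  obtain L \<delta> where zL: "z = (L, \<delta>)" by fastforce
  have L: "intermediate_ring L" "derivation_on L \<delta>" "{a \<in> L. \<delta> a = 0} = range emb"
    using z(1) by (auto simp: P_def zL)
  have "L = UNIV"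
  proof (rule ccontr)
    assume "L \<noteq> UNIV"
    then obtain x where x: "x \<notin> L" by blast
    obtain c where c: "c \<in> L" "c \<notin> \<delta> ` L"
      using exists_nonimage_of_derivation[OF fin L] by blast
    obtain L' \<delta>' where L': "intermediate_ring L'" "derivation_on L' \<delta>'" "{a \<in> L'. \<delta>' a = 0} = range emb"
      "L \<subset> L'" by (rule extend_derivation[OF L x c])
    have sub: "V.subspace M" if "intermediate_ring M" for M
    proof -
      interpret M: intermediate_extension emb M by unfold_locales (rule that)
      show ?thesis by (rule V.subspaceI) (auto intro: M.L_add M.L_mult)
    qed
    have "V.dim L < V.dim L'"
      using V.dim_psubset[of L L'] L'(4) sub[OF L(1)] sub[OF L'(1)] V.span_eq_iff by metis
    moreover have "V.dim L' \<le> V.dim L"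
      using z(2)[of "(L', \<delta>')"] L' by (simp add: P_def zL)
    ultimately show False by simp
  qed
  then have "derivation \<delta>" "Const \<delta> = range emb"
    using L by (auto simp: derivation_on_def derivation_def Const_def)
  then show ?thesis by blast
qed

end

section \<open>Differential polynomials and the modules on which they act\<close>

text \<open>
  The relation \<open>t a = a t + \<delta>(a)\<close>, as seen by the operator \<open>T\<close> through which \<open>t\<close> acts.
\<close>

definition semilinear :: "('k::field \<Rightarrow> 'k) \<Rightarrow> ('k poly \<Rightarrow> 'k poly) \<Rightarrow> bool" where
  "semilinear \<delta> T \<longleftrightarrow>
     (\<forall>u v. T (u + v) = T u + T v) \<and>
     (\<forall>a v. T (Polynomial.smult a v) = Polynomial.smult a (T v) + Polynomial.smult (\<delta> a) v)"

text \<open>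
  The action of \<open>g \<in> K[t;\<delta>]\<close> on a vector \<open>v\<close> when \<open>t\<close> acts as \<open>T\<close>. Vectors are polynomials, read as
  sequences of coordinates: with \<open>T = t_mult \<delta>\<close> this is the product in \<open>K[t;\<delta>]\<close>, with \<open>T = map_poly \<delta>\<close> on
  constant polynomials it is the action by differential operators on \<open>K\<close>, and polynomials of degree
  less than \<open>m\<close> serve as \<open>K\<^sup>m\<close>.
\<close>

definition dact :: "('k poly \<Rightarrow> 'k poly) \<Rightarrow> 'k::field poly \<Rightarrow> 'k poly \<Rightarrow> 'k poly" where
  "dact T g v = (\<Sum>i\<le>degree g. Polynomial.smult (Polynomial.coeff g i) ((T ^^ i) v))"

lemma dact_alt:
  assumes "degree g \<le> n"
  shows "dact T g v = (\<Sum>i\<le>n. Polynomial.smult (Polynomial.coeff g i) ((T ^^ i) v))"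
  unfolding dact_def
  by (rule sum.mono_neutral_left) (use assms in \<open>auto simp: coeff_eq_0 not_le\<close>)

lemma dact_0_left [simp]: "dact T 0 v = 0"
  by (simp add: dact_def)

lemma dact_const [simp]: "dact T [:a:] v = Polynomial.smult a v"
  by (simp add: dact_def)

lemma dact_add_left: "dact T (g + h) v = dact T g v + dact T h v"
proof -
  define n where "n = max (degree g) (degree h)"
  have "degree (g + h) \<le> n" "degree g \<le> n" "degree h \<le> n"
    unfolding n_def by (auto intro: degree_add_le)
  then show ?thesis
    by (simp add: dact_alt[of _ n] smult_add_left sum.distrib)
qed

lemma smult_sum: "Polynomial.smult a (\<Sum>i\<in>A. h i) = (\<Sum>i\<in>A. Polynomial.smult a (h i))"
  by (induction A rule: infinite_finite_induct) (auto simp: smult_add_right)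

lemma dact_smult_left: "dact T (Polynomial.smult a g) v = Polynomial.smult a (dact T g v)"
  by (subst dact_alt[of _ "degree g"]) (simp_all add: degree_smult_le dact_def smult_sum)

lemma dact_diff_left: "dact T (g - h) v = dact T g v - dact T h v"
  using dact_add_left[of T "g - h" h v] by simp

lemma dact_sum_left: "dact T (sum g A) v = (\<Sum>i\<in>A. dact T (g i) v)"
  by (induction A rule: infinite_finite_induct) (auto simp: dact_add_left)

lemma dact_monom: "dact T (Polynomial.monom a i) v = Polynomial.smult a ((T ^^ i) v)"
proof -
  have "dact T (Polynomial.monom a i) v =
      (\<Sum>j\<le>i. Polynomial.smult (Polynomial.coeff (Polynomial.monom a i) j) ((T ^^ j) v))"
    by (rule dact_alt) (rule degree_monom_le)
  also have "\<dots> = (\<Sum>j\<in>{i}. Polynomial.smult (Polynomial.coeff (Polynomial.monom a i) j) ((T ^^ j) v))"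
    by (rule sum.mono_neutral_right) auto
  finally show ?thesis by simp
qed

lemma dact_1_left [simp]: "dact T 1 v = v"
  using dact_const[of T 1 v] by (simp add: one_pCons[symmetric])

locale differential_module =
  fixes \<delta> :: "'k::field \<Rightarrow> 'k" and T :: "'k poly \<Rightarrow> 'k poly"
  assumes derivation: "derivation \<delta>" and semilinear: "semilinear \<delta> T"
begin

lemma T_add: "T (u + v) = T u + T v"
  and T_smult: "T (Polynomial.smult a v) = Polynomial.smult a (T v) + Polynomial.smult (\<delta> a) v"
  using semilinear by (auto simp: semilinear_def)

lemma T_0 [simp]: "T 0 = 0"
  by (metis T_add add.right_neutral add_left_cancel)

lemma T_sum: "T (sum g A) = (\<Sum>i\<in>A. T (g i))"
  by (induction A rule: infinite_finite_induct) (auto simp: T_add)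

lemma T_pow_add: "(T ^^ i) (u + v) = (T ^^ i) u + (T ^^ i) v"
  by (induction i) (auto simp: T_add)

lemma dact_add_right: "dact T g (u + v) = dact T g u + dact T g v"
  by (simp add: dact_def T_pow_add smult_add_right sum.distrib)

lemma dact_0_right [simp]: "dact T g 0 = 0"
  by (metis dact_add_right add.right_neutral add_left_cancel)

lemma dact_sum_right: "dact T g (sum v A) = (\<Sum>i\<in>A. dact T g (v i))"
  by (induction A rule: infinite_finite_induct) (auto simp: dact_add_right)

lemma dact_t_mult: "dact T (t_mult \<delta> g) v = T (dact T g v)"
proof -
  have "degree (map_poly \<delta> g) \<le> degree g"
    by (rule degree_le) (auto simp: coeff_map_poly derivation_0[OF derivation] coeff_eq_0)
  then have "dact T (map_poly \<delta> g) v =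
      (\<Sum>i\<le>degree g. Polynomial.smult (\<delta> (Polynomial.coeff g i)) ((T ^^ i) v))"
    by (simp add: dact_alt[of _ "degree g"] coeff_map_poly derivation_0[OF derivation])
  moreover have "dact T (pCons 0 g) v =
      (\<Sum>i\<le>degree g. Polynomial.smult (Polynomial.coeff g i) ((T ^^ Suc i) v))"
    by (simp add: dact_alt[of "pCons 0 g" "Suc (degree g)"] degree_pCons_le
          sum.atMost_Suc_shift del: sum.atMost_Suc)
  ultimately show ?thesis
    unfolding t_mult_def dact_add_left
    by (simp add: dact_def T_sum T_smult sum.distrib)
qed

text \<open>
  It suffices to let the left factor be a power of \<open>t\<close>; there it is the defining property of \<open>T\<close>.
\<close>

lemma dact_diff_mult: "dact T (diff_mult \<delta> g h) v = dact T g (dact T h v)"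
proof -
  have "dact T ((t_mult \<delta> ^^ i) h) v = (T ^^ i) (dact T h v)" for i
    by (induction i) (auto simp: dact_t_mult)
  then show ?thesis
    unfolding diff_mult_def by (simp add: dact_sum_left dact_smult_left dact_def[of T g])
qed

end

lemma degree_t_mult_pow:
  assumes "derivation \<delta>"
  shows "degree ((t_mult \<delta> ^^ i) h) \<le> i + degree h"
    and "Polynomial.coeff ((t_mult \<delta> ^^ i) h) (i + degree h) = lead_coeff h"
proof -
  have "degree ((t_mult \<delta> ^^ i) h) \<le> i + degree h \<and>
      Polynomial.coeff ((t_mult \<delta> ^^ i) h) (i + degree h) = lead_coeff h"
  proof (induction i)
    case (Suc i)
    let ?u = "(t_mult \<delta> ^^ i) h"
    have "Polynomial.coeff (t_mult \<delta> ?u) n = 0" if "n > Suc (i + degree h)" for n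
      using that Suc by (auto simp: coeff_t_mult assms derivation_0 coeff_eq_0)
    moreover have "Polynomial.coeff ?u (Suc (i + degree h)) = 0"
      using Suc by (intro coeff_eq_0) auto
    ultimately show ?case
      using Suc by (auto simp: coeff_t_mult assms derivation_0 intro!: degree_le)
  qed auto
  then show "degree ((t_mult \<delta> ^^ i) h) \<le> i + degree h"
    and "Polynomial.coeff ((t_mult \<delta> ^^ i) h) (i + degree h) = lead_coeff h"
    by auto
qed

lemma degree_diff_mult_le:
  assumes "derivation \<delta>"
  shows "degree (diff_mult \<delta> g h) \<le> degree g + degree h"
  unfolding diff_mult_def
  by (rule degree_sum_le)
     (auto intro!: order_trans[OF degree_smult_le] order_trans[OF degree_t_mult_pow(1)[OF assms]])

lemma coeff_diff_mult_top:
  assumes "derivation \<delta>"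
  shows "Polynomial.coeff (diff_mult \<delta> g h) (degree g + degree h) = lead_coeff g * lead_coeff h"
proof -
  have "Polynomial.coeff ((t_mult \<delta> ^^ i) h) (degree g + degree h) = 0" if "i < degree g" for i
    using that degree_t_mult_pow(1)[OF assms, of i h] by (intro coeff_eq_0) auto
  then have "Polynomial.coeff (diff_mult \<delta> g h) (degree g + degree h) =
      (\<Sum>i\<in>{degree g}. Polynomial.coeff g i * Polynomial.coeff ((t_mult \<delta> ^^ i) h) (degree g + degree h))"
    unfolding diff_mult_def coeff_sum coeff_smult
    by (intro sum.mono_neutral_right) auto
  then show ?thesis by (simp add: degree_t_mult_pow(2)[OF assms])
qed

lemma degree_diff_mult:
  assumes "derivation \<delta>" "g \<noteq> 0" "h \<noteq> 0"
  shows "degree (diff_mult \<delta> g h) = degree g + degree h"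
proof (rule antisym)
  show "degree g + degree h \<le> degree (diff_mult \<delta> g h)"
    by (rule le_degree) (simp add: coeff_diff_mult_top assms)
qed (rule degree_diff_mult_le[OF assms(1)])

lemma lead_coeff_diff_mult:
  assumes "derivation \<delta>" "g \<noteq> 0" "h \<noteq> 0"
  shows "lead_coeff (diff_mult \<delta> g h) = lead_coeff g * lead_coeff h"
  by (simp add: degree_diff_mult assms coeff_diff_mult_top)

lemma diff_mult_eq_0_iff:
  assumes "derivation \<delta>"
  shows "diff_mult \<delta> g h = 0 \<longleftrightarrow> g = 0 \<or> h = 0"
proof
  assume "diff_mult \<delta> g h = 0"
  then show "g = 0 \<or> h = 0"
    using lead_coeff_diff_mult[OF assms, of g h] by fastforce
next
  have "diff_mult \<delta> g 0 = 0" by (metis assms diff_mult_add_right add.right_neutral add_left_cancel)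
  then show "g = 0 \<or> h = 0 \<Longrightarrow> diff_mult \<delta> g h = 0" by auto
qed

lemma right_division:
  assumes "derivation \<delta>" "degree f > 0"
  shows "\<exists>q r. degree r < degree f \<and> g = diff_mult \<delta> q f + r"
proof (induction "degree g" arbitrary: g rule: less_induct)
  case less
  show ?case
  proof (cases "degree g < degree f")
    case True
    then show ?thesis by (intro exI[of _ 0] exI[of _ g]) auto
  next
    case False
    have f: "f \<noteq> 0" using assms(2) by auto
    have g: "g \<noteq> 0" using False assms(2) by auto
    define l where "l = Polynomial.monom (lead_coeff g / lead_coeff f) (degree g - degree f)"
    have l: "degree l = degree g - degree f" "lead_coeff l = lead_coeff g / lead_coeff f" "l \<noteq> 0"
      using f g by (auto simp: l_def degree_monom_eq)
    define h where "h = g - diff_mult \<delta> l f"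
    have deg: "degree (diff_mult \<delta> l f) = degree g"
      using l f False by (simp add: degree_diff_mult assms)
    have "degree h \<le> degree g" unfolding h_def by (rule degree_diff_le) (auto simp: deg)
    moreover have "Polynomial.coeff h (degree g) = 0"
      using lead_coeff_diff_mult[OF assms(1) l(3) f] l(2) f by (simp add: h_def deg)
    ultimately have "h = 0 \<or> degree h < degree g" by (rule eq_zero_or_degree_less)
    then have "\<exists>q r. degree r < degree f \<and> h = diff_mult \<delta> q f + r"
    proof
      assume "h = 0"
      then show ?thesis using assms(2) by (intro exI[of _ 0] exI[of _ 0]) auto
    qed (rule less)
    then obtain q r where "degree r < degree f" "h = diff_mult \<delta> q f + r" by blast
    then show ?thesis
      by (intro exI[of _ "l + q"] exI[of _ r]) (auto simp: h_def diff_mult_add_left algebra_simps)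
  qed
qed

lemma diff_mult_diff_left: "diff_mult \<delta> (g - h) f = diff_mult \<delta> g f - diff_mult \<delta> h f"
  using diff_mult_add_left[of \<delta> "g - h" h f] by simp

lemma small_left_multiple_is_0:
  assumes "derivation \<delta>" "degree (diff_mult \<delta> q f) < degree f"
  shows "q = 0"
  using degree_diff_mult[OF assms(1), of q f] assms by fastforce

lemma mod_r_eqI:
  assumes "derivation \<delta>" "degree r < degree f" "g = diff_mult \<delta> q f + r"
  shows "mod_r \<delta> g f = r"
  unfolding mod_r_def
proof (rule the_equality)
  fix r' assume "degree r' < degree f \<and> (\<exists>q. g = diff_mult \<delta> q f + r')"
  then obtain q' where q': "degree r' < degree f" "g = diff_mult \<delta> q' f + r'" by blast
  have "diff_mult \<delta> (q - q') f = r' - r"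
    using assms(3) q'(2) by (simp add: diff_mult_diff_left algebra_simps)
  moreover have "degree (r' - r) < degree f"
    using assms(2) q'(1) by (rule degree_diff_less[rotated])
  ultimately have "q - q' = 0" using small_left_multiple_is_0[OF assms(1)] by metis
  then show "r' = r" using assms(3) q'(2) by simp
qed (use assms in blast)

lemma mod_r_decomp:
  assumes "derivation \<delta>" "degree f > 0"
  shows "degree (mod_r \<delta> g f) < degree f" "\<exists>q. g = diff_mult \<delta> q f + mod_r \<delta> g f"
proof -
  obtain q r where qr: "degree r < degree f" "g = diff_mult \<delta> q f + r"
    using right_division[OF assms] by blast
  with mod_r_eqI[OF assms(1) qr] show "degree (mod_r \<delta> g f) < degree f"
    "\<exists>q. g = diff_mult \<delta> q f + mod_r \<delta> g f" by auto
qed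

lemma mod_r_add:
  assumes "derivation \<delta>" "degree f > 0"
  shows "mod_r \<delta> (g + h) f = mod_r \<delta> g f + mod_r \<delta> h f"
proof -
  obtain q q' where "g = diff_mult \<delta> q f + mod_r \<delta> g f" "h = diff_mult \<delta> q' f + mod_r \<delta> h f"
    using mod_r_decomp[OF assms] by metis
  then have "g + h = diff_mult \<delta> (q + q') f + (mod_r \<delta> g f + mod_r \<delta> h f)"
    unfolding diff_mult_add_left by (metis add.assoc add.left_commute)
  then show ?thesis
    by (intro mod_r_eqI[OF assms(1)] degree_add_less mod_r_decomp assms)
qed

lemma mod_r_smult:
  assumes "derivation \<delta>" "degree f > 0"
  shows "mod_r \<delta> (Polynomial.smult a g) f = Polynomial.smult a (mod_r \<delta> g f)"
proof -
  obtain q where "g = diff_mult \<delta> q f + mod_r \<delta> g f"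
    using mod_r_decomp[OF assms] by metis
  then have "Polynomial.smult a g =
      diff_mult \<delta> (Polynomial.smult a q) f + Polynomial.smult a (mod_r \<delta> g f)"
    by (metis diff_mult_smult_left smult_add_right)
  then show ?thesis
    by (intro mod_r_eqI[OF assms(1)] le_less_trans[OF degree_smult_le] mod_r_decomp assms)
qed

lemma mod_r_small:
  assumes "derivation \<delta>" "degree g < degree f" shows "mod_r \<delta> g f = g"
  by (rule mod_r_eqI[OF assms, of _ 0]) simp

lemma diff_mult_smult_right:
  assumes "derivation \<delta>" "\<delta> a = 0"
  shows "diff_mult \<delta> g (Polynomial.smult a h) = Polynomial.smult a (diff_mult \<delta> g h)"
proof -
  have "(t_mult \<delta> ^^ i) (Polynomial.smult a h) = Polynomial.smult a ((t_mult \<delta> ^^ i) h)" for i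
    by (induction i) (auto simp: t_mult_smult assms)
  then show ?thesis by (simp add: diff_mult_def smult_sum mult.commute)
qed

section \<open>Differential operators on the coefficient field\<close>

lemma differential_module_constants:
  assumes "derivation \<delta>" shows "differential_module \<delta> (map_poly \<delta>)"
  by unfold_locales
     (use assms in \<open>auto simp: semilinear_def derivation_def coeff_map_poly derivation_0[OF assms] intro!: poly_eqI\<close>)

lemma map_poly_pow_const:
  assumes "derivation \<delta>" shows "(map_poly \<delta> ^^ i) [:a:] = [:(\<delta> ^^ i) a:]"
  by (induction i) (auto simp: map_poly_pCons derivation_0[OF assms])

lemma dact_on_constant:
  assumes "derivation \<delta>" "degree g \<le> n"
  shows "dact (map_poly \<delta>) g [:a:] = [:\<Sum>i\<le>n. Polynomial.coeff g i * (\<delta> ^^ i) a:]"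
  unfolding dact_alt[OF assms(2)]
  by (rule poly_eqI) (simp add: map_poly_pow_const assms coeff_sum coeff_pCons split: nat.splits)

locale family_independent_over_constants =
  fixes \<delta> :: "'k::field \<Rightarrow> 'k" and B :: "'k set"
  assumes derivation: "derivation \<delta>" and finite_B: "finite B"
    and independent_B: "\<And>f b. \<lbrakk>\<And>b. b \<in> B \<Longrightarrow> f b \<in> Const \<delta>; (\<Sum>b\<in>B. f b * b) = 0; b \<in> B\<rbrakk> \<Longrightarrow> f b = 0"
begin

lemma \<delta>_add: "\<delta> (a + b) = \<delta> a + \<delta> b" and \<delta>_mult: "\<delta> (a * b) = a * \<delta> b + \<delta> a * b"
  using derivation by (auto simp: derivation_def)

lemma \<delta>_0 [simp]: "\<delta> 0 = 0" by (rule derivation_0[OF derivation])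

lemma \<delta>_1 [simp]: "\<delta> 1 = 0"
  using \<delta>_mult[of 1 1] by (metis add_cancel_right_left mult.right_neutral mult_1)

lemma \<delta>_sum: "\<delta> (sum f A) = (\<Sum>i\<in>A. \<delta> (f i))"
  by (induction A rule: infinite_finite_induct) (auto simp: \<delta>_add)

text \<open>
  Scale a solution with minimal support so that one entry is \<open>1\<close> and differentiate. The solution space
  is closed under this, because it involves all powers of \<open>\<delta>\<close>, and the support becomes smaller; so
  the entries are constants, contradicting the independence of \<open>B\<close>.
\<close>

lemma iterated_derivations_separate:
  assumes "\<And>i. (\<Sum>b\<in>B. x b * (\<delta> ^^ i) b) = 0"
  shows "\<forall>b\<in>B. x b = 0"
  using assms
proof (induction "card {b \<in> B. x b \<noteq> 0}" arbitrary: x rule: less_induct)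
  case less
  show ?case
  proof (rule ccontr)
    assume "\<not> ?case"
    then obtain b0 where b0: "b0 \<in> B" "x b0 \<noteq> 0" by blast
    define y where "y = (\<lambda>b. x b / x b0)"
    have y: "(\<Sum>b\<in>B. y b * (\<delta> ^^ i) b) = 0" for i
      using less.prems[of i] by (simp add: y_def sum_divide_distrib[symmetric])
    have "(\<Sum>b\<in>B. \<delta> (y b) * (\<delta> ^^ i) b) = 0" for i
    proof -
      have "\<delta> (\<Sum>b\<in>B. y b * (\<delta> ^^ i) b) =
          (\<Sum>b\<in>B. y b * (\<delta> ^^ Suc i) b) + (\<Sum>b\<in>B. \<delta> (y b) * (\<delta> ^^ i) b)"
        by (simp add: \<delta>_sum \<delta>_mult sum.distrib)
      then show ?thesis by (simp only: y \<delta>_0 add_0)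
    qed
    moreover have "card {b \<in> B. \<delta> (y b) \<noteq> 0} < card {b \<in> B. x b \<noteq> 0}"
    proof (rule psubset_card_mono)
      have "\<delta> (y b0) = 0" using b0 by (simp add: y_def)
      moreover have "x b = 0 \<Longrightarrow> \<delta> (y b) = 0" for b by (simp add: y_def)
      ultimately show "{b \<in> B. \<delta> (y b) \<noteq> 0} \<subset> {b \<in> B. x b \<noteq> 0}" using b0 by blast
    qed (use finite_B in auto)
    ultimately have "\<forall>b\<in>B. \<delta> (y b) = 0" by (rule less.hyps[rotated])
    then have "y b0 = 0"
      using y[of 0] b0(1) by (intro independent_B[of y b0]) (auto simp: Const_def)
    then show False using b0 by (simp add: y_def)
  qed
qed

text \<open>
  If \<open>g\<close> annihilates \<open>K\<close>, then right division by \<open>g\<close> expresses every power \<open>\<delta>\<^sup>i\<close> through the first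
  \<open>deg g\<close> powers. A nontrivial solution of only \<open>deg g\<close> equations in \<open>card B\<close> unknowns then solves them all,
  contrary to \<open>iterated_derivations_separate\<close>.
\<close>

lemma nonzero_operator_acts_nontrivially:
  assumes "degree g < card B" "\<And>a. dact (map_poly \<delta>) g [:a:] = 0"
  shows "g = 0"
proof (rule ccontr)
  assume g: "g \<noteq> 0"
  interpret K: differential_module \<delta> "map_poly \<delta>" by (rule differential_module_constants[OF derivation])
  have deg: "degree g > 0"
  proof (rule ccontr)
    assume "\<not> degree g > 0"
    then obtain c where "g = [:c:]" using degree_eq_zeroE by blast
    then show False using assms(2)[of 1] g by simp
  qed
  obtain x where x: "\<exists>b\<in>B. x b \<noteq> 0" "\<And>i. i < degree g \<Longrightarrow> (\<Sum>b\<in>B. (\<delta> ^^ i) b * x b) = 0"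
    using homogeneous_system[of "{..<degree g}" B "\<lambda>i b. (\<delta> ^^ i) b"] finite_B assms(1) by auto
  have "(\<Sum>b\<in>B. x b * (\<delta> ^^ i) b) = 0" for i
  proof -
    obtain q r where qr: "degree r < degree g" "Polynomial.monom 1 i = diff_mult \<delta> q g + r"
      using right_division[OF derivation deg] by blast
    have "(\<delta> ^^ i) b = (\<Sum>j<degree g. Polynomial.coeff r j * (\<delta> ^^ j) b)" for b
    proof -
      have "[:(\<delta> ^^ i) b:] = dact (map_poly \<delta>) (Polynomial.monom 1 i) [:b:]"
        by (simp add: dact_monom map_poly_pow_const derivation)
      also have "\<dots> = dact (map_poly \<delta>) r [:b:]"
        unfolding qr(2) by (simp add: dact_add_left K.dact_diff_mult assms(2))
      also have "\<dots> = [:\<Sum>j\<le>degree g - 1. Polynomial.coeff r j * (\<delta> ^^ j) b:]"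
        by (rule dact_on_constant[OF derivation]) (use qr(1) in simp)
      also have "{..degree g - 1} = {..<degree g}" using deg by auto
      finally show ?thesis by simp
    qed
    then have "(\<Sum>b\<in>B. x b * (\<delta> ^^ i) b) =
        (\<Sum>b\<in>B. \<Sum>j<degree g. Polynomial.coeff r j * ((\<delta> ^^ j) b * x b))"
      by (intro sum.cong refl) (simp add: sum_distrib_left algebra_simps)
    also have "\<dots> = (\<Sum>j<degree g. Polynomial.coeff r j * (\<Sum>b\<in>B. (\<delta> ^^ j) b * x b))"
      by (subst sum.swap) (simp add: sum_distrib_left)
    also have "\<dots> = 0" by (simp add: x)
    finally show ?thesis .
  qed
  then show False using iterated_derivations_separate x(1) by blast
qed

text \<open>
  If \<open>g\<close> commutes with \<open>K\<close>, it acts on \<open>K\<close> as multiplication by the constant coefficient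
  \<open>g(1)\<close>, so \<open>g\<close> minus that coefficient annihilates \<open>K\<close>.
\<close>

lemma commuting_with_coefficients_imp_constant:
  assumes "degree g < card B"
    and "\<And>a. diff_mult \<delta> g [:a:] = Polynomial.smult a g"
  shows "degree g = 0"
proof -
  interpret K: differential_module \<delta> "map_poly \<delta>" by (rule differential_module_constants[OF derivation])
  define c where "c = Polynomial.coeff g 0"
  have pow1: "(\<delta> ^^ i) 1 = (if i = 0 then 1 else 0)" for i
    by (induction i) auto
  have g1: "dact (map_poly \<delta>) g [:1:] = [:c:]"
    by (simp add: dact_on_constant[OF derivation order_refl] pow1 c_def if_distrib sum.delta cong: if_cong)
  have "g - [:c:] = 0"
  proof (rule nonzero_operator_acts_nontrivially)
    show "degree (g - [:c:]) < card B"
      by (rule degree_diff_less) (use assms(1) in auto)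
    fix a
    have "dact (map_poly \<delta>) g [:a:] = dact (map_poly \<delta>) (diff_mult \<delta> g [:a:]) [:1:]"
      by (simp add: K.dact_diff_mult)
    also have "\<dots> = [:a * c:]" by (simp add: assms(2) dact_smult_left g1)
    finally show "dact (map_poly \<delta>) (g - [:c:]) [:a:] = 0"
      by (simp add: dact_diff_left)
  qed
  then have "g = [:c:]" by simp
  then show ?thesis by (metis degree_pCons_0)
qed

text \<open>
  Take \<open>g\<close> of least degree annihilating \<open>V\<close>. Its commutator with any \<open>a \<in> K\<close> also annihilates \<open>V\<close> and has
  smaller degree, so it is zero; hence \<open>g\<close> is constant.
\<close>

lemma differential_module_faithful:
  assumes "differential_module \<delta> T"
    and V: "\<And>a v. v \<in> V \<Longrightarrow> Polynomial.smult a v \<in> V" "v0 \<in> V" "v0 \<noteq> 0"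
    and "degree g < card B" "\<And>v. v \<in> V \<Longrightarrow> dact T g v = 0"
  shows "g = 0"
  using assms(5,6)
proof (induction "degree g" arbitrary: g rule: less_induct)
  case less
  interpret T: differential_module \<delta> T by (rule assms(1))
  have "degree g = 0"
  proof (cases "degree g = 0")
    case False
    show ?thesis
    proof (rule commuting_with_coefficients_imp_constant[OF less.prems(1)])
      fix a
      define h where "h = diff_mult \<delta> g [:a:] - Polynomial.smult a g"
      have "degree h \<le> degree g"
        unfolding h_def using degree_diff_mult_le[OF derivation, of g "[:a:]"]
        by (intro degree_diff_le) (auto simp: degree_smult_le)
      moreover have "Polynomial.coeff h (degree g) = 0"
        using coeff_diff_mult_top[OF derivation, of g "[:a:]"] by (simp add: h_def)
      ultimately have "h = 0 \<or> degree h < degree g" by (rule eq_zero_or_degree_less)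
      moreover have "dact T h v = 0" if "v \<in> V" for v
        using that by (simp add: h_def dact_diff_left T.dact_diff_mult dact_smult_left less.prems V)
      ultimately have "h = 0" using less.hyps[of h] less.prems(1) by force
      then show "diff_mult \<delta> g [:a:] = Polynomial.smult a g" by (simp add: h_def)
    qed
  qed
  then obtain c where "g = [:c:]" using degree_eq_zeroE by blast
  then show ?case using less.prems(2)[OF V(2)] V(3) by simp
qed

end

section \<open>Splitting as a matrix representation\<close>

text \<open>
  A homomorphism of \<open>F\<close>-algebras into \<open>n \<times> n\<close> matrices over \<open>K\<close> whose image spans all matrices over \<open>K\<close>.
  Only the entries with indices below \<open>n\<close> are meaningful.
\<close>

definition spanning_matrix_representation ::
    "('f \<Rightarrow> 'd::ring_1 \<Rightarrow> 'd) \<Rightarrow> ('f \<Rightarrow> 'k::field) \<Rightarrow> nat \<Rightarrow> ('d \<Rightarrow> nat \<Rightarrow> nat \<Rightarrow> 'k) \<Rightarrow> bool" where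
  "spanning_matrix_representation scale emb n \<psi> \<longleftrightarrow>
     (\<forall>i<n. \<forall>j<n.
        (\<forall>x y. \<psi> (x + y) i j = \<psi> x i j + \<psi> y i j \<and> \<psi> (x * y) i j = (\<Sum>k<n. \<psi> x i k * \<psi> y k j)) \<and>
        \<psi> 1 i j = (if i = j then 1 else 0) \<and>
        (\<forall>c x. \<psi> (scale c x) i j = emb c * \<psi> x i j)) \<and>
     (\<forall>M. \<exists>X c. finite X \<and> (\<forall>i<n. \<forall>j<n. M i j = (\<Sum>x\<in>X. c x * \<psi> x i j)))"

abbreviation frag_mult :: "(('d::ring_1 \<times> 'k::comm_ring_1) \<Rightarrow>\<^sub>0 int) \<Rightarrow> (('d \<times> 'k) \<Rightarrow>\<^sub>0 int) \<Rightarrow> (('d \<times> 'k) \<Rightarrow>\<^sub>0 int)" where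
  "frag_mult \<equiv> mult product_monoid_ring"

lemma frag_mult_alt:
  assumes "finite A" "Poly_Mapping.keys u \<subseteq> A" "finite B" "Poly_Mapping.keys v \<subseteq> B"
  shows "frag_mult u v = (\<Sum>x\<in>A. \<Sum>y\<in>B. Poly_Mapping.single (fst x * fst y, snd x * snd y)
                  (Poly_Mapping.lookup u x * Poly_Mapping.lookup v y))"
proof -
  have "(\<Sum>x\<in>Poly_Mapping.keys u. \<Sum>y\<in>Poly_Mapping.keys v.
        Poly_Mapping.single (fst x * fst y, snd x * snd y) (Poly_Mapping.lookup u x * Poly_Mapping.lookup v y)) =
      (\<Sum>x\<in>Poly_Mapping.keys u. \<Sum>y\<in>B.
        Poly_Mapping.single (fst x * fst y, snd x * snd y) (Poly_Mapping.lookup u x * Poly_Mapping.lookup v y))"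
    by (intro sum.cong refl sum.mono_neutral_left)
       (use assms in \<open>auto simp: in_keys_iff\<close>)
  also have "\<dots> = (\<Sum>x\<in>A. \<Sum>y\<in>B.
        Poly_Mapping.single (fst x * fst y, snd x * snd y) (Poly_Mapping.lookup u x * Poly_Mapping.lookup v y))"
    by (intro sum.mono_neutral_left) (use assms in \<open>auto simp: in_keys_iff\<close>)
  finally show ?thesis by (simp add: product_monoid_ring_def)
qed

lemma frag_mult_add_left: "frag_mult (u + u') v = frag_mult u v + frag_mult u' v"
proof -
  let ?A = "Poly_Mapping.keys u \<union> Poly_Mapping.keys u'"
  have "Poly_Mapping.keys (u + u') \<subseteq> ?A" by (rule keys_add)
  then show ?thesis
    by (simp add: frag_mult_alt[of ?A _ "Poly_Mapping.keys v"] lookup_add distrib_right single_add sum.distrib)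
qed

lemma frag_mult_add_right: "frag_mult u (v + v') = frag_mult u v + frag_mult u v'"
proof -
  let ?A = "Poly_Mapping.keys v \<union> Poly_Mapping.keys v'"
  have "Poly_Mapping.keys (v + v') \<subseteq> ?A" by (rule keys_add)
  then show ?thesis
    by (simp add: frag_mult_alt[of "Poly_Mapping.keys u" _ ?A] lookup_add distrib_left single_add sum.distrib)
qed

lemma frag_mult_diff_left: "frag_mult (u - u') v = frag_mult u v - frag_mult u' v"
  using frag_mult_add_left[of "u - u'" u' v] by simp

lemma frag_mult_diff_right: "frag_mult u (v - v') = frag_mult u v - frag_mult u v'"
  using frag_mult_add_right[of u "v - v'" v'] by simp

lemma frag_mult_0 [simp]: "frag_mult 0 v = 0" "frag_mult u 0 = 0"
  by (simp_all add: product_monoid_ring_def)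

lemma frag_mult_of [simp]:
  "frag_mult (frag_of x) (frag_of y) = frag_of (fst x * fst y, snd x * snd y)"
  by (simp add: product_monoid_ring_def)

text \<open>
  Pairs \<open>(x, a)\<close> generate the monoid ring as a group, so identities that are additive in each argument
  can be checked on them.
\<close>

lemma frag_induct [case_names zero one diff]:
  assumes "P 0" "\<And>x. P (frag_of x)" "\<And>a b. P a \<Longrightarrow> P b \<Longrightarrow> P (a - b)"
  shows "P c"
  by (rule frag_induction[where S = UNIV]) (use assms in auto)

lemma frag_mult_assoc: "frag_mult (frag_mult u v) w = frag_mult u (frag_mult v w)"
proof (induction u rule: frag_induct)
  case (one x)
  show ?case
  proof (induction v rule: frag_induct)
    case (one y)
    show ?case
      by (induction w rule: frag_induct)
         (auto simp: frag_mult_diff_right mult.assoc)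
  qed (auto simp: frag_mult_diff_left frag_mult_diff_right)
qed (auto simp: frag_mult_diff_left)

lemma frag_mult_1_left: "frag_mult (frag_of (1, 1)) u = u"
  by (induction u rule: frag_induct) (auto simp: frag_mult_diff_right)

lemma frag_mult_1_right: "frag_mult u (frag_of (1, 1)) = u"
  by (induction u rule: frag_induct) (auto simp: frag_mult_diff_left)

lemma product_monoid_ring_simps [simp]:
  "carrier product_monoid_ring = UNIV" "one product_monoid_ring = frag_of (1, 1)"
  "zero product_monoid_ring = 0" "add product_monoid_ring = (+)"
  by (simp_all add: product_monoid_ring_def)

lemma ring_product_monoid_ring:
  "ring (product_monoid_ring :: (('d::ring_1 \<times> 'k::comm_ring_1) \<Rightarrow>\<^sub>0 int) ring)"
proof (rule ringI)
  show "abelian_group (product_monoid_ring :: (('d::ring_1 \<times> 'k::comm_ring_1) \<Rightarrow>\<^sub>0 int) ring)"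
  proof (rule abelian_groupI)
    fix x :: "('d \<times> 'k) \<Rightarrow>\<^sub>0 int"
    show "\<exists>y\<in>carrier product_monoid_ring. y \<oplus>\<^bsub>product_monoid_ring\<^esub> x = \<zero>\<^bsub>product_monoid_ring\<^esub>"
      by (rule bexI[of _ "- x"]) auto
  qed (auto simp: algebra_simps)
  show "Group.monoid (product_monoid_ring :: (('d::ring_1 \<times> 'k::comm_ring_1) \<Rightarrow>\<^sub>0 int) ring)"
    by (rule monoidI) (auto simp: frag_mult_assoc frag_mult_1_left frag_mult_1_right)
qed (auto simp: frag_mult_add_left frag_mult_add_right)

text \<open>
  Restrict the isomorphism from \<open>D \<otimes>\<^sub>F K\<close> to the elements \<open>x \<otimes> 1\<close>. Since \<open>x \<otimes> a\<close> is \<open>a\<close> times \<open>x \<otimes> 1\<close>,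
  and tensors \<open>x \<otimes> a\<close> generate the tensor product as a group, these elements span it over \<open>K\<close>.
\<close>

lemma splits_imp_matrix_representation:
  fixes scale :: "'f \<Rightarrow> 'd::ring_1 \<Rightarrow> 'd" and emb :: "'f \<Rightarrow> 'k::field"
  assumes "splits scale emb"
  shows "\<exists>n \<psi>. n > 0 \<and> spanning_matrix_representation scale emb n \<psi>"
proof -
  let ?P = "product_monoid_ring :: (('d \<times> 'k) \<Rightarrow>\<^sub>0 int) ring"
  define I where "I = tensor_ideal scale emb"
  define T where "T = ?P Quot I"
  define \<rho> where "\<rho> = (\<lambda>u. I +>\<^bsub>?P\<^esub> u)"
  interpret P: ring ?P by (rule ring_product_monoid_ring)
  have I: "ideal I ?P" unfolding I_def tensor_ideal_def by (rule P.genideal_ideal) simp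
  interpret I: ideal I ?P by (rule I)
  have rel: "tensor_relations scale emb \<subseteq> I"
    unfolding I_def tensor_ideal_def by (rule P.genideal_self) simp
  have \<rho>_hom: "\<rho> \<in> Ring.ring_hom ?P T" unfolding \<rho>_def T_def by (rule I.rcos_ring_hom)
  have \<rho>_eq: "\<rho> u = \<rho> v" if "u - v \<in> I" for u v
  proof -
    have "u \<ominus>\<^bsub>?P\<^esub> v = u - v"
    proof -
      have "\<ominus>\<^bsub>?P\<^esub> v = - v" by (rule P.minus_equality) auto
      then show ?thesis by (simp add: a_minus_def)
    qed
    then show ?thesis
      unfolding \<rho>_def using P.quotient_eq_iff_same_a_r_cos[OF I, of u v] that by simp
  qed
  obtain n \<Theta> where n: "n > 0" and \<Theta>:
    "\<Theta> \<in> algebra_iso (scalar_extension scale emb) (mat_algebra ((*) :: 'k \<Rightarrow> 'k \<Rightarrow> 'k) n UNIV)"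
    using assms unfolding splits_def by blast
  let ?M = "mat_algebra ((*) :: 'k \<Rightarrow> 'k \<Rightarrow> 'k) n UNIV"
  let ?T = "scalar_extension scale emb"
  have T_simps: "carrier ?T = carrier T" "mult ?T = mult T" "add ?T = add T" "one ?T = one T"
    "module.smult ?T a X = mult T (\<rho> (frag_of (1, a))) X" for a X
    by (simp_all add: scalar_extension_def Let_def T_def I_def ring.extend_def module.fields_def
        pure_tensor_def \<rho>_def)
  have M_simps: "carrier ?M = carrier_mat n n" "mult ?M = (*)" "add ?M = (+)" "one ?M = 1\<^sub>m n"
    "module.smult ?M a = map_mat ((*) a)" for a
    by (auto simp: mat_algebra_def)
  define \<Psi> where "\<Psi> = (\<lambda>u. \<Theta> (\<rho> u))"
  have \<Theta>_hom: "\<Theta> \<in> Ring.ring_hom ?T ?M" and \<Theta>_bij: "bij_betw \<Theta> (carrier T) (carrier_mat n n)"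
    and \<Theta>_scale: "\<And>c X. X \<in> carrier T \<Longrightarrow> \<Theta> (mult T (\<rho> (frag_of (1, c))) X) = map_mat ((*) c) (\<Theta> X)"
    using \<Theta> unfolding algebra_iso_def ring_iso_def by (auto simp: T_simps M_simps)
  have \<rho>_carr: "\<rho> u \<in> carrier T" for u using ring_hom_closed[OF \<rho>_hom] by simp
  have \<Psi>_carr: "\<Psi> u \<in> carrier_mat n n" for u
    using ring_hom_closed[OF \<Theta>_hom] \<rho>_carr by (simp add: \<Psi>_def T_simps M_simps)
  have \<Psi>_add: "\<Psi> (u + v) = \<Psi> u + \<Psi> v" for u v
    using ring_hom_add[OF \<Theta>_hom] ring_hom_add[OF \<rho>_hom, of u v] \<rho>_carr
    by (simp add: \<Psi>_def T_simps M_simps)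
  have \<Psi>_mult: "\<Psi> (frag_mult u v) = \<Psi> u * \<Psi> v" for u v
    using ring_hom_mult[OF \<Theta>_hom] ring_hom_mult[OF \<rho>_hom, of u v] \<rho>_carr
    by (simp add: \<Psi>_def T_simps M_simps)
  have \<Psi>_one: "\<Psi> (frag_of (1, 1)) = 1\<^sub>m n"
    using ring_hom_one[OF \<Theta>_hom] ring_hom_one[OF \<rho>_hom]
    by (simp add: \<Psi>_def T_simps M_simps)
  have \<Psi>_eq: "\<Psi> u = \<Psi> v" if "u - v \<in> tensor_relations scale emb" for u v
    using \<rho>_eq[of u v] that rel by (auto simp: \<Psi>_def)
  have \<Psi>_scale: "\<Psi> (frag_of (x, a)) = map_mat ((*) a) (\<Psi> (frag_of (x, 1)))" for x a
    using \<Theta>_scale[OF \<rho>_carr, of a "frag_of (x, 1)"] ring_hom_mult[OF \<rho>_hom, of "frag_of (1, a)" "frag_of (x, 1)"]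
    by (simp add: \<Psi>_def)
  define \<psi> where "\<psi> = (\<lambda>x i j. \<Psi> (frag_of (x, 1)) $$ (i, j))"
  have \<Psi>_diff: "\<Psi> (u - v) $$ (i, j) = \<Psi> u $$ (i, j) - \<Psi> v $$ (i, j)" if "i < n" "j < n" for u v i j
    using \<Psi>_add[of "u - v" v] \<Psi>_carr[of "u - v"] \<Psi>_carr[of v] \<Psi>_carr[of u] that
    by (metis add_diff_cancel_right' diff_add_cancel index_add_mat(1) carrier_matD)
  have \<Psi>_0: "\<Psi> 0 $$ (i, j) = 0" if "i < n" "j < n" for i j
    using \<Psi>_diff[OF that, of 0 0] by simp
  have "spanning_matrix_representation scale emb n \<psi>"
    unfolding spanning_matrix_representation_def
  proof (intro conjI allI impI)
    fix i j x y assume ij: "i < n" "j < n"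
    have "frag_of (x + y, 1) - frag_of (x, 1) - frag_of (y, 1) \<in> tensor_relations scale emb"
      unfolding tensor_relations_def Let_def by blast
    then have "frag_of (x + y, 1) - (frag_of (x, 1) + frag_of (y, 1)) \<in> tensor_relations scale emb"
      by (simp add: diff_diff_eq)
    from \<Psi>_eq[OF this] show "\<psi> (x + y) i j = \<psi> x i j + \<psi> y i j"
      using ij \<Psi>_carr[of "frag_of (x, 1)"] \<Psi>_carr[of "frag_of (y, 1)"]
      by (auto simp: \<psi>_def \<Psi>_add)
    have "\<Psi> (frag_of (x * y, 1)) = \<Psi> (frag_of (x, 1)) * \<Psi> (frag_of (y, 1))"
      by (simp flip: \<Psi>_mult)
    then show "\<psi> (x * y) i j = (\<Sum>k<n. \<psi> x i k * \<psi> y k j)"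
      using ij \<Psi>_carr[of "frag_of (x, 1)"] \<Psi>_carr[of "frag_of (y, 1)"]
      by (auto simp: \<psi>_def scalar_prod_def lessThan_atLeast0 intro!: sum.cong)
  next
    fix i j assume "i < n" "j < n"
    then show "\<psi> 1 i j = (if i = j then 1 else 0)" by (auto simp: \<psi>_def \<Psi>_one)
  next
    fix i j c x assume ij: "i < n" "j < n"
    have "frag_of (scale c x, 1) - frag_of (x, emb c * 1) \<in> tensor_relations scale emb"
      unfolding tensor_relations_def Let_def by blast
    from \<Psi>_eq[OF this] show "\<psi> (scale c x) i j = emb c * \<psi> x i j"
      using ij \<Psi>_carr[of "frag_of (x, 1)"] \<Psi>_scale[of x "emb c"] by (auto simp: \<psi>_def)
  next
    fix M :: "nat \<Rightarrow> nat \<Rightarrow> 'k"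
    have rep: "\<exists>c. finite {x. c x \<noteq> 0} \<and> (\<forall>i<n. \<forall>j<n. \<Psi> u $$ (i, j) = (\<Sum>x | c x \<noteq> 0. c x * \<psi> x i j))" for u
    proof (induction u rule: frag_induct)
      case zero
      then show ?case by (intro exI[of _ "\<lambda>_. 0"]) (auto simp: \<Psi>_0)
    next
      case (one z)
      obtain x a where z: "z = (x, a)" by fastforce
      define c where "c = (\<lambda>y. if y = x then a else 0)"
      have sub: "{y. c y \<noteq> 0} \<subseteq> {x}" by (auto simp: c_def)
      have "(\<Sum>y | c y \<noteq> 0. c y * \<psi> y i j) = (\<Sum>y\<in>{x}. c y * \<psi> y i j)" for i j
        by (rule sum.mono_neutral_left) (use sub in auto)
      then show ?case
        using finite_subset[OF sub] \<Psi>_carr[of "frag_of (x, 1)"]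
        by (intro exI[of _ c]) (auto simp: z \<Psi>_scale[of x a] \<psi>_def c_def)
    next
      case (diff u v)
      then obtain c d where c: "finite {x. c x \<noteq> 0}" "\<forall>i<n. \<forall>j<n. \<Psi> u $$ (i, j) = (\<Sum>x | c x \<noteq> 0. c x * \<psi> x i j)"
        and d: "finite {x. d x \<noteq> 0}" "\<forall>i<n. \<forall>j<n. \<Psi> v $$ (i, j) = (\<Sum>x | d x \<noteq> 0. d x * \<psi> x i j)"
        by blast
      let ?A = "{x. c x \<noteq> 0} \<union> {x. d x \<noteq> 0}"
      have A: "finite ?A" using c d by simp
      have sub: "{x. c x - d x \<noteq> 0} \<subseteq> ?A" by auto
      have "\<Psi> (u - v) $$ (i, j) = (\<Sum>x | c x - d x \<noteq> 0. (c x - d x) * \<psi> x i j)" if ij: "i < n" "j < n" for i j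
      proof -
        have "(\<Sum>x | c x - d x \<noteq> 0. (c x - d x) * \<psi> x i j) = (\<Sum>x\<in>?A. (c x - d x) * \<psi> x i j)"
          by (rule sum.mono_neutral_left[OF A sub]) auto
        also have "\<dots> = (\<Sum>x\<in>?A. c x * \<psi> x i j) - (\<Sum>x\<in>?A. d x * \<psi> x i j)"
          by (simp add: sum_subtractf left_diff_distrib)
        also have "(\<Sum>x\<in>?A. c x * \<psi> x i j) = (\<Sum>x | c x \<noteq> 0. c x * \<psi> x i j)"
          by (rule sum.mono_neutral_right[OF A]) auto
        also have "(\<Sum>x\<in>?A. d x * \<psi> x i j) = (\<Sum>x | d x \<noteq> 0. d x * \<psi> x i j)"
          by (rule sum.mono_neutral_right[OF A]) auto
        finally show ?thesis using c(2) d(2) ij by (simp add: \<Psi>_diff)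
      qed
      then show ?case using finite_subset[OF sub A] by (intro exI[of _ "\<lambda>x. c x - d x"]) auto
    qed
    have "Matrix.mat n n (\<lambda>(i, j). M i j) \<in> \<Theta> ` carrier T"
      using \<Theta>_bij by (simp add: bij_betw_def)
    then obtain X where X: "X \<in> carrier T" "Matrix.mat n n (\<lambda>(i, j). M i j) = \<Theta> X" by blast
    obtain u where "X = \<rho> u"
      using X(1) by (auto simp: T_def FactRing_def A_RCOSETS_def' \<rho>_def)
    then have u: "Matrix.mat n n (\<lambda>(i, j). M i j) = \<Psi> u" using X by (simp add: \<Psi>_def)
    obtain c where c: "finite {x. c x \<noteq> 0}" "\<And>i j. i < n \<Longrightarrow> j < n \<Longrightarrow> \<Psi> u $$ (i, j) = (\<Sum>x | c x \<noteq> 0. c x * \<psi> x i j)"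
      using rep[of u] by blast
    have "M i j = (\<Sum>x | c x \<noteq> 0. c x * \<psi> x i j)" if "i < n" "j < n" for i j
      using c(2)[OF that] that by (simp flip: u)
    then show "\<exists>X c. finite X \<and> (\<forall>i<n. \<forall>j<n. M i j = (\<Sum>x\<in>X. c x * \<psi> x i j))"
      using c(1) by blast
  qed
  then show ?thesis using n by blast
qed

section \<open>Split division algebras\<close>

text \<open>
  A central division algebra with a spanning matrix representation over an extension \<open>K\<close> of its centre,
  and with explicit finite bases of \<open>K\<close> and of the algebra over that centre, for counting dimensions.
\<close>

locale split_division_algebra =
  emb: field_hom emb + D: vector_space scale
  for emb :: "'f::field \<Rightarrow> 'k::field" and scale :: "'f \<Rightarrow> 'd::ring_1 \<Rightarrow> 'd" +
  fixes B\<^sub>K :: "'k set" and B\<^sub>D :: "'d set" and n :: nat and \<psi> :: "'d \<Rightarrow> nat \<Rightarrow> nat \<Rightarrow> 'k"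
  assumes scale_mult_left: "scale c x * y = scale c (x * y)"
    and scale_mult_right: "x * scale c y = scale c (x * y)"
    and inverse_ex: "x \<noteq> 0 \<Longrightarrow> \<exists>y. y * x = 1 \<and> x * y = 1"
    and center: "(\<And>y. x * y = y * x) \<Longrightarrow> \<exists>c. x = scale c 1"
    and one_neq_0: "(1::'d) \<noteq> 0"
    and finite_BK: "finite B\<^sub>K"
    and indep_BK: "\<And>f b. (\<Sum>b\<in>B\<^sub>K. emb (f b) * b) = 0 \<Longrightarrow> b \<in> B\<^sub>K \<Longrightarrow> f b = 0"
    and span_BK: "\<exists>f. a = (\<Sum>b\<in>B\<^sub>K. emb (f b) * b)"
    and finite_BD: "finite B\<^sub>D"
    and indep_BD: "\<And>f d. (\<Sum>d\<in>B\<^sub>D. scale (f d) d) = 0 \<Longrightarrow> d \<in> B\<^sub>D \<Longrightarrow> f d = 0"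
    and span_BD: "\<exists>f. x = (\<Sum>d\<in>B\<^sub>D. scale (f d) d)"
    and n_pos: "n > 0"
    and representation: "spanning_matrix_representation scale emb n \<psi>"
begin

lemma \<psi>_add: "i < n \<Longrightarrow> j < n \<Longrightarrow> \<psi> (x + y) i j = \<psi> x i j + \<psi> y i j"
  and \<psi>_mult: "i < n \<Longrightarrow> j < n \<Longrightarrow> \<psi> (x * y) i j = (\<Sum>k<n. \<psi> x i k * \<psi> y k j)"
  and \<psi>_one: "i < n \<Longrightarrow> j < n \<Longrightarrow> \<psi> 1 i j = (if i = j then 1 else 0)"
  and \<psi>_scale: "i < n \<Longrightarrow> j < n \<Longrightarrow> \<psi> (scale c x) i j = emb c * \<psi> x i j"
  and \<psi>_span: "\<exists>X c. finite X \<and> (\<forall>i<n. \<forall>j<n. M i j = (\<Sum>x\<in>X. c x * \<psi> x i j))"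
  using representation unfolding spanning_matrix_representation_def by blast+

lemma \<psi>_zero: "i < n \<Longrightarrow> j < n \<Longrightarrow> \<psi> 0 i j = 0"
  using \<psi>_add[of i j 0 0] by (metis add.right_neutral add_left_cancel)

lemma \<psi>_diff: "i < n \<Longrightarrow> j < n \<Longrightarrow> \<psi> (x - y) i j = \<psi> x i j - \<psi> y i j"
  using \<psi>_add[of i j "x - y" y] by simp

lemma \<psi>_sum: "i < n \<Longrightarrow> j < n \<Longrightarrow> \<psi> (sum f A) i j = (\<Sum>x\<in>A. \<psi> (f x) i j)"
  by (induction A rule: infinite_finite_induct) (auto simp: \<psi>_zero \<psi>_add)

text \<open>
  Injectivity of \<open>D \<otimes>\<^sub>F K \<rightarrow> M\<^sub>n(K)\<close>. Scale a shortest relation so that one of the \<open>e b\<close> is \<open>1\<close>. Its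
  commutator with any element of \<open>D\<close> is shorter, hence trivial, so all \<open>e b\<close> are central; then the relation
  is a dependence between elements of \<open>B\<^sub>K\<close> over \<open>F\<close>.
\<close>

lemma tensor_relation_trivial:
  assumes "\<And>i j. i < n \<Longrightarrow> j < n \<Longrightarrow> (\<Sum>b\<in>B\<^sub>K. b * \<psi> (e b) i j) = 0"
  shows "\<forall>b\<in>B\<^sub>K. e b = 0"
  using assms
proof (induction "card {b \<in> B\<^sub>K. e b \<noteq> 0}" arbitrary: e rule: less_induct)
  case less
  have left: "(\<Sum>b\<in>B\<^sub>K. b * \<psi> (x * h b) i j) = 0"
    if h: "\<And>i j. i < n \<Longrightarrow> j < n \<Longrightarrow> (\<Sum>b\<in>B\<^sub>K. b * \<psi> (h b) i j) = 0" and ij: "i < n" "j < n" for x h i j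
  proof -
    have "(\<Sum>b\<in>B\<^sub>K. b * \<psi> (x * h b) i j) = (\<Sum>k<n. \<psi> x i k * (\<Sum>b\<in>B\<^sub>K. b * \<psi> (h b) k j))"
      by (simp only: \<psi>_mult[OF ij]) (rule sum_mult_sum_left_commute)
    then show ?thesis by (simp add: h ij)
  qed
  have right: "(\<Sum>b\<in>B\<^sub>K. b * \<psi> (h b * x) i j) = 0"
    if h: "\<And>i j. i < n \<Longrightarrow> j < n \<Longrightarrow> (\<Sum>b\<in>B\<^sub>K. b * \<psi> (h b) i j) = 0" and ij: "i < n" "j < n" for x h i j
  proof -
    have "(\<Sum>b\<in>B\<^sub>K. b * \<psi> (h b * x) i j) = (\<Sum>k<n. (\<Sum>b\<in>B\<^sub>K. b * \<psi> (h b) i k) * \<psi> x k j)"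
      by (simp only: \<psi>_mult[OF ij]) (rule sum_mult_sum_assoc)
    then show ?thesis by (simp add: h ij)
  qed
  show ?case
  proof (rule ccontr)
    assume "\<not> ?case"
    then obtain b0 where b0: "b0 \<in> B\<^sub>K" "e b0 \<noteq> 0" by blast
    obtain y where y: "y * e b0 = 1" using inverse_ex[OF b0(2)] by blast
    define h where "h = (\<lambda>b. y * e b)"
    have h: "(\<Sum>b\<in>B\<^sub>K. b * \<psi> (h b) i j) = 0" if "i < n" "j < n" for i j
      unfolding h_def by (rule left[OF less.prems that])
    have "h b0 = 1" by (simp add: h_def y)
    have comm: "x * h b = h b * x" if "b \<in> B\<^sub>K" for x b
    proof -
      have "\<forall>b\<in>B\<^sub>K. x * h b - h b * x = 0"
      proof (rule less.hyps)
        show "card {b \<in> B\<^sub>K. x * h b - h b * x \<noteq> 0} < card {b \<in> B\<^sub>K. e b \<noteq> 0}"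
        proof (rule psubset_card_mono)
          have "e b = 0 \<Longrightarrow> x * h b - h b * x = 0" for b by (simp add: h_def)
          moreover have "x * h b0 - h b0 * x = 0" by (simp add: \<open>h b0 = 1\<close>)
          ultimately show "{b \<in> B\<^sub>K. x * h b - h b * x \<noteq> 0} \<subset> {b \<in> B\<^sub>K. e b \<noteq> 0}"
            using b0 by blast
        qed (use finite_BK in auto)
        fix i j assume ij: "i < n" "j < n"
        show "(\<Sum>b\<in>B\<^sub>K. b * \<psi> (x * h b - h b * x) i j) = 0"
          using left[OF h ij] right[OF h ij]
          by (simp add: \<psi>_diff ij right_diff_distrib sum_subtractf)
      qed
      then show ?thesis using that by auto
    qed
    have "\<forall>b\<in>B\<^sub>K. \<exists>c. h b = scale c 1"
      using center comm by metis
    then obtain c where c: "\<And>b. b \<in> B\<^sub>K \<Longrightarrow> h b = scale (c b) 1" by metis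
    have "(\<Sum>b\<in>B\<^sub>K. emb (c b) * b) = (\<Sum>b\<in>B\<^sub>K. b * \<psi> (h b) 0 0)"
      by (intro sum.cong refl) (simp add: c \<psi>_scale \<psi>_one n_pos)
    then have "c b0 = 0" using h[OF n_pos n_pos] b0(1) by (intro indep_BK) auto
    then show False using c[OF b0(1)] \<open>h b0 = 1\<close> one_neq_0 by simp
  qed
qed

lemma representation_independent:
  assumes a: "\<And>i j. i < n \<Longrightarrow> j < n \<Longrightarrow> (\<Sum>d\<in>B\<^sub>D. a d * \<psi> d i j) = 0" and "d \<in> B\<^sub>D"
  shows "a d = 0"
proof -
  have "\<forall>d. \<exists>f. a d = (\<Sum>b\<in>B\<^sub>K. emb (f b) * b)" using span_BK by blast
  from choice[OF this] obtain f where f: "\<And>d. a d = (\<Sum>b\<in>B\<^sub>K. emb (f d b) * b)" by blast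
  define e where "e = (\<lambda>b. \<Sum>d\<in>B\<^sub>D. scale (f d b) d)"
  have "\<forall>b\<in>B\<^sub>K. e b = 0"
  proof (rule tensor_relation_trivial)
    fix i j assume ij: "i < n" "j < n"
    have "(\<Sum>b\<in>B\<^sub>K. b * \<psi> (e b) i j) = (\<Sum>b\<in>B\<^sub>K. \<Sum>d\<in>B\<^sub>D. emb (f d b) * b * \<psi> d i j)"
      by (simp add: e_def \<psi>_sum ij \<psi>_scale sum_distrib_left algebra_simps)
    also have "\<dots> = (\<Sum>d\<in>B\<^sub>D. a d * \<psi> d i j)"
      by (subst sum.swap) (simp add: f sum_distrib_right)
    finally show "(\<Sum>b\<in>B\<^sub>K. b * \<psi> (e b) i j) = 0" using a[OF ij] by simp
  qed
  then have "f d b = 0" if "b \<in> B\<^sub>K" for b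
    using indep_BD[of "\<lambda>d. f d b" d] that assms(2) by (auto simp: e_def)
  then show ?thesis by (simp add: f)
qed

lemma representation_spans: "\<exists>a. \<forall>i<n. \<forall>j<n. M i j = (\<Sum>d\<in>B\<^sub>D. a d * \<psi> d i j)"
proof -
  obtain X c where X: "\<And>i j. i < n \<Longrightarrow> j < n \<Longrightarrow> M i j = (\<Sum>x\<in>X. c x * \<psi> x i j)"
    using \<psi>_span[of M] by blast
  obtain g where g: "\<And>x. x = (\<Sum>d\<in>B\<^sub>D. scale (g x d) d)" using span_BD by metis
  have "M i j = (\<Sum>d\<in>B\<^sub>D. (\<Sum>x\<in>X. c x * emb (g x d)) * \<psi> d i j)" if ij: "i < n" "j < n" for i j
  proof -
    have e: "\<psi> x i j = (\<Sum>d\<in>B\<^sub>D. emb (g x d) * \<psi> d i j)" for x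
      by (subst g[of x]) (simp add: \<psi>_sum ij \<psi>_scale)
    have "M i j = (\<Sum>x\<in>X. c x * (\<Sum>d\<in>B\<^sub>D. emb (g x d) * \<psi> d i j))"
      by (simp add: X ij flip: e)
    then show ?thesis by (simp only: sum_mult_sum_assoc)
  qed
  then show ?thesis by (intro exI[of _ "\<lambda>d. \<Sum>x\<in>X. c x * emb (g x d)"]) auto
qed

text \<open>
  A basis of \<open>D\<close> over \<open>F\<close> becomes a basis of the matrices over \<open>K\<close>.
\<close>

lemma card_BD: "card B\<^sub>D = n * n"
proof (rule antisym)
  let ?P = "{..<n} \<times> {..<n}"
  show "card B\<^sub>D \<le> n * n"
  proof (rule ccontr)
    assume "\<not> ?thesis"
    then have "card ?P < card B\<^sub>D" by simp
    then obtain x where x: "\<exists>d\<in>B\<^sub>D. x d \<noteq> 0" "\<forall>p\<in>?P. (\<Sum>d\<in>B\<^sub>D. \<psi> d (fst p) (snd p) * x d) = 0"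
      using homogeneous_system[of ?P B\<^sub>D "\<lambda>p d. \<psi> d (fst p) (snd p)"] finite_BD by auto
    have "(\<Sum>d\<in>B\<^sub>D. x d * \<psi> d i j) = 0" if "i < n" "j < n" for i j
      using bspec[OF x(2), of "(i, j)"] that by (simp add: mult.commute)
    then show False using representation_independent x(1) by blast
  qed
  show "n * n \<le> card B\<^sub>D"
  proof (rule ccontr)
    assume "\<not> ?thesis"
    then have less: "card B\<^sub>D < card ?P" by simp
    have "\<exists>a. \<forall>i<n. \<forall>j<n. (if (i, j) = p then 1 else 0) = (\<Sum>d\<in>B\<^sub>D. a d * \<psi> d i j)" for p
      by (rule representation_spans)
    then obtain a where a: "\<And>p i j. i < n \<Longrightarrow> j < n \<Longrightarrow>
        (if (i, j) = p then 1 else 0) = (\<Sum>d\<in>B\<^sub>D. a p d * \<psi> d i j)" by metis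
    obtain x where x: "\<exists>p\<in>?P. x p \<noteq> 0" "\<And>d. d \<in> B\<^sub>D \<Longrightarrow> (\<Sum>p\<in>?P. a p d * x p) = 0"
      using homogeneous_system[OF finite_BD _ less, of "\<lambda>d p. a p d"] by auto
    have "x p = 0" if "p \<in> ?P" for p
    proof -
      have e: "(if p = p' then 1 else 0) = (\<Sum>d\<in>B\<^sub>D. a p' d * \<psi> d (fst p) (snd p))" for p'
        using a[of "fst p" "snd p" p'] that by (simp add: mem_Times_iff)
      have "x p = (\<Sum>p'\<in>?P. x p' * (if p = p' then 1 else 0))"
        using that by (simp add: if_distrib sum.delta cong: if_cong)
      also have "\<dots> = (\<Sum>p'\<in>?P. x p' * (\<Sum>d\<in>B\<^sub>D. a p' d * \<psi> d (fst p) (snd p)))"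
        by (simp only: e)
      also have "\<dots> = (\<Sum>p'\<in>?P. \<Sum>d\<in>B\<^sub>D. (a p' d * x p') * \<psi> d (fst p) (snd p))"
        by (simp add: sum_distrib_left algebra_simps)
      also have "\<dots> = (\<Sum>d\<in>B\<^sub>D. (\<Sum>p'\<in>?P. a p' d * x p') * \<psi> d (fst p) (snd p))"
        by (subst sum.swap) (simp add: sum_distrib_right)
      finally show ?thesis by (simp add: x(2))
    qed
    then show False using x(1) by blast
  qed
qed

text \<open>
  Let \<open>\<Delta>\<close> be the \<open>K\<close>-linear extension of \<open>\<psi> d \<mapsto> \<delta> (\<psi> d)\<close> to all matrices. It is a derivation, and a
  derivation of a matrix ring is inner, given by \<open>c = \<Sum>\<^sub>l \<Delta>(E\<^sub>l\<^sub>0) E\<^sub>0\<^sub>l\<close> with matrix units \<open>E\<^sub>i\<^sub>j\<close>; thus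
  \<open>c i j\<close> is the entry \<open>(i, 0)\<close> of \<open>\<Delta>(E\<^sub>j\<^sub>0)\<close>. The two sides of the identity come from computing that entry of
  \<open>\<Delta>(\<psi> y E\<^sub>j\<^sub>0)\<close> by the Leibniz rule, and from writing \<open>\<psi> y E\<^sub>j\<^sub>0 = \<Sum>\<^sub>k (\<psi> y)\<^sub>k\<^sub>j E\<^sub>k\<^sub>0\<close>.
\<close>

lemma derivation_of_representation_inner:
  assumes \<delta>: "derivation \<delta>" and const: "\<And>c. \<delta> (emb c) = 0"
  shows "\<exists>c. \<forall>y. \<forall>i<n. \<forall>j<n. \<delta> (\<psi> y i j) = (\<Sum>k<n. c i k * \<psi> y k j) - (\<Sum>k<n. \<psi> y i k * c k j)"
proof -
  have \<delta>_add: "\<delta> (a + b) = \<delta> a + \<delta> b" and \<delta>_mult: "\<delta> (a * b) = a * \<delta> b + \<delta> a * b" for a b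
    using \<delta> by (auto simp: derivation_def)
  have \<delta>_sum: "\<delta> (sum f A) = (\<Sum>i\<in>A. \<delta> (f i))" for f :: "'x \<Rightarrow> 'k" and A
    by (induction A rule: infinite_finite_induct) (auto simp: \<delta>_add derivation_0[OF \<delta>])
  have "\<exists>a. \<forall>r<n. \<forall>s<n. (if r = j \<and> s = 0 then 1 else 0) = (\<Sum>d\<in>B\<^sub>D. a d * \<psi> d r s)" for j
    by (rule representation_spans)
  then obtain a where a: "\<And>j r s. r < n \<Longrightarrow> s < n \<Longrightarrow>
      (\<Sum>d\<in>B\<^sub>D. a j d * \<psi> d r s) = (if r = j \<and> s = 0 then 1 else 0)" by metis
  obtain g where g: "\<And>x. x = (\<Sum>d\<in>B\<^sub>D. scale (g x d) d)" using span_BD by metis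
  have \<psi>_g: "\<psi> x i j = (\<Sum>d\<in>B\<^sub>D. emb (g x d) * \<psi> d i j)" if "i < n" "j < n" for x i j
    by (subst g[of x]) (simp add: \<psi>_sum that \<psi>_scale)
  define c where "c = (\<lambda>i j. \<Sum>d\<in>B\<^sub>D. a j d * \<delta> (\<psi> d i 0))"
  have "\<delta> (\<psi> y i j) + (\<Sum>k<n. \<psi> y i k * c k j) = (\<Sum>k<n. c i k * \<psi> y k j)" if ij: "i < n" "j < n" for y i j
  proof -
    have coeffs: "(\<Sum>d\<in>B\<^sub>D. a j d * emb (g (y * d) d')) = (\<Sum>k<n. \<psi> y k j * a k d')" if d': "d' \<in> B\<^sub>D" for d'
    proof -
      have "(\<Sum>d\<in>B\<^sub>D. a j d * emb (g (y * d) d')) - (\<Sum>k<n. \<psi> y k j * a k d') = 0"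
      proof (rule representation_independent[OF _ d'])
        fix r s assume rs: "r < n" "s < n"
        have "(\<Sum>d'\<in>B\<^sub>D. (\<Sum>d\<in>B\<^sub>D. a j d * emb (g (y * d) d')) * \<psi> d' r s) =
            (\<Sum>d\<in>B\<^sub>D. a j d * (\<Sum>d'\<in>B\<^sub>D. emb (g (y * d) d') * \<psi> d' r s))"
          by (rule sum_mult_sum_assoc[symmetric])
        also have "\<dots> = (\<Sum>d\<in>B\<^sub>D. a j d * \<psi> (y * d) r s)"
          by (simp flip: \<psi>_g[OF rs])
        also have "\<dots> = (\<Sum>k<n. \<psi> y r k * (\<Sum>d\<in>B\<^sub>D. a j d * \<psi> d k s))"
          by (simp only: \<psi>_mult[OF rs]) (rule sum_mult_sum_left_commute)
        also have "\<dots> = (\<Sum>k<n. \<psi> y r k * (if k = j \<and> s = 0 then 1 else 0))"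
          by (intro sum.cong refl) (simp add: a rs)
        also have "\<dots> = (if s = 0 then \<psi> y r j else 0)"
          using ij by (auto simp: if_distrib sum.delta cong: if_cong)
        also have "\<dots> = (\<Sum>k<n. \<psi> y k j * (if r = k \<and> s = 0 then 1 else 0))"
          using rs by (auto simp: if_distrib sum.delta cong: if_cong)
        also have "\<dots> = (\<Sum>k<n. \<psi> y k j * (\<Sum>d'\<in>B\<^sub>D. a k d' * \<psi> d' r s))"
          by (intro sum.cong refl) (simp add: a rs)
        also have "\<dots> = (\<Sum>d'\<in>B\<^sub>D. (\<Sum>k<n. \<psi> y k j * a k d') * \<psi> d' r s)"
          by (rule sum_mult_sum_assoc)
        finally show "(\<Sum>d'\<in>B\<^sub>D. ((\<Sum>d\<in>B\<^sub>D. a j d * emb (g (y * d) d')) - (\<Sum>k<n. \<psi> y k j * a k d')) * \<psi> d' r s) = 0"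
          by (simp add: left_diff_distrib sum_subtractf)
      qed
      then show ?thesis by simp
    qed
    have "(\<Sum>d\<in>B\<^sub>D. a j d * \<delta> (\<psi> (y * d) i 0)) =
        (\<Sum>d\<in>B\<^sub>D. a j d * (\<Sum>d'\<in>B\<^sub>D. emb (g (y * d) d') * \<delta> (\<psi> d' i 0)))"
      by (subst \<psi>_g[OF ij(1) n_pos]) (simp add: \<delta>_sum \<delta>_mult const)
    also have "\<dots> = (\<Sum>d'\<in>B\<^sub>D. (\<Sum>d\<in>B\<^sub>D. a j d * emb (g (y * d) d')) * \<delta> (\<psi> d' i 0))"
      by (rule sum_mult_sum_assoc)
    also have "\<dots> = (\<Sum>d'\<in>B\<^sub>D. (\<Sum>k<n. \<psi> y k j * a k d') * \<delta> (\<psi> d' i 0))"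
      by (intro sum.cong refl) (simp add: coeffs)
    also have "\<dots> = (\<Sum>k<n. c i k * \<psi> y k j)"
      by (subst sum_mult_sum_assoc[symmetric]) (simp add: c_def mult.commute)
    finally have 1: "(\<Sum>d\<in>B\<^sub>D. a j d * \<delta> (\<psi> (y * d) i 0)) = (\<Sum>k<n. c i k * \<psi> y k j)" .
    have "(\<Sum>d\<in>B\<^sub>D. a j d * \<delta> (\<psi> (y * d) i 0)) =
        (\<Sum>d\<in>B\<^sub>D. \<Sum>k<n. a j d * (\<psi> y i k * \<delta> (\<psi> d k 0))) + (\<Sum>d\<in>B\<^sub>D. \<Sum>k<n. a j d * (\<delta> (\<psi> y i k) * \<psi> d k 0))"
      by (simp add: \<psi>_mult ij n_pos \<delta>_sum \<delta>_mult sum.distrib sum_distrib_left distrib_left)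
    also have "(\<Sum>d\<in>B\<^sub>D. \<Sum>k<n. a j d * (\<psi> y i k * \<delta> (\<psi> d k 0))) = (\<Sum>k<n. \<psi> y i k * c k j)"
      by (subst sum.swap) (simp add: c_def sum_distrib_left mult.left_commute)
    also have "(\<Sum>d\<in>B\<^sub>D. \<Sum>k<n. a j d * (\<delta> (\<psi> y i k) * \<psi> d k 0)) =
        (\<Sum>k<n. \<delta> (\<psi> y i k) * (\<Sum>d\<in>B\<^sub>D. a j d * \<psi> d k 0))"
      by (subst sum.swap) (simp add: sum_distrib_left mult.left_commute)
    also have "\<dots> = (\<Sum>k<n. \<delta> (\<psi> y i k) * (if k = j then 1 else 0))"
      by (intro sum.cong refl) (simp add: a n_pos)
    also have "\<dots> = \<delta> (\<psi> y i j)"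
      using ij by (auto simp: if_distrib sum.delta cong: if_cong)
    finally show ?thesis using 1 by simp
  qed
  then show ?thesis by (intro exI[of _ c]) (auto simp: eq_diff_eq)
qed

end

section \<open>Row vectors as a module over differential polynomials and over D\<close>

text \<open>
  The product of a row vector with an \<open>m \<times> m\<close> matrix, the coefficients of \<open>v\<close> below \<open>m\<close> being the coordinates.
\<close>

definition row_mult :: "nat \<Rightarrow> (nat \<Rightarrow> nat \<Rightarrow> 'k::field) \<Rightarrow> 'k poly \<Rightarrow> 'k poly" where
  "row_mult m M v = (\<Sum>j<m. Polynomial.monom (\<Sum>i<m. Polynomial.coeff v i * M i j) j)"

lemma coeff_row_mult:
  "Polynomial.coeff (row_mult m M v) j = (if j < m then \<Sum>i<m. Polynomial.coeff v i * M i j else 0)"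
  by (simp add: row_mult_def coeff_sum if_distrib sum.delta cong: if_cong)

lemma coeff_poly_less: "degree v < m \<Longrightarrow> j \<ge> m \<Longrightarrow> Polynomial.coeff v j = 0"
  by (simp add: coeff_eq_0)

lemma degree_lessI: "(\<And>j. j \<ge> m \<Longrightarrow> Polynomial.coeff v j = 0) \<Longrightarrow> m > 0 \<Longrightarrow> degree v < m"
  using degree_le[of "m - 1" v] by fastforce

text \<open>
  The matrix \<open>c\<close> is that of a connection: it corrects the coordinatewise action of \<open>\<delta>\<close> on row vectors
  so that the result commutes with \<open>D\<close>.
\<close>

locale split_division_algebra_with_connection =
  split_division_algebra emb scale B\<^sub>K B\<^sub>D m \<psi>
  for emb :: "'f::field \<Rightarrow> 'k::field" and scale :: "'f \<Rightarrow> 'd::ring_1 \<Rightarrow> 'd"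
    and B\<^sub>K B\<^sub>D m \<psi> +
  fixes \<delta> :: "'k \<Rightarrow> 'k" and c :: "nat \<Rightarrow> nat \<Rightarrow> 'k"
  assumes der: "derivation \<delta>" and Const_eq: "Const \<delta> = range emb"
    and connection: "i < m \<Longrightarrow> j < m \<Longrightarrow>
      \<delta> (\<psi> y i j) = (\<Sum>k<m. c i k * \<psi> y k j) - (\<Sum>k<m. \<psi> y i k * c k j)"
begin

definition act :: "'k poly \<Rightarrow> 'd \<Rightarrow> 'k poly" where
  "act v d = row_mult m (\<psi> d) v"

definition T :: "'k poly \<Rightarrow> 'k poly" where
  "T v = map_poly \<delta> v + row_mult m c v"

definition V :: "'k poly set" where
  "V = {v. degree v < m}"

sublocale family_independent_over_constants \<delta> B\<^sub>K
proof
  fix f b assume f: "\<And>b. b \<in> B\<^sub>K \<Longrightarrow> f b \<in> Const \<delta>" "(\<Sum>b\<in>B\<^sub>K. f b * b) = 0" "b \<in> B\<^sub>K"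
  have "\<forall>b\<in>B\<^sub>K. \<exists>a. f b = emb a" using f(1) Const_eq by blast
  then obtain a where a: "\<And>b. b \<in> B\<^sub>K \<Longrightarrow> f b = emb (a b)" by metis
  have "(\<Sum>b\<in>B\<^sub>K. emb (a b) * b) = 0" using f(2) a by simp
  then show "f b = 0" using indep_BK[of a b] f(3) a by simp
qed (rule der finite_BK)+

lemma V_add: "u \<in> V \<Longrightarrow> v \<in> V \<Longrightarrow> u + v \<in> V"
  by (simp add: V_def degree_add_less)

lemma V_smult: "v \<in> V \<Longrightarrow> Polynomial.smult a v \<in> V"
  using degree_smult_le[of a v] by (simp add: V_def)

lemma V_0: "0 \<in> V"
  by (simp add: V_def n_pos)

lemma V_sum: "(\<And>i. i \<in> A \<Longrightarrow> f i \<in> V) \<Longrightarrow> sum f A \<in> V"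
  by (induction A rule: infinite_finite_induct) (auto intro: V_add V_0)

lemma act_V: "act v d \<in> V"
  unfolding V_def act_def by (auto intro!: degree_lessI simp: coeff_row_mult n_pos)

lemma T_V: "v \<in> V \<Longrightarrow> T v \<in> V"
  unfolding V_def T_def
  by (auto intro!: degree_lessI simp: coeff_row_mult coeff_map_poly coeff_poly_less n_pos)

lemma act_add_left: "act (u + v) d = act u d + act v d"
  by (rule poly_eqI) (simp add: act_def coeff_row_mult distrib_right sum.distrib)

lemma act_smult: "act (Polynomial.smult a v) d = Polynomial.smult a (act v d)"
  by (rule poly_eqI) (simp add: act_def coeff_row_mult mult.assoc sum_distrib_left)

lemma act_add_right: "act v (x + y) = act v x + act v y"
  by (rule poly_eqI) (simp add: act_def coeff_row_mult \<psi>_add distrib_left sum.distrib)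

lemma act_scale: "act v (scale a d) = Polynomial.smult (emb a) (act v d)"
  by (rule poly_eqI) (simp add: act_def coeff_row_mult \<psi>_scale sum_distrib_left mult.left_commute)

lemma act_0_left [simp]: "act 0 d = 0"
  by (rule poly_eqI) (simp add: act_def coeff_row_mult)

lemma act_0_right [simp]: "act v 0 = 0"
  by (rule poly_eqI) (simp add: act_def coeff_row_mult \<psi>_zero)

lemma act_minus_right: "act v (- x) = - act v x"
  using act_add_right[of v x "- x"] by (simp add: eq_neg_iff_add_eq_0 add.commute)

lemma act_sum_left: "act (sum f A) d = (\<Sum>i\<in>A. act (f i) d)"
  by (induction A rule: infinite_finite_induct) (auto simp: act_add_left)

lemma act_sum_right: "act v (sum f A) = (\<Sum>i\<in>A. act v (f i))"
  by (induction A rule: infinite_finite_induct) (auto simp: act_add_right)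

lemma act_one: "v \<in> V \<Longrightarrow> act v 1 = v"
  by (rule poly_eqI)
     (auto simp: act_def coeff_row_mult \<psi>_one V_def coeff_poly_less if_distrib sum.delta cong: if_cong)

lemma act_mult: "act v (x * y) = act (act v x) y"
proof (rule poly_eqI)
  fix j
  show "Polynomial.coeff (act v (x * y)) j = Polynomial.coeff (act (act v x) y) j"
  proof (cases "j < m")
    case True
    have "(\<Sum>i<m. Polynomial.coeff v i * \<psi> (x * y) i j) =
        (\<Sum>i<m. Polynomial.coeff v i * (\<Sum>k<m. \<psi> x i k * \<psi> y k j))"
      using True by (simp add: \<psi>_mult)
    also have "\<dots> = (\<Sum>k<m. (\<Sum>i<m. Polynomial.coeff v i * \<psi> x i k) * \<psi> y k j)"
      by (rule sum_mult_sum_assoc)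
    finally show ?thesis using True by (simp add: act_def coeff_row_mult)
  qed (simp add: act_def coeff_row_mult)
qed

sublocale M: differential_module \<delta> T
proof
  show "semilinear \<delta> T"
    unfolding semilinear_def T_def
    by (auto intro!: poly_eqI
        simp: coeff_row_mult coeff_map_poly \<delta>_add \<delta>_mult distrib_left distrib_right sum.distrib
          mult.assoc sum_distrib_left)
qed (rule der)

text \<open>
  This is where the defining property of \<open>c\<close> enters: the derivative of \<open>\<psi> d\<close> cancels against the commutator
  of \<open>\<psi> d\<close> with \<open>c\<close>.
\<close>

lemma T_act: "T (act v d) = act (T v) d" if "v \<in> V"
proof (rule poly_eqI)
  fix j
  show "Polynomial.coeff (T (act v d)) j = Polynomial.coeff (act (T v) d) j"
  proof (cases "j < m")
    case True
    let ?v = "Polynomial.coeff v"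
    have "\<delta> (\<Sum>i<m. ?v i * \<psi> d i j) =
        (\<Sum>i<m. \<delta> (?v i) * \<psi> d i j) + (\<Sum>i<m. ?v i * (\<Sum>k<m. c i k * \<psi> d k j)) - (\<Sum>i<m. ?v i * (\<Sum>k<m. \<psi> d i k * c k j))"
      using True by (simp add: \<delta>_sum \<delta>_mult connection sum.distrib right_diff_distrib sum_subtractf)
    also have "\<dots> = (\<Sum>i<m. (\<delta> (?v i) + (\<Sum>k<m. ?v k * c k i)) * \<psi> d i j) - (\<Sum>k<m. (\<Sum>i<m. ?v i * \<psi> d i k) * c k j)"
      by (simp only: sum_mult_sum_assoc distrib_right sum.distrib)
    finally show ?thesis
      using True by (simp add: T_def act_def coeff_row_mult coeff_map_poly)
  qed (simp add: T_def act_def coeff_row_mult coeff_map_poly)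
qed

lemma T_pow_V: "v \<in> V \<Longrightarrow> (T ^^ i) v \<in> V"
  by (induction i) (auto intro: T_V)

lemma dact_V: "v \<in> V \<Longrightarrow> dact T g v \<in> V"
  unfolding dact_def by (intro V_sum V_smult T_pow_V)

lemma dact_act: "v \<in> V \<Longrightarrow> dact T g (act v d) = act (dact T g v) d"
proof -
  assume v: "v \<in> V"
  have "(T ^^ i) (act v d) = act ((T ^^ i) v) d" for i
    by (induction i) (auto simp: T_act T_pow_V v)
  then show ?thesis by (simp add: dact_def act_sum_left act_smult)
qed

lemma act_eq_0_iff: "v \<in> V \<Longrightarrow> act v d = 0 \<longleftrightarrow> v = 0 \<or> d = 0"
proof -
  assume v: "v \<in> V"
  have "v = 0" if d: "act v d = 0" "d \<noteq> 0"
  proof -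
    obtain y where "d * y = 1" using inverse_ex[OF d(2)] by blast
    then have "v = act (act v d) y" using act_one[OF v] by (simp flip: act_mult)
    then show ?thesis using d by simp
  qed
  then show ?thesis by auto
qed

definition right_independent :: "'k poly set \<Rightarrow> bool" where
  "right_independent S \<longleftrightarrow> finite S \<and> S \<subseteq> V \<and>
     (\<forall>h. (\<Sum>s\<in>S. act s (h s)) = 0 \<longrightarrow> (\<forall>s\<in>S. h s = 0))"

text \<open>
  Comparing dimensions over \<open>F\<close>: an independent \<open>S\<close> spans a space of dimension \<open>card S * m\<^sup>2\<close> inside \<open>V\<close>,
  whose dimension is \<open>m * card B\<^sub>K\<close>.
\<close>

lemma right_independent_card_le:
  assumes "right_independent S"
  shows "card S * m \<le> card B\<^sub>K"
proof (rule ccontr)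
  assume "\<not> ?thesis"
  then have "card B\<^sub>K < card S * m" by simp
  then have "m * card B\<^sub>K < m * (card S * m)" using n_pos by simp
  then have less: "card ({..<m} \<times> B\<^sub>K) < card (S \<times> B\<^sub>D)"
    by (simp add: card_cartesian_product card_BD ac_simps)
  have fin: "finite S" using assms by (simp add: right_independent_def)
  have "\<forall>z. \<exists>f. z = (\<Sum>b\<in>B\<^sub>K. emb (f b) * b)" using span_BK by blast
  from choice[OF this] obtain f where f: "\<And>z. z = (\<Sum>b\<in>B\<^sub>K. emb (f z b) * b)" by blast
  obtain x where x: "\<exists>p\<in>S \<times> B\<^sub>D. x p \<noteq> 0"
    "\<And>j b. j < m \<Longrightarrow> b \<in> B\<^sub>K \<Longrightarrow> (\<Sum>p\<in>S \<times> B\<^sub>D. f (Polynomial.coeff (act (fst p) (snd p)) j) b * x p) = 0"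
    using homogeneous_system[OF _ _ less, of "\<lambda>i p. f (Polynomial.coeff (act (fst p) (snd p)) (fst i)) (snd i)"]
      finite_BK finite_BD fin by (auto simp: Ball_def)
  define h where "h = (\<lambda>s. \<Sum>d\<in>B\<^sub>D. scale (x (s, d)) d)"
  have "(\<Sum>s\<in>S. act s (h s)) = 0"
  proof (rule poly_eqI)
    fix j
    have "Polynomial.coeff (\<Sum>s\<in>S. act s (h s)) j =
        (\<Sum>p\<in>S \<times> B\<^sub>D. emb (x p) * Polynomial.coeff (act (fst p) (snd p)) j)"
      by (simp add: h_def act_sum_right act_scale coeff_sum sum.cartesian_product split_beta)
    also have "\<dots> = 0"
    proof (cases "j < m")
      case True
      have "(\<Sum>p\<in>S \<times> B\<^sub>D. emb (x p) * Polynomial.coeff (act (fst p) (snd p)) j) =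
          (\<Sum>p\<in>S \<times> B\<^sub>D. emb (x p) * (\<Sum>b\<in>B\<^sub>K. emb (f (Polynomial.coeff (act (fst p) (snd p)) j) b) * b))"
        by (simp flip: f)
      also have "\<dots> = (\<Sum>b\<in>B\<^sub>K. (\<Sum>p\<in>S \<times> B\<^sub>D. emb (x p) * emb (f (Polynomial.coeff (act (fst p) (snd p)) j) b)) * b)"
        by (rule sum_mult_sum_assoc)
      also have "\<dots> = (\<Sum>b\<in>B\<^sub>K. emb (\<Sum>p\<in>S \<times> B\<^sub>D. f (Polynomial.coeff (act (fst p) (snd p)) j) b * x p) * b)"
        by (simp add: emb.hom_sum emb.hom_mult mult.commute)
      also have "\<dots> = 0" using x(2)[OF True] by simp
      finally show ?thesis .
    next
      case False
      then show ?thesis by (simp add: act_def coeff_row_mult)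
    qed
    finally show "Polynomial.coeff (\<Sum>s\<in>S. act s (h s)) j = Polynomial.coeff 0 j" by simp
  qed
  then have h: "\<forall>s\<in>S. h s = 0" using assms unfolding right_independent_def by blast
  have "x (s, d) = 0" if "s \<in> S" "d \<in> B\<^sub>D" for s d
    using h that indep_BD[of "\<lambda>d. x (s, d)" d] by (simp add: h_def)
  then show False using x(1) by auto
qed

definition right_basis :: "'k poly set \<Rightarrow> bool" where
  "right_basis S \<longleftrightarrow> right_independent S \<and> (\<forall>w\<in>V. \<exists>h. w = (\<Sum>s\<in>S. act s (h s)))"

text \<open>
  The usual argument for vector spaces works over the skew field \<open>D\<close>; the cardinality bound provides an
  independent set of maximal size.
\<close>

lemma right_basis_extend:
  assumes "right_independent S0"
  obtains S where "S0 \<subseteq> S" "right_basis S"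
proof -
  define P where "P = (\<lambda>S. S0 \<subseteq> S \<and> right_independent S)"
  have "card S < Suc (card B\<^sub>K)" if "P S" for S
  proof -
    have "card S * 1 \<le> card S * m" using n_pos by (intro mult_le_mono2) simp
    also have "\<dots> \<le> card B\<^sub>K" using that right_independent_card_le by (simp add: P_def)
    finally show ?thesis by simp
  qed
  moreover have "P S0" using assms by (simp add: P_def)
  ultimately obtain S where S: "P S" "\<And>S'. P S' \<Longrightarrow> card S' \<le> card S"
    using ex_has_greatest_nat[of P S0 card "Suc (card B\<^sub>K)"] by blast
  have fin: "finite S" and SV: "S \<subseteq> V" and ind: "right_independent S"
    using S(1) by (auto simp: P_def right_independent_def)
  have "\<exists>h. w = (\<Sum>s\<in>S. act s (h s))" if w: "w \<in> V" for w
  proof (rule ccontr)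
    assume contra: "\<not> ?thesis"
    have "w \<notin> S"
    proof
      assume "w \<in> S"
      have "(\<Sum>s\<in>S. act s (if s = w then 1 else 0)) = (\<Sum>s\<in>S. if s = w then act w 1 else 0)"
        by (intro sum.cong) auto
      also have "\<dots> = w" using \<open>w \<in> S\<close> fin act_one[OF w] by simp
      finally show False using contra by (metis (no_types))
    qed
    have "right_independent (insert w S)"
      unfolding right_independent_def
    proof (intro conjI allI impI)
      fix h assume "(\<Sum>s\<in>insert w S. act s (h s)) = 0"
      then have sum: "act w (h w) + (\<Sum>s\<in>S. act s (h s)) = 0" using fin \<open>w \<notin> S\<close> by simp
      have "h w = 0"
      proof (rule ccontr)
        assume "h w \<noteq> 0"
        then obtain y where y: "h w * y = 1" using inverse_ex by blast
        have "act (act w (h w) + (\<Sum>s\<in>S. act s (h s))) y = 0" by (simp only: sum act_0_left)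
        then have "w + (\<Sum>s\<in>S. act s (h s * y)) = 0"
          by (simp add: act_add_left act_sum_left y act_one[OF w] flip: act_mult)
        then have "w = (\<Sum>s\<in>S. act s (- (h s * y)))"
          by (simp add: act_minus_right sum_negf eq_neg_iff_add_eq_0)
        then have "\<exists>h. w = (\<Sum>s\<in>S. act s (h s))"
          by (rule exI[where x = "\<lambda>s. - (h s * y)"])
        then show False using contra by contradiction
      qed
      moreover have "\<forall>s\<in>S. h s = 0"
        using sum ind \<open>h w = 0\<close> unfolding right_independent_def by auto
      ultimately show "\<forall>s\<in>insert w S. h s = 0" by simp
    qed (use fin SV w in auto)
    then have "P (insert w S)" using S(1) by (auto simp: P_def)
    from S(2)[OF this] show False using fin \<open>w \<notin> S\<close> by simp
  qed
  then show ?thesis using that[of S] S(1) ind by (auto simp: P_def right_basis_def)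
qed

text \<open>
  The opposite comparison of \<open>F\<close>-dimensions, using that a basis spans.
\<close>

lemma right_basis_card:
  assumes "right_basis S"
  shows "card S * m = card B\<^sub>K"
proof (rule antisym)
  show "card S * m \<le> card B\<^sub>K"
    using assms right_independent_card_le by (simp add: right_basis_def)
  have fin: "finite S" using assms by (simp add: right_basis_def right_independent_def)
  show "card B\<^sub>K \<le> card S * m"
  proof (rule ccontr)
    assume "\<not> ?thesis"
    then have "card S * m < card B\<^sub>K" by simp
    then have "m * (card S * m) < m * card B\<^sub>K" using n_pos by simp
    then have less: "card (S \<times> B\<^sub>D) < card ({..<m} \<times> B\<^sub>K)"
      by (simp add: card_cartesian_product card_BD ac_simps)
    have "\<forall>p. \<exists>h. fst p < m \<longrightarrow> Polynomial.monom (snd p) (fst p) = (\<Sum>s\<in>S. act s (h s))"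
    proof
      fix p :: "nat \<times> 'k"
      have "fst p < m \<Longrightarrow> Polynomial.monom (snd p) (fst p) \<in> V"
        unfolding V_def by (auto intro!: degree_lessI simp: n_pos)
      then show "\<exists>h. fst p < m \<longrightarrow> Polynomial.monom (snd p) (fst p) = (\<Sum>s\<in>S. act s (h s))"
        using assms unfolding right_basis_def by blast
    qed
    from choice[OF this] obtain h where h: "\<And>p. fst p < m \<Longrightarrow> Polynomial.monom (snd p) (fst p) = (\<Sum>s\<in>S. act s (h p s))"
      by blast
    have "\<forall>x. \<exists>f. x = (\<Sum>d\<in>B\<^sub>D. scale (f d) d)" using span_BD by blast
    from choice[OF this] obtain g where g: "\<And>x. x = (\<Sum>d\<in>B\<^sub>D. scale (g x d) d)" by blast
    obtain x where x: "\<exists>p\<in>{..<m} \<times> B\<^sub>K. x p \<noteq> 0"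
      "\<And>s d. s \<in> S \<Longrightarrow> d \<in> B\<^sub>D \<Longrightarrow> (\<Sum>p\<in>{..<m} \<times> B\<^sub>K. g (h p s) d * x p) = 0"
      using homogeneous_system[OF _ _ less, of "\<lambda>i p. g (h p (fst i)) (snd i)"]
        finite_BK finite_BD fin by (auto simp: Ball_def)
    have zero: "(\<Sum>p\<in>{..<m} \<times> B\<^sub>K. scale (x p) (h p s)) = 0" if "s \<in> S" for s
    proof -
      have "(\<Sum>p\<in>{..<m} \<times> B\<^sub>K. scale (x p) (h p s)) =
          (\<Sum>p\<in>{..<m} \<times> B\<^sub>K. scale (x p) (\<Sum>d\<in>B\<^sub>D. scale (g (h p s) d) d))"
        by (simp flip: g)
      also have "\<dots> = (\<Sum>p\<in>{..<m} \<times> B\<^sub>K. \<Sum>d\<in>B\<^sub>D. scale (g (h p s) d * x p) d)"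
        by (simp add: D.scale_sum_right mult.commute)
      also have "\<dots> = (\<Sum>d\<in>B\<^sub>D. scale (\<Sum>p\<in>{..<m} \<times> B\<^sub>K. g (h p s) d * x p) d)"
        by (subst sum.swap) (simp add: D.scale_sum_left)
      also have "\<dots> = 0" using x(2)[OF that] by simp
      finally show ?thesis .
    qed
    have "(\<Sum>p\<in>{..<m} \<times> B\<^sub>K. Polynomial.smult (emb (x p)) (Polynomial.monom (snd p) (fst p))) =
        (\<Sum>p\<in>{..<m} \<times> B\<^sub>K. \<Sum>s\<in>S. act s (scale (x p) (h p s)))"
    proof (intro sum.cong refl)
      fix p assume "p \<in> {..<m} \<times> B\<^sub>K"
      then show "Polynomial.smult (emb (x p)) (Polynomial.monom (snd p) (fst p)) =
          (\<Sum>s\<in>S. act s (scale (x p) (h p s)))"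
        using h[of p] by (simp add: smult_sum act_scale mem_Times_iff)
    qed
    also have "\<dots> = (\<Sum>s\<in>S. act s (\<Sum>p\<in>{..<m} \<times> B\<^sub>K. scale (x p) (h p s)))"
      by (subst sum.swap) (simp add: act_sum_right)
    also have "\<dots> = 0" using zero by simp
    finally have eq: "(\<Sum>p\<in>{..<m} \<times> B\<^sub>K. Polynomial.smult (emb (x p)) (Polynomial.monom (snd p) (fst p))) = 0" .
    have "x (j, b) = 0" if "j < m" "b \<in> B\<^sub>K" for j b
    proof -
      have "0 = Polynomial.coeff (\<Sum>p\<in>{..<m} \<times> B\<^sub>K. Polynomial.smult (emb (x p)) (Polynomial.monom (snd p) (fst p))) j"
        by (simp only: eq coeff_0)
      also have "\<dots> = (\<Sum>i<m. \<Sum>b\<in>B\<^sub>K. emb (x (i, b)) * (if i = j then b else 0))"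
        by (simp add: coeff_sum sum.cartesian_product split_beta)
      also have "\<dots> = (\<Sum>i<m. if i = j then \<Sum>b\<in>B\<^sub>K. emb (x (j, b)) * b else 0)"
        by (intro sum.cong) auto
      also have "\<dots> = (\<Sum>b\<in>B\<^sub>K. emb (x (j, b)) * b)" using that by simp
      finally show ?thesis using indep_BK[of "\<lambda>b. x (j, b)" b] that by simp
    qed
    then show False using x(1) by auto
  qed
qed

lemma V_nonzero: "1 \<in> V" "(1 :: 'k poly) \<noteq> 0"
  by (auto simp: V_def n_pos)

text \<open>
  The coefficients of \<open>g\<close> below degree \<open>q = card B\<^sub>K\<close> are \<open>q\<close> unknowns, and prescribing \<open>g s\<close> for \<open>s \<in> S\<close> gives
  \<open>card S * m = q\<close> linear equations over \<open>K\<close>. The homogeneous system has only the trivial solution, because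
  an operator that is zero on \<open>S\<close> is zero on \<open>V\<close>; so the system is solvable.
\<close>

theorem density:
  assumes S: "right_basis S" and w: "\<And>s. s \<in> S \<Longrightarrow> w s \<in> V"
  shows "\<exists>g. \<forall>s\<in>S. dact T g s = w s"
proof -
  let ?q = "card B\<^sub>K"
  have fin: "finite S" and SV: "S \<subseteq> V" using S by (auto simp: right_basis_def right_independent_def)
  let ?J = "insert None (Some ` {..<?q})"
  have less: "card (S \<times> {..<m}) < card ?J"
    using right_basis_card[OF S] by (simp add: card_cartesian_product card_image)
  \<comment> \<open>The unknown None is a common factor of all targets; it makes the system homogeneous, with one
    unknown more than equations.\<close>
  define A where "A = (\<lambda>(s, j) i. case i of None \<Rightarrow> - Polynomial.coeff (w s) j
      | Some i \<Rightarrow> Polynomial.coeff ((T ^^ i) s) j)"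
  obtain x where x: "\<exists>i\<in>?J. x i \<noteq> 0" "\<And>p. p \<in> S \<times> {..<m} \<Longrightarrow> (\<Sum>i\<in>?J. A p i * x i) = 0"
    using homogeneous_system[OF _ _ less, of A] fin by blast
  define g where "g = (\<Sum>i<?q. Polynomial.monom (x (Some i)) i)"
  have coeff_g: "Polynomial.coeff g i = (if i < ?q then x (Some i) else 0)" for i
    by (simp add: g_def coeff_sum if_distrib sum.delta cong: if_cong)
  have q_pos: "?q > 0"
  proof (rule ccontr)
    assume "\<not> ?q > 0"
    then have "B\<^sub>K = {}" using finite_BK by auto
    then show False using span_BK[of 1] by simp
  qed
  have deg: "degree g < ?q" by (rule degree_lessI) (auto simp: coeff_g q_pos)
  have gs: "dact T g s = Polynomial.smult (x None) (w s)" if "s \<in> S" for s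
  proof (rule poly_eqI)
    fix j
    have in_V: "dact T g s \<in> V" "Polynomial.smult (x None) (w s) \<in> V"
      using that SV w by (auto intro: dact_V V_smult)
    show "Polynomial.coeff (dact T g s) j = Polynomial.coeff (Polynomial.smult (x None) (w s)) j"
    proof (cases "j < m")
      case True
      have "Polynomial.coeff (dact T g s) j = (\<Sum>i<?q. x (Some i) * Polynomial.coeff ((T ^^ i) s) j)"
        by (simp add: g_def dact_sum_left dact_monom coeff_sum)
      also have "\<dots> = x None * Polynomial.coeff (w s) j"
        using x(2)[of "(s, j)"] that True by (simp add: A_def sum.reindex mult.commute)
      finally show ?thesis by simp
    next
      case False
      then have "Polynomial.coeff u j = 0" if "u \<in> V" for u
        using that coeff_poly_less[of u m j] by (simp add: V_def)
      then show ?thesis using in_V by (simp only:)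
    qed
  qed
  have "x None \<noteq> 0"
  proof
    assume zero: "x None = 0"
    have "g = 0"
    proof (rule differential_module_faithful[of T V 1])
      show "differential_module \<delta> T" by (rule M.differential_module_axioms)
      fix v assume "v \<in> V"
      then obtain h where h: "v = (\<Sum>s\<in>S. act s (h s))" using S by (auto simp: right_basis_def)
      have "dact T g v = (\<Sum>s\<in>S. act (dact T g s) (h s))"
        unfolding h M.dact_sum_right using SV by (intro sum.cong refl dact_act) auto
      also have "\<dots> = 0" by (simp add: gs zero)
      finally show "dact T g v = 0" .
    qed (use V_nonzero V_smult deg in auto)
    then have "x (Some i) = 0" if "i < ?q" for i using coeff_g[of i] that by simp
    then show False using x(1) zero by auto
  qed
  then have "\<forall>s\<in>S. dact T (Polynomial.smult (inverse (x None)) g) s = w s"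
    by (simp add: dact_smult_left gs)
  then show ?thesis by blast
qed

text \<open>
  A nonzero vector belongs to a basis over \<open>D\<close>.
\<close>

lemma every_vector_cyclic:
  assumes "v \<in> V" "v \<noteq> 0" "w \<in> V"
  shows "\<exists>g. dact T g v = w"
proof -
  have "right_independent {v}"
    using assms act_eq_0_iff by (auto simp: right_independent_def)
  then obtain S where "{v} \<subseteq> S" "right_basis S" by (rule right_basis_extend)
  then show ?thesis using density[of S "\<lambda>_. w"] assms(3) by auto
qed

text \<open>
  If \<open>w\<close> is not in \<open>v D\<close>, both vectors belong to a common basis over \<open>D\<close>.
\<close>

lemma separating_operator:
  assumes "v \<in> V" "v \<noteq> 0" "w \<in> V" "\<And>d. w \<noteq> act v d"
  shows "\<exists>g. dact T g v = 0 \<and> dact T g w = w"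
proof -
  have "v \<noteq> w" using assms(4)[of 1] act_one[OF assms(1)] by auto
  have "right_independent {v, w}"
    unfolding right_independent_def
  proof (intro conjI allI impI)
    fix h assume "(\<Sum>s\<in>{v, w}. act s (h s)) = 0"
    then have sum: "act v (h v) + act w (h w) = 0" using \<open>v \<noteq> w\<close> by simp
    have "h w = 0"
    proof (rule ccontr)
      assume "h w \<noteq> 0"
      then obtain y where y: "h w * y = 1" using inverse_ex by blast
      have "act (act v (h v) + act w (h w)) y = 0" by (simp only: sum act_0_left)
      then have "act v (h v * y) + w = 0"
        by (simp add: act_add_left y act_one[OF assms(3)] flip: act_mult)
      then have "w = act v (- (h v * y))"
        by (simp add: act_minus_right eq_neg_iff_add_eq_0 add.commute)
      then show False using assms(4) by blast
    qed
    then show "\<forall>s\<in>{v, w}. h s = 0" using sum act_eq_0_iff[OF assms(1)] assms(2) by simp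
  qed (use assms in auto)
  then obtain S where S: "{v, w} \<subseteq> S" "right_basis S" by (rule right_basis_extend)
  have "(if s = v then 0 else w) \<in> V" for s using assms(3) V_0 by simp
  then obtain g where "\<forall>s\<in>S. dact T g s = (if s = v then 0 else w)"
    using density[OF S(2), of "\<lambda>s. if s = v then 0 else w"] by blast
  then show ?thesis using S(1) \<open>v \<noteq> w\<close> by (intro exI[of _ g]) auto
qed

end

section \<open>The Petit algebra attached to a cyclic vector\<close>

context split_division_algebra_with_connection
begin

text \<open>
  If \<open>g v = 0\<close>, division by \<open>g\<close> shows that \<open>v\<close> generates a space of dimension at most \<open>deg g\<close> over \<open>K\<close>. But
  it generates all of \<open>V\<close>.
\<close>

lemma annihilator_degree:
  assumes v: "v \<in> V" "v \<noteq> 0" and g: "g \<noteq> 0" "dact T g v = 0"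
  shows "degree g \<ge> m"
proof (rule ccontr)
  assume "\<not> ?thesis"
  then have less: "degree g < m" by simp
  have deg: "degree g > 0"
  proof (rule ccontr)
    assume "\<not> degree g > 0"
    then obtain a where "g = [:a:]" using degree_eq_zeroE by blast
    then show False using g v by simp
  qed
  have "\<exists>r. degree r < degree g \<and> dact T r v = w" if "w \<in> V" for w
  proof -
    have "\<exists>h. dact T h v = w" using v that by (rule every_vector_cyclic)
    then obtain h where h: "dact T h v = w" by blast
    obtain q r where "degree r < degree g" "h = diff_mult \<delta> q g + r"
      using right_division[OF der deg] by blast
    then show ?thesis using h g(2) by (auto simp: dact_add_left M.dact_diff_mult)
  qed
  moreover have "Polynomial.monom 1 j \<in> V" if "j < m" for j
    using that degree_monom_le[of "1::'k" j] by (simp add: V_def)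
  ultimately have "\<exists>r. j < m \<longrightarrow> degree r < degree g \<and> dact T r v = Polynomial.monom 1 j" for j
    by blast
  then obtain r where r: "\<And>j. j < m \<Longrightarrow> degree (r j) < degree g \<and> dact T (r j) v = Polynomial.monom 1 j"
    by metis
  obtain x where x: "\<exists>j\<in>{..<m}. x j \<noteq> 0" "\<And>i. i < degree g \<Longrightarrow> (\<Sum>j<m. Polynomial.coeff (r j) i * x j) = 0"
    using homogeneous_system[of "{..<degree g}" "{..<m}" "\<lambda>i j. Polynomial.coeff (r j) i"] less by auto
  have "(\<Sum>j<m. Polynomial.smult (x j) (r j)) = 0"
  proof (rule poly_eqI)
    fix i
    have "(\<Sum>j<m. x j * Polynomial.coeff (r j) i) = 0"
    proof (cases "i < degree g")
      case False
      then have "Polynomial.coeff (r j) i = 0" if "j < m" for j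
        using r[OF that] by (intro coeff_eq_0) simp
      then show ?thesis by simp
    qed (use x(2) in \<open>simp add: mult.commute\<close>)
    then show "Polynomial.coeff (\<Sum>j<m. Polynomial.smult (x j) (r j)) i = Polynomial.coeff 0 i"
      by (simp add: coeff_sum)
  qed
  then have "dact T (\<Sum>j<m. Polynomial.smult (x j) (r j)) v = 0" by simp
  then have "(\<Sum>j<m. Polynomial.monom (x j) j) = 0"
    using r by (simp add: dact_sum_left dact_smult_left smult_monom)
  moreover have "Polynomial.coeff (\<Sum>j<m. Polynomial.monom (x j) j) i = x i" if "i < m" for i
    using that by (simp add: coeff_sum)
  ultimately have "x i = 0" if "i < m" for i
    using that by (metis coeff_0)
  then show False using x(1) by auto
qed

text \<open>
  The \<open>m + 1\<close> vectors \<open>v, T v, \<dots>, T\<^sup>m v\<close> are dependent over \<open>K\<close>.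
\<close>

lemma monic_annihilator_exists:
  assumes v: "v \<in> V" "v \<noteq> 0"
  shows "\<exists>f. degree f = m \<and> lead_coeff f = 1 \<and> dact T f v = 0"
proof -
  obtain x where x: "\<exists>i\<in>{..m}. x i \<noteq> 0" "\<And>j. j < m \<Longrightarrow> (\<Sum>i\<le>m. Polynomial.coeff ((T ^^ i) v) j * x i) = 0"
    using homogeneous_system[of "{..<m}" "{..m}" "\<lambda>j i. Polynomial.coeff ((T ^^ i) v) j"] by auto
  define g where "g = (\<Sum>i\<le>m. Polynomial.monom (x i) i)"
  have coeff_g: "Polynomial.coeff g i = (if i \<le> m then x i else 0)" for i
    by (simp add: g_def coeff_sum if_distrib sum.delta cong: if_cong)
  have g: "g \<noteq> 0"
  proof
    assume "g = 0"
    then have "x i = 0" if "i \<le> m" for i using coeff_g[of i] that by simp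
    then show False using x(1) by auto
  qed
  have "dact T g v = 0"
  proof (rule poly_eqI)
    fix j
    have "Polynomial.coeff (dact T g v) j = (\<Sum>i\<le>m. Polynomial.coeff ((T ^^ i) v) j * x i)"
      by (simp add: g_def dact_sum_left dact_monom coeff_sum mult.commute)
    also have "\<dots> = 0"
    proof (cases "j < m")
      case False
      then show ?thesis using T_pow_V[OF v(1)]
        by (intro sum.neutral) (auto simp: V_def intro!: coeff_poly_less[of _ m])
    qed (rule x(2))
    finally show "Polynomial.coeff (dact T g v) j = Polynomial.coeff 0 j" by simp
  qed
  moreover have "degree g \<le> m" by (rule degree_le) (simp add: coeff_g)
  ultimately have "degree g = m" using annihilator_degree[OF v g] by simp
  then show ?thesis
    using g \<open>dact T g v = 0\<close> leading_coeff_0_iff[of g]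
    by (intro exI[of _ "Polynomial.smult (inverse (lead_coeff g)) g"]) (simp add: dact_smult_left)
qed

end

lemma const_polys_UNIV_iff: "g \<in> const_polys UNIV \<longleftrightarrow> degree g = 0"
  by (auto simp: const_polys_def elim: degree_eq_zeroE)

text \<open>
  The polynomial \<open>f\<close> generates the annihilator of \<open>u\<close>, so \<open>V\<close> is \<open>K[t;\<delta>]/K[t;\<delta>]f\<close> with \<open>u\<close> as the class
  of \<open>1\<close>.
\<close>

locale cyclic_presentation =
  split_division_algebra_with_connection emb scale B\<^sub>K B\<^sub>D m \<psi> \<delta> c
  for emb :: "'f::field \<Rightarrow> 'k::field" and scale :: "'f \<Rightarrow> 'd::ring_1 \<Rightarrow> 'd"
    and B\<^sub>K B\<^sub>D m \<psi> \<delta> c +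
  fixes f u :: "'k poly"
  assumes u: "u \<in> V" "u \<noteq> 0" and degree_f: "degree f = m" and monic_f: "lead_coeff f = 1"
    and f_u: "dact T f u = 0"
    and m_ge_2: "m \<ge> 2" and m_less: "m < card B\<^sub>K"
begin

abbreviation S :: "('f, 'k poly) module" where
  "S \<equiv> petit_algebra emb \<delta> f"

definition pmul :: "'k poly \<Rightarrow> 'k poly \<Rightarrow> 'k poly" where
  "pmul g h = mod_r \<delta> (diff_mult \<delta> g h) f"

lemma S_simps [simp]:
  "carrier S = V" "mult S = pmul" "one S = 1" "zero S = 0" "add S = (+)"
  "module.smult S = (\<lambda>a. Polynomial.smult (emb a))"
  by (auto simp: petit_algebra_def V_def degree_f pmul_def fun_eq_iff)

lemma degree_f_pos: "degree f > 0" using degree_f n_pos by simp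

lemma pmul_V: "pmul g h \<in> V"
  using mod_r_decomp(1)[OF der degree_f_pos] by (simp add: pmul_def V_def degree_f)

lemma dact_mod: "dact T (mod_r \<delta> g f) u = dact T g u"
proof -
  obtain q where "g = diff_mult \<delta> q f + mod_r \<delta> g f"
    using mod_r_decomp[OF der degree_f_pos] by blast
  then have "dact T g u = dact T (diff_mult \<delta> q f) u + dact T (mod_r \<delta> g f) u"
    by (metis dact_add_left)
  then show ?thesis by (simp add: M.dact_diff_mult f_u)
qed

text \<open>
  The identity through which all computations in the Petit algebra become computations with operators
  on \<open>V\<close>.
\<close>

lemma dact_pmul: "dact T (pmul g h) u = dact T g (dact T h u)"
  by (simp add: pmul_def dact_mod M.dact_diff_mult)

lemma dact_eq_0: "g \<in> V \<Longrightarrow> v \<in> V \<Longrightarrow> dact T g v = 0 \<Longrightarrow> g = 0 \<or> v = 0"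
  using annihilator_degree[of v g] by (auto simp: V_def)

lemma V_diff: "g \<in> V \<Longrightarrow> h \<in> V \<Longrightarrow> g - h \<in> V"
  by (simp add: V_def degree_diff_less)

lemma eq_if_dact_eq: "g \<in> V \<Longrightarrow> h \<in> V \<Longrightarrow> dact T g u = dact T h u \<Longrightarrow> g = h"
  using dact_eq_0[of "g - h" u] u V_diff[of g h] by (auto simp: dact_diff_left)

lemma ex_dact_eq:
  assumes "w \<in> V" shows "\<exists>g\<in>V. dact T g u = w"
proof -
  obtain g where "dact T g u = w" using every_vector_cyclic[OF u assms] by blast
  then show ?thesis
    using mod_r_decomp(1)[OF der degree_f_pos] dact_mod
    by (intro bexI[of _ "mod_r \<delta> g f"]) (auto simp: V_def degree_f)
qed

lemma \<delta>_emb: "\<delta> (emb a) = 0"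
  using Const_eq by (auto simp: Const_def)

lemma diff_mult_smult_emb:
  "diff_mult \<delta> g (Polynomial.smult (emb a) h) = Polynomial.smult (emb a) (diff_mult \<delta> g h)"
  by (rule diff_mult_smult_right[OF der \<delta>_emb])

lemma pmul_add_left: "pmul (g + g') h = pmul g h + pmul g' h"
  and pmul_add_right: "pmul g (h + h') = pmul g h + pmul g h'"
  and pmul_smult_left: "pmul (Polynomial.smult b g) h = Polynomial.smult b (pmul g h)"
  and pmul_smult_right: "pmul g (Polynomial.smult (emb a) h) = Polynomial.smult (emb a) (pmul g h)"
  by (simp_all add: pmul_def diff_mult_add_left diff_mult_add_right der mod_r_add mod_r_smult
      degree_f_pos diff_mult_smult_left diff_mult_smult_emb)

lemma pmul_one_left: "g \<in> V \<Longrightarrow> pmul 1 g = g"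
  using diff_mult_const[of \<delta> 1 g]
  by (simp add: pmul_def V_def degree_f mod_r_small der one_pCons)

lemma pmul_one_right: "g \<in> V \<Longrightarrow> pmul g 1 = g"
  by (simp add: pmul_def V_def degree_f mod_r_small der diff_mult_1_right)

text \<open>
  In \<open>f = g h\<close> with factors of smaller degree, \<open>g (h u) = 0\<close> although no nonzero polynomial of degree less
  than \<open>m\<close> kills a nonzero vector.
\<close>

theorem f_irreducible: "diff_irreducible \<delta> f"
  unfolding diff_irreducible_def
proof (intro conjI notI)
  assume "f \<in> Units (diff_poly_ring \<delta>)"
  then obtain y where y: "diff_mult \<delta> y f = 1" by (auto simp: Units_def diff_poly_ring_def)
  then have "y \<noteq> 0" by auto
  moreover have "f \<noteq> 0" using degree_f_pos by auto
  ultimately have "degree (diff_mult \<delta> y f) = degree y + degree f" by (rule degree_diff_mult[OF der])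
  then show False using y degree_f_pos by simp
next
  assume "\<exists>g h. degree g < degree f \<and> degree h < degree f \<and> f = diff_mult \<delta> g h"
  then obtain g h where gh: "g \<in> V" "h \<in> V" "f = diff_mult \<delta> g h" by (auto simp: V_def degree_f)
  have "dact T g (dact T h u) = 0" using f_u by (simp add: gh(3) M.dact_diff_mult)
  then have "g = 0 \<or> h = 0" using dact_eq_0 dact_V u gh by metis
  then have "f = 0" using gh(3) diff_mult_eq_0_iff[OF der] by blast
  then show False using degree_f_pos by simp
qed

lemma abelian_group_S: "abelian_group S"
proof (rule abelian_groupI)
  fix x assume "x \<in> carrier S"
  then show "\<exists>y\<in>carrier S. y \<oplus>\<^bsub>S\<^esub> x = \<zero>\<^bsub>S\<^esub>"
    by (intro bexI[of _ "- x"]) (auto simp: V_def)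
qed (auto simp: V_add V_0 algebra_simps)

lemma nonassoc_algebra_S: "nonassoc_algebra S"
  unfolding nonassoc_algebra_def
proof (intro conjI ballI allI)
  show "Module.module class_ring S"
    by (rule Module.moduleI)
       (auto simp: class_cring.is_cring abelian_group_S V_smult smult_add_left smult_add_right
          emb.hom_add emb.hom_mult)
qed (auto simp: pmul_V pmul_add_left pmul_add_right pmul_smult_left pmul_smult_right V_nonzero
      pmul_one_left pmul_one_right)

sublocale F: vector_space "\<lambda>a. Polynomial.smult (emb a)"
  by unfold_locales (auto simp: smult_add_left smult_add_right emb.hom_add emb.hom_mult)

definition monomial_basis :: "'k poly set" where
  "monomial_basis = (\<lambda>(j, b). Polynomial.monom b j) ` ({..<m} \<times> B\<^sub>K)"

lemma BK_nonzero: "b \<in> B\<^sub>K \<Longrightarrow> b \<noteq> 0"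
proof
  assume b: "b \<in> B\<^sub>K" "b = 0"
  have "(\<Sum>x\<in>B\<^sub>K. emb (if x = b then 1 else 0) * x) = 0"
    using b by (intro sum.neutral) auto
  from indep_BK[OF this b(1)] show False by simp
qed

lemma monomial_inj: "inj_on (\<lambda>(j, b). Polynomial.monom b j) ({..<m} \<times> B\<^sub>K)"
  using BK_nonzero by (auto simp: inj_on_def monom_eq_iff')

lemma finite_monomial_basis: "finite monomial_basis"
  by (simp add: monomial_basis_def finite_BK)

lemma card_monomial_basis: "card monomial_basis = m * card B\<^sub>K"
  unfolding monomial_basis_def by (simp add: card_image[OF monomial_inj] card_cartesian_product)

lemma coeff_monomial_combination:
  "Polynomial.coeff (\<Sum>g\<in>monomial_basis. Polynomial.smult (emb (x g)) g) i =
     (if i < m then \<Sum>b\<in>B\<^sub>K. emb (x (Polynomial.monom b i)) * b else 0)"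
proof -
  have "Polynomial.coeff (\<Sum>g\<in>monomial_basis. Polynomial.smult (emb (x g)) g) i =
      (\<Sum>j<m. \<Sum>b\<in>B\<^sub>K. emb (x (Polynomial.monom b j)) * (if j = i then b else 0))"
    unfolding monomial_basis_def sum.reindex[OF monomial_inj] coeff_sum
    by (simp add: sum.cartesian_product split_beta)
  also have "\<dots> = (\<Sum>j<m. if j = i then \<Sum>b\<in>B\<^sub>K. emb (x (Polynomial.monom b i)) * b else 0)"
    by (intro sum.cong) auto
  finally show ?thesis by simp
qed

lemma independent_monomial_basis: "F.independent monomial_basis"
proof (rule F.independent_if_scalars_zero[OF finite_monomial_basis])
  fix x g assume x: "(\<Sum>g\<in>monomial_basis. Polynomial.smult (emb (x g)) g) = 0" and "g \<in> monomial_basis"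
  then obtain j b where g: "j < m" "b \<in> B\<^sub>K" "g = Polynomial.monom b j" by (auto simp: monomial_basis_def)
  have "(\<Sum>b\<in>B\<^sub>K. emb (x (Polynomial.monom b j)) * b) = 0"
    using coeff_monomial_combination[of x j] g(1) x by simp
  from indep_BK[OF this g(2)] show "x g = 0" by (simp add: g(3))
qed

lemma span_monomial_basis: "F.span monomial_basis = V"
proof
  have "monomial_basis \<subseteq> V"
    by (auto simp: monomial_basis_def V_def intro: le_less_trans[OF degree_monom_le])
  moreover have "F.subspace V" by (rule F.subspaceI) (auto simp: V_0 V_add V_smult)
  ultimately show "F.span monomial_basis \<subseteq> V" by (rule F.span_minimal)
next
  show "V \<subseteq> F.span monomial_basis"
  proof
    fix g assume g: "g \<in> V"
    have "\<forall>z. \<exists>f. z = (\<Sum>b\<in>B\<^sub>K. emb (f b) * b)" using span_BK by blast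
    from choice[OF this] obtain r where r: "\<And>z. z = (\<Sum>b\<in>B\<^sub>K. emb (r z b) * b)" by blast
    have "g = (\<Sum>j<m. Polynomial.monom (Polynomial.coeff g j) j)"
      by (rule poly_eqI) (use g in \<open>auto simp: coeff_sum V_def coeff_poly_less if_distrib sum.delta cong: if_cong\<close>)
    also have "\<dots> = (\<Sum>j<m. \<Sum>b\<in>B\<^sub>K. Polynomial.smult (emb (r (Polynomial.coeff g j) b)) (Polynomial.monom b j))"
    proof (intro sum.cong refl)
      fix j
      have "Polynomial.monom (Polynomial.coeff g j) j =
          Polynomial.monom (\<Sum>b\<in>B\<^sub>K. emb (r (Polynomial.coeff g j) b) * b) j"
        by (simp flip: r)
      then show "Polynomial.monom (Polynomial.coeff g j) j =
          (\<Sum>b\<in>B\<^sub>K. Polynomial.smult (emb (r (Polynomial.coeff g j) b)) (Polynomial.monom b j))"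
        by (simp add: monom_sum smult_monom)
    qed
    also have "\<dots> \<in> F.span monomial_basis"
      by (intro F.span_sum F.span_scale F.span_base) (auto simp: monomial_basis_def)
    finally show "g \<in> F.span monomial_basis" .
  qed
qed

theorem dim_S: "algebra_dim S = m * card B\<^sub>K"
  unfolding algebra_dim_def S_simps
  by (rule F.dim_unique[OF _ _ independent_monomial_basis card_monomial_basis])
     (use span_monomial_basis F.span_superset in auto)

theorem division_algebra_S: "division_algebra S"
proof -
  have bij: "bij_betw L V V"
    if "\<And>x y. L (x + y) = L x + L y" "\<And>a x. L (Polynomial.smult (emb a) x) = Polynomial.smult (emb a) (L x)"
      "\<And>x. L x \<in> V" "\<And>x. x \<in> V \<Longrightarrow> L x = 0 \<Longrightarrow> x = 0" for L
  proof (rule bij_betw_imageI)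
    have diff: "L (x - y) = L x - L y" for x y using that(1)[of "x - y" y] by simp
    show "inj_on L V"
    proof (rule inj_onI)
      fix x y assume "x \<in> V" "y \<in> V" "L x = L y"
      then show "x = y" using that(4)[of "x - y"] V_diff diff by simp
    qed
    have "\<exists>x\<in>V. L x = w" if "w \<in> V" for w
      using F.injective_endomorphism_surjective[OF finite_monomial_basis independent_monomial_basis, of L w]
      unfolding span_monomial_basis using \<open>w \<in> V\<close> \<open>\<And>x y. L (x + y) = L x + L y\<close>
        \<open>\<And>a x. L (Polynomial.smult (emb a) x) = Polynomial.smult (emb a) (L x)\<close>
        \<open>\<And>x. L x \<in> V\<close> \<open>\<And>x. x \<in> V \<Longrightarrow> L x = 0 \<Longrightarrow> x = 0\<close> by blast
    then show "L ` V = V" using that(3) by blast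
  qed
  have no_zero_divisors: "g = 0 \<or> h = 0" if "g \<in> V" "h \<in> V" "pmul g h = 0" for g h
  proof -
    have "dact T g (dact T h u) = 0" using dact_pmul[of g h] that(3) by simp
    then have "g = 0 \<or> dact T h u = 0" using dact_eq_0 that dact_V u by blast
    then show ?thesis using dact_eq_0[of h u] u that by blast
  qed
  show ?thesis
    unfolding division_algebra_def
  proof (intro conjI ballI)
    show "nonassoc_algebra S" by (rule nonassoc_algebra_S)
    show "carrier S \<noteq> {\<zero>\<^bsub>S\<^esub>}" using V_nonzero by auto
    fix a assume "a \<in> carrier S - {\<zero>\<^bsub>S\<^esub>}"
    then have a: "a \<in> V" "a \<noteq> 0" by auto
    show "bij_betw (\<lambda>x. a \<otimes>\<^bsub>S\<^esub> x) (carrier S) (carrier S)"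
      unfolding S_simps
      by (rule bij) (use a no_zero_divisors pmul_V in \<open>auto simp: pmul_add_right pmul_smult_right\<close>)
    show "bij_betw (\<lambda>x. x \<otimes>\<^bsub>S\<^esub> a) (carrier S) (carrier S)"
      unfolding S_simps
      by (rule bij) (use a no_zero_divisors pmul_V in \<open>auto simp: pmul_add_left pmul_smult_left\<close>)
  qed
qed

text \<open>
  Applied to \<open>u\<close>, the product \<open>(x \<circ> y) \<circ> z\<close> gives \<open>(x y - q f) z u\<close> and \<open>x \<circ> (y \<circ> z)\<close> gives \<open>x y z u\<close>.
\<close>

lemma associator_eq_0_iff:
  assumes "x \<in> V" "y \<in> V" "z \<in> V" and q: "diff_mult \<delta> x y = diff_mult \<delta> q f + r" "degree r < m"
  shows "associator S x y z = \<zero>\<^bsub>S\<^esub> \<longleftrightarrow> dact T q (dact T f (dact T z u)) = 0"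
proof -
  have "pmul x y = r" unfolding pmul_def by (rule mod_r_eqI[OF der _ q(1)]) (simp add: q degree_f)
  then have eq: "dact T (pmul x y) v = dact T x (dact T y v) - dact T q (dact T f v)" for v
    using q(1) by (metis M.dact_diff_mult dact_add_left add_diff_cancel_left')
  have "associator S x y z = \<zero>\<^bsub>S\<^esub> \<longleftrightarrow> pmul (pmul x y) z = pmul x (pmul y z)"
    unfolding associator_def
    using abelian_group.minus_other_side[OF abelian_group_S, of "pmul (pmul x y) z" "pmul x (pmul y z)"]
    by (simp add: pmul_V)
  also have "\<dots> \<longleftrightarrow> dact T (pmul (pmul x y) z) u = dact T (pmul x (pmul y z)) u"
    using eq_if_dact_eq pmul_V by metis
  also have "\<dots> \<longleftrightarrow> dact T q (dact T f (dact T z u)) = 0"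
    by (simp add: dact_pmul eq)
  finally show ?thesis .
qed

lemma diff_mult_degree_m:
  assumes "x \<noteq> 0" "y \<noteq> 0" "degree x + degree y = m"
  obtains r where "diff_mult \<delta> x y = diff_mult \<delta> [:lead_coeff x * lead_coeff y:] f + r" "degree r < m"
proof -
  define r where "r = diff_mult \<delta> x y - Polynomial.smult (lead_coeff x * lead_coeff y) f"
  have "degree r \<le> m"
    unfolding r_def using degree_diff_mult[OF der assms(1,2)] assms(3) degree_f
    by (intro degree_diff_le) (auto simp: degree_smult_le intro: order_trans[OF degree_smult_le])
  moreover have "Polynomial.coeff r m = 0"
    using coeff_diff_mult_top[OF der, of x y] monic_f by (simp add: r_def assms(3) degree_f)
  ultimately have "degree r < m"
    using eq_zero_or_degree_less[of r m] n_pos by auto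
  then show ?thesis using that[of r] by (simp add: r_def diff_mult_const)
qed

text \<open>
  This uses \<open>m < card B\<^sub>K\<close>, the bound below which operators act faithfully.
\<close>

lemma f_not_annihilates: "\<exists>v\<in>V. dact T f v \<noteq> 0"
proof (rule ccontr)
  assume "\<not> ?thesis"
  then have "f = 0"
    using differential_module_faithful[OF M.differential_module_axioms, of V 1 f]
      V_nonzero V_smult m_less degree_f by blast
  then show False using degree_f_pos by simp
qed

lemma const_in_V: "[:a:] \<in> V" by (simp add: V_def n_pos)

text \<open>
  Multiplying \<open>x\<close> by the power of \<open>t\<close> that raises the degree to exactly \<open>m\<close> makes the quotient by \<open>f\<close> a nonzero
  constant. Vanishing associators then say that \<open>f\<close> annihilates \<open>V\<close>.
\<close>

lemma associative_left_factor_constant: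
  assumes x: "x \<in> V" and assoc: "\<And>y z. y \<in> V \<Longrightarrow> z \<in> V \<Longrightarrow> associator S x y z = \<zero>\<^bsub>S\<^esub>"
  shows "x \<in> const_polys UNIV"
proof (rule ccontr)
  assume "x \<notin> const_polys UNIV"
  then have deg: "degree x > 0" by (simp add: const_polys_UNIV_iff)
  define y where "y = Polynomial.monom (1::'k) (m - degree x)"
  have degx: "degree x < m" using x by (simp add: V_def)
  have y: "y \<noteq> 0" "degree y = m - degree x" "lead_coeff y = 1"
    by (auto simp: y_def degree_monom_eq)
  have "y \<in> V" using deg degx by (simp add: V_def y)
  have "x \<noteq> 0" using deg by auto
  obtain r where r: "diff_mult \<delta> x y = diff_mult \<delta> [:lead_coeff x * lead_coeff y:] f + r" "degree r < m"
    using diff_mult_degree_m[of x y] \<open>x \<noteq> 0\<close> y degx by auto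
  obtain v where v: "v \<in> V" "dact T f v \<noteq> 0" using f_not_annihilates by blast
  obtain z where z: "z \<in> V" "dact T z u = v" using ex_dact_eq[OF v(1)] by blast
  have "dact T [:lead_coeff x * lead_coeff y:] (dact T f v) = 0"
    using assoc[OF \<open>y \<in> V\<close> z(1)] associator_eq_0_iff[OF x \<open>y \<in> V\<close> z(1) r] z(2) by simp
  then show False using v(2) \<open>x \<noteq> 0\<close> y by simp
qed

lemma associative_middle_factor_constant:
  assumes y: "y \<in> V" and assoc: "\<And>x z. x \<in> V \<Longrightarrow> z \<in> V \<Longrightarrow> associator S x y z = \<zero>\<^bsub>S\<^esub>"
  shows "y \<in> const_polys UNIV"
proof (rule ccontr)
  assume "y \<notin> const_polys UNIV"
  then have deg: "degree y > 0" by (simp add: const_polys_UNIV_iff)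
  define x where "x = Polynomial.monom (1::'k) (m - degree y)"
  have degy: "degree y < m" using y by (simp add: V_def)
  have x: "x \<noteq> 0" "degree x = m - degree y" "lead_coeff x = 1"
    by (auto simp: x_def degree_monom_eq)
  have "x \<in> V" using deg degy by (simp add: V_def x)
  have "y \<noteq> 0" using deg by auto
  obtain r where r: "diff_mult \<delta> x y = diff_mult \<delta> [:lead_coeff x * lead_coeff y:] f + r" "degree r < m"
    using diff_mult_degree_m[of x y] \<open>y \<noteq> 0\<close> x degy by auto
  obtain v where v: "v \<in> V" "dact T f v \<noteq> 0" using f_not_annihilates by blast
  obtain z where z: "z \<in> V" "dact T z u = v" using ex_dact_eq[OF v(1)] by blast
  have "dact T [:lead_coeff x * lead_coeff y:] (dact T f v) = 0"
    using assoc[OF \<open>x \<in> V\<close> z(1)] associator_eq_0_iff[OF \<open>x \<in> V\<close> y z(1) r] z(2) by simp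
  then show False using v(2) \<open>y \<noteq> 0\<close> x by simp
qed

lemma associator_small:
  assumes "x \<in> V" "y \<in> V" "z \<in> V" "degree x + degree y < m"
  shows "associator S x y z = \<zero>\<^bsub>S\<^esub>"
proof -
  have "degree (diff_mult \<delta> x y) < m" using degree_diff_mult_le[OF der, of x y] assms(4) by simp
  then show ?thesis using associator_eq_0_iff[OF assms(1-3), of 0 "diff_mult \<delta> x y"] by simp
qed

theorem Nuc_l_eq: "Nuc_l S = const_polys UNIV"
proof
  show "Nuc_l S \<subseteq> const_polys UNIV"
    using associative_left_factor_constant by (auto simp: Nuc_l_def)
  show "const_polys UNIV \<subseteq> Nuc_l S"
    using associator_small const_in_V by (auto simp: Nuc_l_def const_polys_def V_def)
qed

theorem Nuc_m_eq: "Nuc_m S = const_polys UNIV"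
proof
  show "Nuc_m S \<subseteq> const_polys UNIV"
    using associative_middle_factor_constant by (auto simp: Nuc_m_def)
  show "const_polys UNIV \<subseteq> Nuc_m S"
    using associator_small const_in_V by (auto simp: Nuc_m_def const_polys_def V_def)
qed

text \<open>
  For the product \<open>t t\<^sup>m\<^sup>-\<^sup>1\<close> the quotient by \<open>f\<close> is \<open>1\<close>; here \<open>m \<ge> 2\<close> is needed to have both factors in the algebra.
\<close>

theorem Nuc_r_eq: "Nuc_r S = {z \<in> V. dact T f (dact T z u) = 0}"
proof
  show "{z \<in> V. dact T f (dact T z u) = 0} \<subseteq> Nuc_r S"
  proof safe
    fix z assume z: "z \<in> V" "dact T f (dact T z u) = 0"
    have "associator S x y z = \<zero>\<^bsub>S\<^esub>" if "x \<in> V" "y \<in> V" for x y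
    proof -
      obtain q r where "degree r < m" "diff_mult \<delta> x y = diff_mult \<delta> q f + r"
        using right_division[OF der degree_f_pos, of "diff_mult \<delta> x y"] degree_f by blast
      then show ?thesis using associator_eq_0_iff[OF that z(1)] z(2) by simp
    qed
    then show "z \<in> Nuc_r S" using z by (simp add: Nuc_r_def)
  qed
next
  show "Nuc_r S \<subseteq> {z \<in> V. dact T f (dact T z u) = 0}"
  proof safe
    fix z assume z: "z \<in> Nuc_r S"
    then show zV: "z \<in> V" by (simp add: Nuc_r_def)
    define x y where "x = Polynomial.monom (1::'k) 1" and "y = Polynomial.monom (1::'k) (m - 1)"
    have xy: "x \<noteq> 0" "degree x = 1" "lead_coeff x = 1" "y \<noteq> 0" "degree y = m - 1" "lead_coeff y = 1"
      by (auto simp: x_def y_def degree_monom_eq)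
    have V: "x \<in> V" "y \<in> V" using m_ge_2 by (auto simp: V_def xy)
    obtain r where r: "diff_mult \<delta> x y = diff_mult \<delta> [:lead_coeff x * lead_coeff y:] f + r" "degree r < m"
      using diff_mult_degree_m[of x y] xy m_ge_2 by auto
    have "associator S x y z = \<zero>\<^bsub>S\<^esub>" using z V by (simp add: Nuc_r_def)
    then show "dact T f (dact T z u) = 0"
      using associator_eq_0_iff[OF V zV r] xy by simp
  qed
qed

text \<open>
  If \<open>z u\<close> is not in \<open>u D\<close>, some \<open>g\<close> kills \<open>u\<close> but fixes \<open>z u \<noteq> 0\<close>. Then \<open>g = q f\<close>, so \<open>f z u\<close> cannot vanish.
\<close>

lemma Nuc_r_iff_act: "z \<in> Nuc_r S \<longleftrightarrow> z \<in> V \<and> (\<exists>d. dact T z u = act u d)"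
proof
  assume z: "z \<in> Nuc_r S"
  then have zV: "z \<in> V" and fz: "dact T f (dact T z u) = 0" by (auto simp: Nuc_r_eq)
  have "\<exists>d. dact T z u = act u d"
  proof (rule ccontr)
    assume contra: "\<not> ?thesis"
    then obtain g where g: "dact T g u = 0" "dact T g (dact T z u) = dact T z u"
      using separating_operator[OF u dact_V[OF u(1)], of z] by blast
    obtain q r where qr: "degree r < m" "g = diff_mult \<delta> q f + r"
      using right_division[OF der degree_f_pos, of g] degree_f by blast
    have "dact T r u = 0" using g(1) by (simp add: qr(2) dact_add_left M.dact_diff_mult f_u)
    then have "r = 0" using dact_eq_0[of r u] u qr(1) by (auto simp: V_def)
    then have "dact T z u = 0" using g(2) fz qr(2) by (simp add: M.dact_diff_mult)
    then show False using contra act_0_right[of u] by metis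
  qed
  then show "z \<in> V \<and> (\<exists>d. dact T z u = act u d)" using zV by blast
next
  assume "z \<in> V \<and> (\<exists>d. dact T z u = act u d)"
  then show "z \<in> Nuc_r S" by (auto simp: Nuc_r_eq dact_act u f_u)
qed

definition \<phi> :: "'d \<Rightarrow> 'k poly" where
  "\<phi> d = (SOME g. g \<in> V \<and> dact T g u = act u d)"

lemma \<phi>: "\<phi> d \<in> V" "dact T (\<phi> d) u = act u d"
proof -
  have "\<exists>g. g \<in> V \<and> dact T g u = act u d" using ex_dact_eq[OF act_V] by blast
  from someI_ex[OF this] show "\<phi> d \<in> V" "dact T (\<phi> d) u = act u d" by (auto simp: \<phi>_def)
qed

lemma \<phi>_eqI: "g \<in> V \<Longrightarrow> dact T g u = act u d \<Longrightarrow> \<phi> d = g"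
  by (rule eq_if_dact_eq) (auto simp: \<phi>)

text \<open>
  The map is multiplicative, not antimultiplicative, because \<open>D\<close> acts on \<open>V\<close> from the right:
  \<open>\<phi> x (\<phi> y u) = (\<phi> x u) y = u x y\<close>.
\<close>

theorem \<phi>_iso: "\<phi> \<in> algebra_iso (type_algebra scale) (S\<lparr>carrier := Nuc_r S\<rparr>)"
proof -
  have range: "\<phi> ` UNIV = Nuc_r S"
    using \<phi> \<phi>_eqI by (auto simp: Nuc_r_iff_act image_iff) metis
  have "inj \<phi>"
  proof (rule injI)
    fix x y assume "\<phi> x = \<phi> y"
    then have "act u x = act u y" using \<phi>(2) by metis
    then have "act u (x + (- y)) = 0" by (simp only: act_add_right act_minus_right) simp
    then show "x = y" using act_eq_0_iff[OF u(1)] u(2) by simp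
  qed
  then have "bij_betw \<phi> UNIV (Nuc_r S)" using range by (simp add: bij_betw_def)
  moreover have "\<phi> (x * y) = pmul (\<phi> x) (\<phi> y)" for x y
    by (rule \<phi>_eqI) (auto simp: pmul_V dact_pmul \<phi> dact_act u act_mult)
  moreover have "\<phi> (x + y) = \<phi> x + \<phi> y" for x y
    by (rule \<phi>_eqI) (auto simp: V_add dact_add_left \<phi> act_add_right)
  moreover have "\<phi> 1 = 1"
    by (rule \<phi>_eqI) (auto simp: V_nonzero act_one u)
  moreover have "\<phi> (scale a x) = Polynomial.smult (emb a) (\<phi> x)" for a x
    by (rule \<phi>_eqI) (auto simp: V_smult dact_smult_left \<phi> act_scale)
  ultimately show ?thesis
    using range
    by (auto simp: algebra_iso_def ring_iso_def type_algebra_def intro!: ring_hom_memI)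
qed

text \<open>
  The elements of \<open>K\<close> that lie in the right nucleus, described through the action of \<open>D\<close> on \<open>u\<close>.
\<close>

definition L :: "'k set" where
  "L = {a. \<exists>d. Polynomial.smult a u = act u d}"

lemma const_in_Nuc_r_iff: "[:a:] \<in> Nuc_r S \<longleftrightarrow> a \<in> L"
  by (simp add: Nuc_r_iff_act L_def const_in_V)

lemma Nuc_eq: "Nuc S = const_polys L"
  unfolding Nuc_def Nuc_l_eq Nuc_m_eq using const_in_Nuc_r_iff by (auto simp: const_polys_def)

lemma emb_in_L: "range emb \<subseteq> L"
proof
  fix x assume "x \<in> range emb"
  then obtain a where "x = emb a" by blast
  then have "Polynomial.smult x u = act u (scale a 1)" by (simp add: act_scale act_one u)
  then show "x \<in> L" by (auto simp: L_def)
qed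

text \<open>
  If \<open>K\<close> were contained in the right nucleus, every \<open>f a - a f\<close> would kill \<open>u\<close>. Its degree is less than \<open>m\<close>, so
  it would vanish, and \<open>f\<close> would commute with \<open>K\<close>.
\<close>

lemma L_neq_UNIV: "L \<noteq> UNIV"
proof
  assume "L = UNIV"
  have "degree f = 0"
  proof (rule commuting_with_coefficients_imp_constant)
    show "degree f < card B\<^sub>K" using m_less degree_f by simp
    fix a
    define h where "h = diff_mult \<delta> f [:a:] - Polynomial.smult a f"
    have "[:a:] \<in> Nuc_r S" using \<open>L = UNIV\<close> const_in_Nuc_r_iff by simp
    then have "dact T h u = 0"
      by (simp add: h_def dact_diff_left M.dact_diff_mult dact_smult_left f_u Nuc_r_eq)
    moreover have "h \<in> V"
    proof -
      have "degree h \<le> degree f"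
        unfolding h_def using degree_diff_mult_le[OF der, of f "[:a:]"]
        by (intro degree_diff_le) (auto simp: degree_smult_le)
      moreover have "Polynomial.coeff h (degree f) = 0"
        using coeff_diff_mult_top[OF der, of f "[:a:]"] by (simp add: h_def)
      ultimately show ?thesis
        using eq_zero_or_degree_less[of h "degree f"] degree_f_pos by (auto simp: V_def degree_f)
    qed
    ultimately have "h = 0" using dact_eq_0 u by blast
    then show "diff_mult \<delta> f [:a:] = Polynomial.smult a f" by (simp add: h_def)
  qed
  then show False using degree_f_pos by simp
qed

lemma L_subfield: "subfield L class_ring"
proof (rule field.subfieldI'[OF class_field])
  show "subring L class_ring"
  proof (rule ring.subringI)
    show "ring (class_ring :: 'k ring)" using class_cring.is_cring by (rule cring.axioms(1))
    show "\<one>\<^bsub>class_ring\<^esub> \<in> L" using emb_in_L emb.hom_one by force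
    fix a b assume "a \<in> L" "b \<in> L"
    then obtain x y where xy: "Polynomial.smult a u = act u x" "Polynomial.smult b u = act u y"
      by (auto simp: L_def)
    have "Polynomial.smult (a + b) u = act u (x + y)" by (simp add: smult_add_left act_add_right xy)
    then show "a \<oplus>\<^bsub>class_ring\<^esub> b \<in> L" by (auto simp: L_def)
    have "Polynomial.smult (a * b) u = act (Polynomial.smult a u) y"
      by (simp add: act_smult flip: xy)
    then have "Polynomial.smult (a * b) u = act u (x * y)" by (simp add: xy act_mult)
    then show "a \<otimes>\<^bsub>class_ring\<^esub> b \<in> L" by (auto simp: L_def)
    have "Polynomial.smult (- a) u = act u (- x)" by (simp add: act_minus_right flip: xy)
    moreover have "\<ominus>\<^bsub>class_ring\<^esub> a = - a"
      by (rule abelian_group.minus_equality) (use class_cring.is_cring in \<open>auto simp: cring_def ring_def\<close>)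
    ultimately show "\<ominus>\<^bsub>class_ring\<^esub> a \<in> L" by (auto simp: L_def)
  qed auto
  fix a assume "a \<in> L - {\<zero>\<^bsub>class_ring :: 'k ring\<^esub>}"
  then have a: "a \<in> L" "a \<noteq> 0" by auto
  then obtain x where x: "Polynomial.smult a u = act u x" by (auto simp: L_def)
  have "x \<noteq> 0" using x a u by auto
  then obtain y where y: "x * y = 1" using inverse_ex by blast
  have "Polynomial.smult a (act u y) = act (act u x) y" by (simp add: act_smult flip: x)
  also have "\<dots> = u" by (simp add: y act_one u flip: act_mult)
  finally have "Polynomial.smult (inverse a) u = Polynomial.smult (inverse a) (Polynomial.smult a (act u y))"
    by simp
  then have "Polynomial.smult (inverse a) u = act u y" using a by simp
  moreover have "inv\<^bsub>class_ring\<^esub> a = inverse a"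
    by (rule comm_monoid.comm_inv_char)
       (use class_cring.is_cring a in \<open>auto simp: cring_def\<close>)
  ultimately show "inv\<^bsub>class_ring\<^esub> a \<in> L" by (auto simp: L_def)
qed

end

section \<open>Every split division algebra is the right nucleus of a Petit algebra\<close>

theorem corollary16:
  fixes emb :: "'f::field \<Rightarrow> 'k::field"
    and scale :: "'f \<Rightarrow> 'd::ring_1 \<Rightarrow> 'd"
    and p m e :: nat
  assumes "CHAR('f) = p" and "p > 0"
    and "p_algebra p scale"
    and "division_algebra (type_algebra scale)"
    and "algebra_degree (type_algebra scale) = real m" and "m \<ge> 2"
    and "field_hom emb"
    and "purely_inseparable emb" and "exponent_one emb"
    and "algebra_dim (extension_algebra emb) = p ^ e"
    and "splits scale emb"
    and "m < algebra_dim (extension_algebra emb)"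
  shows "\<exists>\<delta> f. derivation \<delta> \<and> Const \<delta> = range emb \<and>
           diff_irreducible \<delta> f \<and> degree f = m \<and>
           (let S = petit_algebra emb \<delta> f; K = const_polys UNIV in
              division_algebra S \<and> algebra_dim S = m * p ^ e \<and>
              (\<exists>\<phi>\<in>algebra_iso (type_algebra scale) (S\<lparr>carrier := Nuc_r S\<rparr>).
                 Nuc_l S = K \<and> Nuc_m S = K \<and>
                 Nuc S = range \<phi> \<inter> K \<and>
                 (\<exists>L. Nuc S = const_polys L \<and> subfield L class_ring \<and>
                      range emb \<subseteq> L \<and> L \<noteq> UNIV)))"
proof -
  interpret emb: field_hom emb by fact
  have of_nat_p: "emb (of_nat n) = of_nat n" for n by (induction n) (simp_all add: emb.hom_add)
  have "of_nat p = (0::'k)"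
    using of_nat_p[of p] assms(1) by (metis emb.hom_zero of_nat_CHAR)
  then have "CHAR('k) > 0" using assms(2) by (auto simp: CHAR_pos_iff)
  then have "prime CHAR('k)" by (rule prime_CHAR_semidom)
  then interpret K: exponent_one_extension emb
    using assms(9) by unfold_locales (auto simp: exponent_one_def)
  interpret KV: vector_space "\<lambda>c x. emb c * x" by (rule K.vector_space_emb)
  have dim_K: "KV.dim UNIV = p ^ e"
    using assms(10) by (simp add: algebra_dim_def extension_algebra_def type_algebra_def)
  then have dim_K_pos: "KV.dim UNIV > 0" using assms(2) by simp
  then obtain \<delta> where \<delta>: "derivation \<delta>" "Const \<delta> = range emb"
    using K.exists_derivation_with_constants by blast
  obtain B\<^sub>K :: "'k set" where BK: "KV.independent B\<^sub>K" "UNIV \<subseteq> KV.span B\<^sub>K" "card B\<^sub>K = p ^ e"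
    using KV.basis_exists[of UNIV] dim_K by metis
  have finite_BK: "finite B\<^sub>K" using BK(3) assms(2) by (intro card_ge_0_finite) simp
  have cs: "central_simple (type_algebra scale)" using assms(3) by (simp add: p_algebra_def)
  have na: "nonassoc_algebra (type_algebra scale)" using cs by (simp add: central_simple_def)
  have "Module.module class_ring (type_algebra scale)"
    using na by (simp add: nonassoc_algebra_def)
  then have D_module: "scale (a + b) x = scale a x + scale b x" "scale a (x + y) = scale a x + scale a y"
    "scale (a * b) x = scale a (scale b x)" "scale 1 x = x" for a b x y
    unfolding Module.module_def Module.module_axioms_def by (auto simp: type_algebra_def)
  interpret DV: vector_space scale by unfold_locales (auto simp: D_module)
  have "algebra_degree (type_algebra scale) = sqrt (real (DV.dim UNIV))"
    by (simp add: algebra_degree_def algebra_dim_def type_algebra_def)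
  then have "real (DV.dim UNIV) = (real m)\<^sup>2"
    using assms(5) by (metis of_nat_0_le_iff real_sqrt_pow2)
  then have dim_D: "DV.dim UNIV = m * m" by (simp add: power2_eq_square flip: of_nat_mult)
  obtain B\<^sub>D :: "'d set" where BD: "DV.independent B\<^sub>D" "UNIV \<subseteq> DV.span B\<^sub>D" "card B\<^sub>D = m * m"
    using DV.basis_exists[of UNIV] dim_D by metis
  have finite_BD: "finite B\<^sub>D" using BD(3) assms(6) by (intro card_ge_0_finite) simp
  obtain n \<psi> where n: "n > 0" "spanning_matrix_representation scale emb n \<psi>"
    using splits_imp_matrix_representation[OF assms(11)] by blast
  interpret D: split_division_algebra emb scale B\<^sub>K B\<^sub>D n \<psi>
  proof
    fix c x y
    show "scale c x * y = scale c (x * y)" "x * scale c y = scale c (x * y)"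
      using na unfolding nonassoc_algebra_def type_algebra_def by simp_all
  next
    fix x :: 'd assume "x \<noteq> 0"
    then have "bij_betw (\<lambda>y. x * y) UNIV UNIV" "bij_betw (\<lambda>y. y * x) UNIV UNIV"
      using assms(4) unfolding division_algebra_def type_algebra_def by auto
    then obtain y z where yz: "x * y = 1" "z * x = 1"
      by (metis bij_betw_def imageE UNIV_I)
    then have "z = y" by (metis mult.assoc mult_1 mult.right_neutral)
    then show "\<exists>y. y * x = 1 \<and> x * y = 1" using yz by blast
  next
    fix x :: 'd assume "\<And>y. x * y = y * x"
    then have "x \<in> {z. \<forall>x. z * x = x * z}" by blast
    also have "\<dots> = range (\<lambda>c. scale c 1)"
      using cs unfolding central_simple_def type_algebra_def by simp
    finally show "\<exists>c. x = scale c 1" by blast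
  next
    show "(1::'d) \<noteq> 0" using cs by (simp add: central_simple_def type_algebra_def)
  next
    fix f b assume "(\<Sum>b\<in>B\<^sub>K. emb (f b) * b) = 0" "b \<in> B\<^sub>K"
    then show "f b = 0" using KV.independentD[OF BK(1) finite_BK order_refl] by blast
  next
    fix a show "\<exists>f. a = (\<Sum>b\<in>B\<^sub>K. emb (f b) * b)"
      using BK(2) KV.span_finite[OF finite_BK] by blast
  next
    fix f d assume "(\<Sum>d\<in>B\<^sub>D. scale (f d) d) = 0" "d \<in> B\<^sub>D"
    then show "f d = 0" using DV.independentD[OF BD(1) finite_BD order_refl] by blast
  next
    fix x show "\<exists>f. x = (\<Sum>d\<in>B\<^sub>D. scale (f d) d)"
      using BD(2) DV.span_finite[OF finite_BD] by blast
  qed (use finite_BK finite_BD n in blast)+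
  have "n * n = m * m" using D.card_BD BD(3) by simp
  then have "n = m" by (metis power2_eq_square power_eq_imp_eq_base zero_le zero_less_numeral)
  have "\<delta> (emb a) = 0" for a using \<delta>(2) by (auto simp: Const_def)
  then obtain c where c: "\<And>y i j. i < n \<Longrightarrow> j < n \<Longrightarrow>
      \<delta> (\<psi> y i j) = (\<Sum>k<n. c i k * \<psi> y k j) - (\<Sum>k<n. \<psi> y i k * c k j)"
    using D.derivation_of_representation_inner[OF \<delta>(1)] by blast
  interpret split_division_algebra_with_connection emb scale B\<^sub>K B\<^sub>D m \<psi> \<delta> c
    using D.split_division_algebra_axioms \<delta> c
    by (simp add: split_division_algebra_with_connection_def
        split_division_algebra_with_connection_axioms_def \<open>n = m\<close>)
  \<comment> \<open>Any nonzero vector would do in place of 1, the first unit vector.\<close>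
  obtain f where f: "degree f = m" "lead_coeff f = 1" "dact T f 1 = 0"
    using monic_annihilator_exists[OF V_nonzero] by blast
  interpret cyclic_presentation emb scale B\<^sub>K B\<^sub>D m \<psi> \<delta> c f 1
    using V_nonzero f assms(6,10,12) BK(3) by unfold_locales auto
  have "range \<phi> = Nuc_r S"
    using \<phi>_iso by (auto simp: algebra_iso_def ring_iso_def bij_betw_def type_algebra_def)
  then have "Nuc S = range \<phi> \<inter> const_polys UNIV"
    by (auto simp: Nuc_def Nuc_l_eq Nuc_m_eq)
  then show ?thesis
    using \<delta> f_irreducible f(1) division_algebra_S dim_S BK(3) \<phi>_iso Nuc_l_eq Nuc_m_eq Nuc_eq
      L_subfield emb_in_L L_neq_UNIV
    unfolding Let_def by metis
qed

end
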